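(* Let $\mathcal I=\mathbb R_+=[0,\infty)$ and let $X=\{x_n\}_{n=1}^\infty$, $d_n=x_n-x_{n-1}$ with $\sup_nd_n<\infty$ be as in the context. Then for any $\beta=\{\beta_n\}_{n=1}^\infty\subset\mathbb R\setminus\{0\}$ the spectrum of the operator $\mathrm H_{X,\beta}$ is not discrete if at least one of the following conditions is satisfied: (i) $\{d_n\}_{n=1}^\infty\notin l_3$; (ii) $\{d_n\}_{n=1}^\infty\in l_3$ and $$\lim_{n\to\infty}x_n\sum_{j=n}^\infty d_j^3>0 .$$
   Context: $X=\{x_n\}_{n=1}^\infty$, $0=x_0<x_1<x_2<\dots$, $\lim_nx_n=+\infty$; $d_n=x_n-x_{n-1}$, $\sup_nd_n<\infty$; $\beta_n\neq0$ for all $n$. $W^{2,2}(\mathcal I\setminus X)=\{f\in L^2(\mathcal I): f,f'\in AC_{loc}(\mathcal I\setminus X),\ f''\in L^2(\mathcal I)\}$, and $W^{2,2}_{\mathrm{comp}}(\mathcal I\setminus X)$ is the set of its elements with compact support in $\mathcal I=[0,\infty)$. $\mathrm H_{X,\beta}$ is the closure in $L^2(\mathcal I)$ of the symmetric operator $-\mathrm d^2/\mathrm dx^2$ with domain $$\{f\in W^{2,2}_{\mathrm{comp}}(\mathcal I\setminus X): f'(0+)=0,\ f'(x_n+)=f'(x_n-),\ f(x_n+)-f(x_n-)=\beta_nf'(x_n),\ n\in\mathbb N\};$$ for $\mathcal I=\mathbb R_+$ it is self-adjoint. A self-adjoint operator has discrete spectrum if its spectrum consists only of isolated eigenvalues of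 finite multiplicity. *)

theory Defs
  imports "HOL-Analysis.Analysis"
begin

section \<open>The Hilbert space of square integrable functions on the half line\<close>

text \<open>
  Elements of \<open>L\<^sup>2([0,\<infinity>))\<close> are represented by functions \<open>real \<Rightarrow> complex\<close>, whose values on the
  negative half line are irrelevant.  Functions that agree almost everywhere on \<open>[0,\<infinity>)\<close> represent
  the same element; every notion below that concerns elements of the Hilbert space is formulated
  modulo this identification.
\<close>

abbreviation leb_half_line :: "real measure" where
  "leb_half_line \<equiv> lebesgue_on {0..}"

definition L2 :: "(real \<Rightarrow> complex) set" where
  "L2 = {f \<in> borel_measurable leb_half_line. integrable leb_half_line (\<lambda>y. (cmod (f y))\<^sup>2)}"

definition L2_norm :: "(real \<Rightarrow> complex) \<Rightarrow> real" where
  "L2_norm f = sqrt (LINT y|leb_half_line. (cmod (f y))\<^sup>2)"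

section \<open>Unbounded operators and their spectra\<close>

text \<open>
  An operator is given by its graph, a set of pairs \<open>(f, g)\<close> meaning that \<open>f\<close> lies in the domain
  and is mapped to \<open>g\<close>.
\<close>

type_synonym L2_operator = "((real \<Rightarrow> complex) \<times> (real \<Rightarrow> complex)) set"

text \<open>
  The graph of the closure consists of all representatives of the limits, so it is saturated under
  equality almost everywhere.
\<close>

definition closure_op :: "L2_operator \<Rightarrow> L2_operator" where
  "closure_op T = {(f, g). f \<in> L2 \<and> g \<in> L2 \<and>
     (\<exists>F G. (\<forall>k::nat. (F k, G k) \<in> T) \<and>
        (\<lambda>k. L2_norm (\<lambda>y. F k y - f y)) \<longlonglongrightarrow> 0 \<and>
        (\<lambda>k. L2_norm (\<lambda>y. G k y - g y)) \<longlonglongrightarrow> 0)}"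

text \<open>
  \<open>z\<close> is in the resolvent set iff \<open>T - z\<close> maps the domain of \<open>T\<close> onto \<open>L\<^sup>2\<close> and has a bounded
  inverse; the norm estimate contains injectivity.
\<close>

definition resolvent_set :: "L2_operator \<Rightarrow> complex set" where
  "resolvent_set T = {z.
     (\<forall>h\<in>L2. \<exists>(f, g)\<in>T. AE y in leb_half_line. g y - z * f y = h y) \<and>
     (\<exists>C. \<forall>(f, g)\<in>T. L2_norm f \<le> C * L2_norm (\<lambda>y. g y - z * f y))}"

definition spectrum :: "L2_operator \<Rightarrow> complex set" where
  "spectrum T = - resolvent_set T"

definition eigenspace :: "L2_operator \<Rightarrow> complex \<Rightarrow> (real \<Rightarrow> complex) set" where
  "eigenspace T z = {f. (f, \<lambda>y. z * f y) \<in> T}"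

definition is_eigenvalue :: "L2_operator \<Rightarrow> complex \<Rightarrow> bool" where
  "is_eigenvalue T z \<longleftrightarrow> (\<exists>f\<in>eigenspace T z. \<not> (AE y in leb_half_line. f y = 0))"

definition finite_multiplicity :: "L2_operator \<Rightarrow> complex \<Rightarrow> bool" where
  "finite_multiplicity T z \<longleftrightarrow>
     (\<exists>B. finite B \<and> B \<subseteq> eigenspace T z \<and>
        (\<forall>f\<in>eigenspace T z. \<exists>c. AE y in leb_half_line. f y = (\<Sum>b\<in>B. c b * b y)))"

definition discrete_spectrum :: "L2_operator \<Rightarrow> bool" where
  "discrete_spectrum T \<longleftrightarrow>
     (\<forall>z\<in>spectrum T. z isolated_in spectrum T \<and> is_eigenvalue T z \<and> finite_multiplicity T z)"

section \<open>The Sobolev space on the half line with a discrete set removed\<close>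

definition absolutely_continuous_on :: "real \<Rightarrow> real \<Rightarrow> (real \<Rightarrow> complex) \<Rightarrow> bool" where
  "absolutely_continuous_on a b f \<longleftrightarrow>
     (\<forall>\<epsilon>>0. \<exists>\<delta>>0. \<forall>D :: (real \<times> real) set.
        finite D \<and> (\<forall>(u, v)\<in>D. a \<le> u \<and> u \<le> v \<and> v \<le> b) \<and>
        disjoint_family_on (\<lambda>(u, v). {u<..<v}) D \<and> (\<Sum>(u, v)\<in>D. v - u) < \<delta>
        \<longrightarrow> (\<Sum>(u, v)\<in>D. cmod (f v - f u)) < \<epsilon>)"

definition AC_loc :: "real set \<Rightarrow> (real \<Rightarrow> complex) \<Rightarrow> bool" where
  "AC_loc S f \<longleftrightarrow> (\<forall>a b. a \<le> b \<and> {a..b} \<subseteq> S \<longrightarrow> absolutely_continuous_on a b f)"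

text \<open>At the endpoint \<open>0\<close> the derivative is one-sided.\<close>

definition deriv1 :: "(real \<Rightarrow> complex) \<Rightarrow> real \<Rightarrow> complex" where
  "deriv1 f y = vector_derivative f (at y within {0..})"

definition has_second_deriv :: "(real \<Rightarrow> complex) \<Rightarrow> (real \<Rightarrow> complex) \<Rightarrow> bool" where
  "has_second_deriv f h \<longleftrightarrow> (AE y in leb_half_line. (deriv1 f has_vector_derivative h y) (at y))"

text \<open>
  If \<open>f\<close> and \<open>f'\<close> are locally absolutely continuous, then \<open>f\<close> is differentiable at every point
  outside \<open>X\<close>; this is recorded explicitly because \<^const>\<open>vector_derivative\<close> is total.
\<close>

definition W22 :: "real set \<Rightarrow> (real \<Rightarrow> complex) set" where
  "W22 X = {f \<in> L2.
     AC_loc ({0..} - X) f \<and>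
     (\<forall>y\<in>{0..} - X. f differentiable (at y within {0..})) \<and>
     AC_loc ({0..} - X) (deriv1 f) \<and>
     (\<exists>h\<in>L2. has_second_deriv f h)}"

definition W22_comp :: "real set \<Rightarrow> (real \<Rightarrow> complex) set" where
  "W22_comp X = {f \<in> W22 X. compact (closure (support_on {0..} f))}"

section \<open>The operator with $\delta'$-interactions\<close>

text \<open>
  The sequences \<open>x\<close> and \<open>\<beta>\<close> are indexed by \<^typ>\<open>nat\<close>, where \<open>x 0 = 0\<close> is the left endpoint.
  The interaction points are the \<open>x n\<close> with \<open>n \<ge> 1\<close>, and \<open>\<beta> 0\<close> and \<open>gap x 0\<close> play no role.
\<close>

definition gap :: "(nat \<Rightarrow> real) \<Rightarrow> nat \<Rightarrow> real" where
  "gap x n = x n - x (n - 1)"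

definition interaction_points :: "(nat \<Rightarrow> real) \<Rightarrow> real set" where
  "interaction_points x = x ` {1..}"

definition delta_prime_condition :: "real \<Rightarrow> real \<Rightarrow> (real \<Rightarrow> complex) \<Rightarrow> bool" where
  "delta_prime_condition p b f \<longleftrightarrow>
     (\<exists>l r s. (f \<longlongrightarrow> l) (at_left p) \<and> (f \<longlongrightarrow> r) (at_right p) \<and>
        (deriv1 f \<longlongrightarrow> s) (at_left p) \<and> (deriv1 f \<longlongrightarrow> s) (at_right p) \<and>
        r - l = of_real b * s)"

definition H_dom :: "(nat \<Rightarrow> real) \<Rightarrow> (nat \<Rightarrow> real) \<Rightarrow> (real \<Rightarrow> complex) set" where
  "H_dom x \<beta> = {f \<in> W22_comp (interaction_points x).
     (deriv1 f \<longlongrightarrow> 0) (at_right 0) \<and>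
     (\<forall>n\<ge>1. delta_prime_condition (x n) (\<beta> n) f)}"

definition H_min :: "(nat \<Rightarrow> real) \<Rightarrow> (nat \<Rightarrow> real) \<Rightarrow> L2_operator" where
  "H_min x \<beta> = {(f, g). f \<in> H_dom x \<beta> \<and> g \<in> L2 \<and> has_second_deriv f (\<lambda>y. - g y)}"

definition H_op :: "(nat \<Rightarrow> real) \<Rightarrow> (nat \<Rightarrow> real) \<Rightarrow> L2_operator" where
  "H_op x \<beta> = closure_op (H_min x \<beta>)"

text \<open>The sequence space \<open>l\<^sub>p\<close> of sequences indexed by the positive integers.\<close>

definition ell :: "nat \<Rightarrow> (nat \<Rightarrow> real) set" where
  "ell p = {a. summable (\<lambda>n. \<bar>a (Suc n)\<bar> ^ p)}"

end

theory Submission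
  imports Defs
begin

text \<open>
  A \<open>C\<^sup>1\<close> function of compact support whose derivative vanishes at every \<open>x\<^sub>n\<close> is in the domain of the operator
  whatever the coupling constants are.  Such a function that equals 1 on \<open>[0, x\<^sub>i]\<close> and falls to 0 on
  \<open>[x\<^sub>i, x\<^sub>i\<^sub>+\<^sub>p]\<close>, by an amount proportional to \<open>d\<^sub>k\<^sup>3\<close> on the \<open>k\<close>-th interval, has
  \<open>\<parallel>f\<parallel>\<^sup>2 \<ge> x\<^sub>i\<close> and \<open>\<parallel>f''\<parallel>\<^sup>2 \<le> 36 / S\<close> with \<open>S\<close> the sum of the \<open>d\<^sub>k\<^sup>3\<close>.  Either hypothesis keeps
  \<open>x\<^sub>i S\<close> bounded away from 0 along some \<open>i \<rightarrow> \<infinity>\<close>, so the normalized functions are bounded in the graph norm; being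
  uniformly small, they tend weakly to 0.  A symmetric operator with discrete spectrum has a real regular value
  and a compact resolvent there, which excludes such a sequence.
\<close>

section \<open>Absolutely continuous functions\<close>

text \<open>The obstacle is to draw a compact resolvent out of the bare definition of discrete
  spectrum, without the spectral theorem. The substitute is one fact about a bounded symmetric
  operator: the infimum of its norms over a directed family of subspaces is, up to sign, an
  approximate eigenvalue. For the whole space alone this bounds s / (s^2 - t^2), applied to T minus
  an isolated point, uniformly in small t; for the subspaces of finite codimension the infimum is
  the essential norm of the resolvent, which must vanish. Only real points enter, so the Hilbert
  space is treated as a real one. The cubes are forced by an extremal problem: on an interval of
  length d, with zero derivative at both ends, a drop of size D costs at least 12 D^2 / d^3 in the
  squared norm of f''. By Cauchy-Schwarz a total drop of 1 is cheapest when split in proportion to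
  d^3, at cost 12 / S; a coarse pointwise bound of f'' turns 12 into 36.\<close>

text \<open>The exceptional set is handled by the gauge that makes the Riemann sums of its indicator small.\<close>

lemma absolutely_continuous_FTC:
  assumes "a \<le> b" and AC: "absolutely_continuous_on a b F" and N: "negligible N"
    and der: "\<And>y. y \<in> {a..b} - N \<Longrightarrow> (F has_vector_derivative f y) (at y within {a..b})"
  shows "(f has_integral (F b - F a)) {a..b}"
proof -
  \<comment> \<open>With \<open>f\<close> set to zero on \<open>N\<close>, tags in \<open>N\<close>
    contribute only increments of \<open>F\<close> over intervals of small total length, which
    absolute continuity controls.\<close>
  define f0 where "f0 y = (if y \<in> N then 0 else f y)" for y
  have "(f0 has_integral (F b - F a)) {a..b}"
    unfolding has_integral_real
  proof (intro allI impI)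
    fix e :: real assume "e > 0"
    define e1 where "e1 = e / (2 * (b - a + 1))"
    have "e1 > 0" unfolding e1_def using \<open>e > 0\<close> \<open>a \<le> b\<close> by auto
    have "e1 * (b - a) < e / 2" unfolding e1_def using \<open>e > 0\<close> \<open>a \<le> b\<close> by (simp add: field_simps)
    have "\<forall>x. \<exists>d>0. x \<in> {a..b} - N \<longrightarrow>
         (\<forall>y\<in>{a..b}. norm (y-x) < d \<longrightarrow> norm (F y - F x - (y-x) *\<^sub>R f x) \<le> e1 * norm (y-x))"
      using der[unfolded has_vector_derivative_def has_derivative_within_alt] \<open>e1 > 0\<close> by (metis zero_less_one)
    then obtain d where d: "\<And>x. 0 < d x"
      "\<And>x y. \<lbrakk>x \<in> {a..b} - N; y \<in> {a..b}; norm (y-x) < d x\<rbrakk>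
         \<Longrightarrow> norm (F y - F x - (y-x) *\<^sub>R f x) \<le> e1 * norm (y-x)"
      by metis
    obtain \<delta> where "\<delta> > 0" and \<delta>: "\<And>D. finite D \<Longrightarrow> (\<And>u v. (u, v) \<in> D \<Longrightarrow> a \<le> u \<and> u \<le> v \<and> v \<le> b) \<Longrightarrow>
        disjoint_family_on (\<lambda>(u, v). {u<..<v}) D \<Longrightarrow> (\<Sum>(u, v)\<in>D. v - u) < \<delta>
        \<Longrightarrow> (\<Sum>(u, v)\<in>D. cmod (F v - F u)) < e / 2"
      using AC \<open>e > 0\<close> unfolding absolutely_continuous_on_def by (metis (no_types, lifting) case_prodI2 half_gt_zero)
    have "((indicator N :: real \<Rightarrow> real) has_integral 0) {a..b}"
      using N unfolding negligible_def by (metis cbox_interval)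
    then obtain \<gamma>' where \<gamma>': "gauge \<gamma>'" "\<And>p. p tagged_division_of {a..b} \<Longrightarrow> \<gamma>' fine p \<Longrightarrow>
        norm ((\<Sum>(x,k)\<in>p. measure lborel k *\<^sub>R indicator N x) - (0::real)) < \<delta>"
      using \<open>\<delta> > 0\<close> unfolding has_integral_real by meson
    define \<gamma> where "\<gamma> x = ball x (d x) \<inter> \<gamma>' x" for x
    have "norm ((\<Sum>(x,k)\<in>p. measure lborel k *\<^sub>R f0 x) - (F b - F a)) < e"
      if p: "p tagged_division_of {a..b}" and fine: "\<gamma> fine p" for p
    proof -
      have fine1: "(\<lambda>x. ball x (d x)) fine p" and fine2: "\<gamma>' fine p"
        using fine unfolding \<gamma>_def fine_Int by auto
      note pD = tagged_division_ofD[OF p]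
      have "finite p" by (rule pD(1))
      have interval: "\<exists>u v. K = {u..v} \<and> u \<le> v \<and> a \<le> u \<and> v \<le> b \<and> u \<le> x \<and> x \<le> v \<and> Inf K = u \<and> Sup K = v
          \<and> measure lborel K = v - u" if xK: "(x, K) \<in> p" for x K
      proof -
        obtain u v where "K = cbox u v" using pD(4)[OF xK] by blast
        then show ?thesis using pD(2,3)[OF xK] by auto
      qed
      \<comment> \<open>Degenerate intervals are left out so that the map to pairs of endpoints is
        injective: two nondegenerate tagged intervals with the same endpoints would have overlapping
        interiors.\<close>
      define p' where "p' = {(x, K) \<in> p. x \<in> N \<and> Inf K < Sup K}"
      have "finite p'" "p' \<subseteq> p" unfolding p'_def using \<open>finite p\<close> by (auto intro: finite_subset)
      define D where "D = (\<lambda>(x, K). (Inf K, Sup K)) ` p'"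
      have interior: "interior K = {Inf K<..<Sup K}" if "(x, K) \<in> p" for x K
        using interval[OF that] interior_atLeastAtMost_real by metis
      have disj: "{Inf K<..<Sup K} \<inter> {Inf K'<..<Sup K'} = {}" if "(x, K) \<in> p'" "(x', K') \<in> p'" "(x, K) \<noteq> (x', K')" for x K x' K'
        using that \<open>p' \<subseteq> p\<close> pD(5)[of x K x' K'] interior by (metis subsetD)
      have inj: "inj_on (\<lambda>(x, K). (Inf K, Sup K)) p'"
      proof (rule inj_onI, clarify)
        fix x K x' K' assume *: "(x, K) \<in> p'" "(x', K') \<in> p'" "Inf K = Inf K'" "Sup K = Sup K'"
        have "{Inf K<..<Sup K} \<noteq> {}" using *(1) unfolding p'_def by simp
        then have "(x, K) = (x', K')" using disj[OF *(1,2)] *(3,4) by auto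
        then show "x = x' \<and> K = K'" by auto
      qed
      have "(\<Sum>(u, v)\<in>D. cmod (F v - F u)) < e / 2"
      proof (rule \<delta>)
        show "finite D" unfolding D_def using \<open>finite p'\<close> by simp
        show "a \<le> u \<and> u \<le> v \<and> v \<le> b" if "(u, v) \<in> D" for u v
          using that \<open>p' \<subseteq> p\<close> interval unfolding D_def by fastforce
        show "disjoint_family_on (\<lambda>(u, v). {u<..<v}) D"
          unfolding disjoint_family_on_def D_def using disj by force
        have "(\<Sum>(u, v)\<in>D. v - u) = (\<Sum>(x, K)\<in>p'. Sup K - Inf K)"
          unfolding D_def by (subst sum.reindex[OF inj]) (simp add: case_prod_unfold)
        also have "\<dots> = (\<Sum>(x, K)\<in>p'. measure lborel K *\<^sub>R indicator N x)"
        proof (rule sum.cong[OF refl], safe)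
          fix x K assume xK: "(x, K) \<in> p'"
          then have "x \<in> N" unfolding p'_def by simp
          then show "Sup K - Inf K = measure lborel K *\<^sub>R indicator N x"
            using interval[of x K] xK \<open>p' \<subseteq> p\<close> by auto
        qed
        also have "\<dots> \<le> (\<Sum>(x, K)\<in>p. measure lborel K *\<^sub>R indicator N x)"
          using \<open>p' \<subseteq> p\<close> \<open>finite p\<close> by (intro sum_mono2) auto
        also have "\<dots> < \<delta>" using \<gamma>'(2)[OF p fine2] by (simp add: abs_less_iff)
        finally show "(\<Sum>(u, v)\<in>D. v - u) < \<delta>" .
      qed
      then have small: "(\<Sum>(x, K)\<in>p'. cmod (F (Sup K) - F (Inf K))) < e / 2"
        unfolding D_def by (subst (asm) sum.reindex[OF inj]) (simp add: case_prod_unfold)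
      have term_le: "norm (measure lborel K *\<^sub>R f0 x - (F (Sup K) - F (Inf K)))
          \<le> e1 * (Sup K - Inf K) + (if (x, K) \<in> p' then cmod (F (Sup K) - F (Inf K)) else 0)"
        if xK: "(x, K) \<in> p" for x K
      proof -
        obtain u v where K: "K = {u..v}" "u \<le> v" "a \<le> u" "v \<le> b" "u \<le> x" "x \<le> v" "Inf K = u" "Sup K = v"
          "measure lborel K = v - u" using interval[OF xK] by blast
        show ?thesis
        proof (cases "x \<in> N")
          case True
          then show ?thesis using K xK \<open>e1 > 0\<close> unfolding f0_def p'_def
            by (cases "u = v") (auto simp: norm_minus_commute)
        next
          case False
          have ball: "\<bar>y - x\<bar> < d x" if "y \<in> K" for y
            using fineD[OF fine1 xK] that by (auto simp: dist_real_def)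
          have x: "x \<in> {a..b} - N" using K False by auto
          \<comment> \<open>Straddle estimate: the tag lies between the endpoints, so the errors at
            the two ends add up to \<open>e1\<close> times the length of the interval.\<close>
          have "norm ((v - u) *\<^sub>R f x - (F v - F u)) = norm (F u - F x - (u - x) *\<^sub>R f x - (F v - F x - (v - x) *\<^sub>R f x))"
            by (auto simp: algebra_simps)
          also have "\<dots> \<le> norm (F u - F x - (u - x) *\<^sub>R f x) + norm (F v - F x - (v - x) *\<^sub>R f x)"
            by (rule norm_triangle_ineq4)
          also have "\<dots> \<le> e1 * norm (u - x) + e1 * norm (v - x)"
            using K ball[of u] ball[of v] by (intro add_mono d(2)[OF x]) auto
          also have "\<dots> = e1 * (v - u)" using K by (simp add: algebra_simps)
          finally show ?thesis using False K unfolding f0_def p'_def by simp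
        qed
      qed
      have "(\<Sum>(x,k)\<in>p. measure lborel k *\<^sub>R f0 x) - (F b - F a)
          = (\<Sum>(x,K)\<in>p. measure lborel K *\<^sub>R f0 x - (F (Sup K) - F (Inf K)))"
        using additive_tagged_division_1[OF \<open>a \<le> b\<close> p, of F] by (simp add: case_prod_unfold sum_subtractf)
      also have "norm \<dots> \<le> (\<Sum>(x,K)\<in>p. e1 * (Sup K - Inf K) + (if (x, K) \<in> p' then cmod (F (Sup K) - F (Inf K)) else 0))"
      proof (rule sum_norm_le)
        fix z assume "z \<in> p"
        then show "norm (case z of (x, K) \<Rightarrow> measure lborel K *\<^sub>R f0 x - (F (Sup K) - F (Inf K)))
            \<le> (case z of (x, K) \<Rightarrow> e1 * (Sup K - Inf K) + (if (x, K) \<in> p' then cmod (F (Sup K) - F (Inf K)) else 0))"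
          using term_le by (cases z) (simp only: prod.case)
      qed
      also have "\<dots> = e1 * (\<Sum>(x,K)\<in>p. Sup K - Inf K) + (\<Sum>z\<in>p. if z \<in> p' then (case z of (x, K) \<Rightarrow> cmod (F (Sup K) - F (Inf K))) else 0)"
        by (simp add: case_prod_unfold sum.distrib sum_distrib_left cong: if_cong)
      also have "(\<Sum>z\<in>p. if z \<in> p' then (case z of (x, K) \<Rightarrow> cmod (F (Sup K) - F (Inf K))) else 0) = (\<Sum>(x, K)\<in>p'. cmod (F (Sup K) - F (Inf K)))"
        using \<open>finite p\<close> \<open>p' \<subseteq> p\<close> by (simp add: sum.If_cases Int_absorb1)
      also have "(\<Sum>(x,K)\<in>p. Sup K - Inf K) = b - a"
        using additive_tagged_division_1[OF \<open>a \<le> b\<close> p, of "\<lambda>x. x"] by simp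
      finally show ?thesis using small \<open>e1 * (b - a) < e / 2\<close> by linarith
    qed
    moreover have "gauge \<gamma>" unfolding \<gamma>_def using d(1) \<gamma>'(1) by (intro gauge_Int gauge_ball_dependent) auto
    ultimately show "\<exists>\<gamma>. gauge \<gamma> \<and> (\<forall>p. p tagged_division_of {a..b} \<and> \<gamma> fine p \<longrightarrow>
        norm ((\<Sum>(x,k)\<in>p. measure lborel k *\<^sub>R f0 x) - (F b - F a)) < e)" by blast
  qed
  then show ?thesis by (rule has_integral_spike[OF N, rotated]) (auto simp: f0_def)
qed

lemma absolutely_continuous_on_imp_continuous_on:
  assumes "absolutely_continuous_on a b F" shows "continuous_on {a..b} F"
  unfolding continuous_on_iff
proof (intro ballI allI impI)
  fix x e :: real assume x: "x \<in> {a..b}" and "e > 0"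
  then obtain \<delta> where "\<delta> > 0" and \<delta>: "\<And>D. finite D \<Longrightarrow> (\<forall>(u, v)\<in>D. a \<le> u \<and> u \<le> v \<and> v \<le> b) \<Longrightarrow>
        disjoint_family_on (\<lambda>(u, v). {u<..<v}) D \<Longrightarrow> (\<Sum>(u, v)\<in>D. v - u) < \<delta>
        \<Longrightarrow> (\<Sum>(u, v)\<in>D. cmod (F v - F u)) < e"
    using assms unfolding absolutely_continuous_on_def by meson
  have "dist (F y) (F x) < e" if y: "y \<in> {a..b}" "dist y x < \<delta>" for y
  proof (cases "x \<le> y")
    case True
    then show ?thesis using \<delta>[of "{(x, y)}"] x y by (auto simp: disjoint_family_on_def dist_norm)
  next
    case False
    then show ?thesis using \<delta>[of "{(y, x)}"] x y
      by (auto simp: disjoint_family_on_def dist_norm norm_minus_commute)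
  qed
  then show "\<exists>d>0. \<forall>y\<in>{a..b}. dist y x < d \<longrightarrow> dist (F y) (F x) < e" using \<open>\<delta> > 0\<close> by blast
qed

text \<open>Sums of increments of \<open>H\<close> inherit smallness from those of \<open>F\<close>
  and \<open>G\<close>. All closure properties below (sums, multiples, conjugates, products,
  Lipschitz functions, congruence) reduce to this one estimate.\<close>

lemma absolutely_continuous_on_dominated:
  assumes F: "absolutely_continuous_on a b F" and G: "absolutely_continuous_on a b G" and "C \<ge> 0"
    and le: "\<And>u v. a \<le> u \<Longrightarrow> u \<le> v \<Longrightarrow> v \<le> b \<Longrightarrow> cmod (H v - H u) \<le> C * (cmod (F v - F u) + cmod (G v - G u))"
  shows "absolutely_continuous_on a b H"
  unfolding absolutely_continuous_on_def
proof (intro allI impI)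
  fix e :: real assume "e > 0"
  \<comment> \<open>Dividing by \<open>C + 1\<close> admits \<open>C = 0\<close> and keeps the final
    bound \<open>e * (C / (C + 1))\<close> strictly below \<open>e\<close>.\<close>
  define e' where "e' = e / (2 * (C + 1))"
  have "e' > 0" unfolding e'_def using \<open>e > 0\<close> \<open>C \<ge> 0\<close> by simp
  obtain d1 where d1: "d1 > 0" "\<And>D. finite D \<Longrightarrow> (\<forall>(u, v)\<in>D. a \<le> u \<and> u \<le> v \<and> v \<le> b) \<Longrightarrow>
        disjoint_family_on (\<lambda>(u, v). {u<..<v}) D \<Longrightarrow> (\<Sum>(u, v)\<in>D. v - u) < d1
        \<Longrightarrow> (\<Sum>(u, v)\<in>D. cmod (F v - F u)) < e'"
    using F \<open>e' > 0\<close> unfolding absolutely_continuous_on_def by meson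
  obtain d2 where d2: "d2 > 0" "\<And>D. finite D \<Longrightarrow> (\<forall>(u, v)\<in>D. a \<le> u \<and> u \<le> v \<and> v \<le> b) \<Longrightarrow>
        disjoint_family_on (\<lambda>(u, v). {u<..<v}) D \<Longrightarrow> (\<Sum>(u, v)\<in>D. v - u) < d2
        \<Longrightarrow> (\<Sum>(u, v)\<in>D. cmod (G v - G u)) < e'"
    using G \<open>e' > 0\<close> unfolding absolutely_continuous_on_def by meson
  have "(\<Sum>(u, v)\<in>D. cmod (H v - H u)) < e"
    if D: "finite D" "\<forall>(u, v)\<in>D. a \<le> u \<and> u \<le> v \<and> v \<le> b"
        "disjoint_family_on (\<lambda>(u, v). {u<..<v}) D" "(\<Sum>(u, v)\<in>D. v - u) < min d1 d2" for D
  proof -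
    have "(\<Sum>(u, v)\<in>D. cmod (H v - H u)) \<le> (\<Sum>(u, v)\<in>D. C * (cmod (F v - F u) + cmod (G v - G u)))"
      using D(2) le by (intro sum_mono) auto
    also have "\<dots> = C * ((\<Sum>(u, v)\<in>D. cmod (F v - F u)) + (\<Sum>(u, v)\<in>D. cmod (G v - G u)))"
      by (simp add: case_prod_unfold sum.distrib flip: sum_distrib_left)
    also have "\<dots> \<le> C * (e' + e')"
      using d1(2)[OF D(1-3)] d2(2)[OF D(1-3)] D(4) \<open>C \<ge> 0\<close> by (intro mult_left_mono add_mono) auto
    also have "\<dots> = e * (C / (C + 1))" using \<open>C \<ge> 0\<close> by (simp add: e'_def divide_simps)
    also have "\<dots> < e * 1" using \<open>e > 0\<close> \<open>C \<ge> 0\<close> by (intro mult_strict_left_mono) auto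
    finally have "(\<Sum>(u, v)\<in>D. cmod (H v - H u)) < e * 1" .
    then show ?thesis by simp
  qed
  then show "\<exists>\<delta>>0. \<forall>D. finite D \<and> (\<forall>(u, v)\<in>D. a \<le> u \<and> u \<le> v \<and> v \<le> b) \<and>
        disjoint_family_on (\<lambda>(u, v). {u<..<v}) D \<and> (\<Sum>(u, v)\<in>D. v - u) < \<delta>
        \<longrightarrow> (\<Sum>(u, v)\<in>D. cmod (H v - H u)) < e" using d1(1) d2(1) by (intro exI[of _ "min d1 d2"]) auto
qed

lemma absolutely_continuous_on_id: "absolutely_continuous_on a b of_real"
  unfolding absolutely_continuous_on_def
proof (intro allI impI, rule exI, safe)
  fix e :: real and D :: "(real \<times> real) set"
  assume "\<forall>(u, v)\<in>D. a \<le> u \<and> u \<le> v \<and> v \<le> b" "(\<Sum>(u, v)\<in>D. v - u) < e"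
  moreover from this(1) have "(\<Sum>(u, v)\<in>D. cmod (of_real v - of_real u)) = (\<Sum>(u, v)\<in>D. v - u)"
    by (intro sum.cong) (auto simp flip: of_real_diff)
  ultimately show "(\<Sum>(u, v)\<in>D. cmod (of_real v - of_real u)) < e" by simp
qed

lemma lipschitz_absolutely_continuous_on:
  assumes "C \<ge> 0" "\<And>u v. a \<le> u \<Longrightarrow> u \<le> v \<Longrightarrow> v \<le> b \<Longrightarrow> cmod (F v - F u) \<le> C * (v - u)"
  shows "absolutely_continuous_on a b F"
proof (rule absolutely_continuous_on_dominated[OF absolutely_continuous_on_id absolutely_continuous_on_id assms(1)])
  fix u v assume uv: "a \<le> u" "u \<le> v" "v \<le> b"
  have "cmod (F v - F u) \<le> C * (v - u)" using assms(2) uv by blast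
  also have "\<dots> \<le> C * ((v - u) + (v - u))" using uv \<open>C \<ge> 0\<close> by (intro mult_left_mono) auto
  finally show "cmod (F v - F u) \<le> C * (cmod (of_real v - of_real u) + cmod (of_real v - of_real u))"
    using uv by (simp flip: of_real_diff)
qed

lemma absolutely_continuous_on_add:
  assumes "absolutely_continuous_on a b F" "absolutely_continuous_on a b G"
  shows "absolutely_continuous_on a b (\<lambda>y. F y + G y)"
proof (rule absolutely_continuous_on_dominated[OF assms, of 1])
  fix u v
  have "F v + G v - (F u + G u) = (F v - F u) + (G v - G u)" by simp
  then show "cmod (F v + G v - (F u + G u)) \<le> 1 * (cmod (F v - F u) + cmod (G v - G u))"
    using norm_triangle_ineq by (metis mult_1)
qed simp

lemma absolutely_continuous_on_cmult:
  assumes "absolutely_continuous_on a b F"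
  shows "absolutely_continuous_on a b (\<lambda>y. c * F y)"
  by (rule absolutely_continuous_on_dominated[OF assms assms, of "cmod c"])
     (auto simp: norm_mult mult_left_mono simp flip: right_diff_distrib)

lemma absolutely_continuous_on_cnj:
  assumes "absolutely_continuous_on a b F"
  shows "absolutely_continuous_on a b (\<lambda>y. cnj (F y))"
  by (rule absolutely_continuous_on_dominated[OF assms assms, of 1])
     (auto simp flip: complex_cnj_diff)

lemma absolutely_continuous_on_mult:
  assumes F: "absolutely_continuous_on a b F" and G: "absolutely_continuous_on a b G"
  shows "absolutely_continuous_on a b (\<lambda>y. F y * G y)"
proof -
  have "bounded (F ` {a..b})" "bounded (G ` {a..b})"
    using assms absolutely_continuous_on_imp_continuous_on compact_continuous_image compact_imp_bounded compact_Icc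
    by blast+
  then obtain A B where A: "\<And>y. y \<in> {a..b} \<Longrightarrow> cmod (F y) \<le> A" and B: "\<And>y. y \<in> {a..b} \<Longrightarrow> cmod (G y) \<le> B"
    unfolding bounded_iff by (metis imageI)
  show ?thesis
  proof (rule absolutely_continuous_on_dominated[OF F G])
    show "max 0 (max A B) \<ge> 0" by simp
    fix u v assume uv: "a \<le> u" "u \<le> v" "v \<le> b"
    have "F v * G v - F u * G u = (F v - F u) * G v + F u * (G v - G u)" by (simp add: algebra_simps)
    then have "cmod (F v * G v - F u * G u) \<le> cmod (F v - F u) * cmod (G v) + cmod (F u) * cmod (G v - G u)"
      by (metis norm_mult norm_triangle_ineq)
    also have "\<dots> \<le> cmod (F v - F u) * max 0 (max A B) + max 0 (max A B) * cmod (G v - G u)"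
      using A[of u] B[of v] uv by (intro add_mono mult_left_mono mult_right_mono) auto
    finally show "cmod (F v * G v - F u * G u) \<le> max 0 (max A B) * (cmod (F v - F u) + cmod (G v - G u))"
      by (simp add: algebra_simps)
  qed
qed

section \<open>The Hilbert space \<open>L\<^sup>2\<close>\<close>

lemma L2_measurable: "f \<in> L2 \<Longrightarrow> f \<in> borel_measurable leb_half_line"
  unfolding L2_def by simp

lemma L2_square_integrable: "f \<in> L2 \<Longrightarrow> integrable leb_half_line (\<lambda>y. (cmod (f y))\<^sup>2)"
  unfolding L2_def by simp

lemma L2I_dominated:
  assumes f: "f \<in> borel_measurable leb_half_line" and g: "integrable leb_half_line g"
    and le: "AE y in leb_half_line. (cmod (f y))\<^sup>2 \<le> g y"
  shows "f \<in> L2"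
proof -
  have "integrable leb_half_line (\<lambda>y. (cmod (f y))\<^sup>2)"
    by (rule Bochner_Integration.integrable_bound[OF g]) (use f le in \<open>auto elim: AE_mp\<close>)
  then show ?thesis using f unfolding L2_def by simp
qed

lemma L2_zero: "(\<lambda>y. 0) \<in> L2"
  unfolding L2_def by simp

lemma L2_mult_const: "f \<in> L2 \<Longrightarrow> (\<lambda>y. c * f y) \<in> L2"
  unfolding L2_def by (auto simp: norm_mult power_mult_distrib)

lemma L2_scaleR: "f \<in> L2 \<Longrightarrow> (\<lambda>y. r *\<^sub>R f y) \<in> L2"
  unfolding scaleR_conv_of_real by (rule L2_mult_const)

lemma L2_uminus: "f \<in> L2 \<Longrightarrow> (\<lambda>y. - f y) \<in> L2"
  using L2_mult_const[of f "-1"] by simp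

lemma L2_add:
  assumes "f \<in> L2" "g \<in> L2" shows "(\<lambda>y. f y + g y) \<in> L2"
proof (rule L2I_dominated)
  show "(\<lambda>y. f y + g y) \<in> borel_measurable leb_half_line"
    using assms L2_measurable by (intro borel_measurable_add)
  show "integrable leb_half_line (\<lambda>y. 2 * (cmod (f y))\<^sup>2 + 2 * (cmod (g y))\<^sup>2)"
    using assms[THEN L2_square_integrable] by auto
  have "(cmod (a + b))\<^sup>2 \<le> 2 * (cmod a)\<^sup>2 + 2 * (cmod b)\<^sup>2" for a b
  proof -
    have "(cmod (a + b))\<^sup>2 \<le> (cmod a + cmod b)\<^sup>2" by (intro power_mono norm_triangle_ineq) auto
    also have "\<dots> \<le> 2 * (cmod a)\<^sup>2 + 2 * (cmod b)\<^sup>2" using sum_squares_bound[of "cmod a" "cmod b"] by (simp add: power2_sum)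
    finally show ?thesis .
  qed
  then show "AE y in leb_half_line. (cmod (f y + g y))\<^sup>2 \<le> 2 * (cmod (f y))\<^sup>2 + 2 * (cmod (g y))\<^sup>2" by auto
qed

lemma L2_diff: "f \<in> L2 \<Longrightarrow> g \<in> L2 \<Longrightarrow> (\<lambda>y. f y - g y) \<in> L2"
  using L2_add[OF _ L2_uminus, of f g] by simp

lemma L2_integrable_mult:
  assumes "f \<in> L2" "g \<in> L2" shows "integrable leb_half_line (\<lambda>y. cmod (f y) * cmod (g y))"
proof (rule Bochner_Integration.integrable_bound)
  show "integrable leb_half_line (\<lambda>y. (cmod (f y))\<^sup>2 + (cmod (g y))\<^sup>2)"
    using assms[THEN L2_square_integrable] by auto
  show "(\<lambda>y. cmod (f y) * cmod (g y)) \<in> borel_measurable leb_half_line"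
    using assms[THEN L2_measurable] by simp
  have "a * b \<le> a\<^sup>2 + b\<^sup>2" if "a \<ge> 0" "b \<ge> 0" for a b :: real
    using sum_squares_bound[of a b] that mult_nonneg_nonneg[OF that] by linarith
  then show "AE y in leb_half_line. norm (cmod (f y) * cmod (g y)) \<le> norm ((cmod (f y))\<^sup>2 + (cmod (g y))\<^sup>2)"
    by (auto simp: abs_of_nonneg)
qed

lemma L2_integrable_product:
  assumes "f \<in> L2" "g \<in> L2" shows "integrable leb_half_line (\<lambda>y. f y * cnj (g y))"
proof (rule Bochner_Integration.integrable_bound[OF L2_integrable_mult[OF assms]])
  have "(\<lambda>y. cnj (g y)) \<in> borel_measurable leb_half_line"
    by (rule measurable_compose[OF L2_measurable[OF assms(2)]])
       (intro borel_measurable_continuous_onI continuous_intros)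
  then show "(\<lambda>y. f y * cnj (g y)) \<in> borel_measurable leb_half_line"
    using L2_measurable[OF assms(1)] by (intro borel_measurable_times)
qed (auto simp: norm_mult)

lemma L2_integrable_inner:
  assumes "f \<in> L2" "g \<in> L2" shows "integrable leb_half_line (\<lambda>y. f y \<bullet> g y)"
  by (rule Bochner_Integration.integrable_bound[OF L2_integrable_mult[OF assms]])
     (use assms[THEN L2_measurable] Cauchy_Schwarz_ineq2 in auto)

lemma L2_norm_square: "(L2_norm f)\<^sup>2 = (LINT y|leb_half_line. (cmod (f y))\<^sup>2)"
  unfolding L2_norm_def by (intro real_sqrt_pow2 integral_nonneg_AE) auto

lemma nn_integral_L2:
  "f \<in> L2 \<Longrightarrow> (\<integral>\<^sup>+y. ennreal ((cmod (f y))\<^sup>2) \<partial>leb_half_line) = ennreal ((L2_norm f)\<^sup>2)"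
  unfolding L2_norm_square by (intro nn_integral_eq_integral L2_square_integrable) auto

\<comment> \<open>The classes of square integrable functions as a real Hilbert space\<close>
quotient_type l2 = "real \<Rightarrow> complex" / partial: "\<lambda>f g. f \<in> L2 \<and> g \<in> L2 \<and> (AE y in leb_half_line. f y = g y)"
proof (rule part_equivpI)
  show "\<exists>f. f \<in> L2 \<and> f \<in> L2 \<and> (AE y in leb_half_line. f y = f y)" using L2_zero by auto
  show "symp (\<lambda>f g. f \<in> L2 \<and> g \<in> L2 \<and> (AE y in leb_half_line. f y = g y))"
    by (auto intro!: sympI elim: AE_mp)
  show "transp (\<lambda>f g. f \<in> L2 \<and> g \<in> L2 \<and> (AE y in leb_half_line. f y = g y))"
    by (auto intro!: transpI elim: eventually_elim2)
qed

instantiation l2 :: real_vector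
begin

lift_definition zero_l2 :: l2 is "\<lambda>y. 0" by (simp add: L2_zero)
lift_definition plus_l2 :: "l2 \<Rightarrow> l2 \<Rightarrow> l2" is "\<lambda>f g y. f y + g y"
  by (auto intro!: L2_add elim: eventually_elim2)
lift_definition minus_l2 :: "l2 \<Rightarrow> l2 \<Rightarrow> l2" is "\<lambda>f g y. f y - g y"
  by (auto intro!: L2_diff elim: eventually_elim2)
lift_definition uminus_l2 :: "l2 \<Rightarrow> l2" is "\<lambda>f y. - f y"
  by (auto intro!: L2_uminus)
lift_definition scaleR_l2 :: "real \<Rightarrow> l2 \<Rightarrow> l2" is "\<lambda>r f y. r *\<^sub>R f y"
  by (auto intro!: L2_scaleR elim: eventually_mono)

instance
proof
  fix x y z :: l2 and r s :: real
  show "x + y + z = x + (y + z)" by transfer (auto intro!: L2_add simp: add.assoc)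
  show "x + y = y + x" by transfer (auto intro!: L2_add simp: add.commute)
  show "0 + x = x" by transfer auto
  show "- x + x = 0" by transfer (auto intro!: L2_zero)
  show "x - y = x + - y" by transfer (auto intro!: L2_add L2_diff L2_uminus)
  show "r *\<^sub>R (x + y) = r *\<^sub>R x + r *\<^sub>R y"
    by transfer (auto intro!: L2_add L2_scaleR simp: scaleR_add_right)
  show "(r + s) *\<^sub>R x = r *\<^sub>R x + s *\<^sub>R x"
    by transfer (auto intro!: L2_add L2_scaleR simp: scaleR_add_left)
  show "r *\<^sub>R s *\<^sub>R x = (r * s) *\<^sub>R x" by transfer (auto intro!: L2_scaleR)
  show "1 *\<^sub>R x = x" by transfer auto
qed

end

instantiation l2 :: real_inner
begin

text \<open>On complex numbers \<open>inner\<close> is Re (a * cnj b), so this is the real part of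
  the Hermitian product. It induces the same norm, and Hermitian symmetry of an operator becomes
  symmetry for it.\<close>

lift_definition inner_l2 :: "l2 \<Rightarrow> l2 \<Rightarrow> real" is "\<lambda>f g. LINT y|leb_half_line. f y \<bullet> g y"
  by (intro integral_cong_AE borel_measurable_inner) (auto intro: L2_measurable elim: eventually_elim2)

definition norm_l2 :: "l2 \<Rightarrow> real" where "norm_l2 x = sqrt (x \<bullet> x)"
definition dist_l2 :: "l2 \<Rightarrow> l2 \<Rightarrow> real" where "dist_l2 x y = norm (x - y)"
definition sgn_l2 :: "l2 \<Rightarrow> l2" where "sgn_l2 x = x /\<^sub>R norm x"
definition uniformity_l2 :: "(l2 \<times> l2) filter" where
  "uniformity_l2 = (INF e\<in>{0<..}. principal {(x, y). dist x y < e})"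
definition open_l2 :: "l2 set \<Rightarrow> bool" where
  "open_l2 U \<longleftrightarrow> (\<forall>x\<in>U. \<forall>\<^sub>F (x', y) in uniformity. x' = x \<longrightarrow> y \<in> U)"

instance
proof
  fix x y z :: l2 and r s :: real
  show "dist x y = norm (x - y)" by (rule dist_l2_def)
  show "sgn x = x /\<^sub>R norm x" by (rule sgn_l2_def)
  show "(uniformity :: (l2 \<times> l2) filter) = (INF e\<in>{0<..}. principal {(x, y). dist x y < e})"
    by (rule uniformity_l2_def)
  show "open U \<longleftrightarrow> (\<forall>x\<in>U. \<forall>\<^sub>F (x', y) in uniformity. x' = x \<longrightarrow> y \<in> U)" for U :: "l2 set"
    by (rule open_l2_def)
  show "x \<bullet> y = y \<bullet> x" by transfer (simp add: inner_commute)
  show "(x + y) \<bullet> z = x \<bullet> z + y \<bullet> z"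
    by transfer (auto simp: inner_add_left intro!: Bochner_Integration.integral_add L2_integrable_inner)
  show "(r *\<^sub>R x) \<bullet> y = r * (x \<bullet> y)" by transfer simp
  show "0 \<le> x \<bullet> x" by transfer (auto intro!: integral_nonneg_AE)
  show "x \<bullet> x = 0 \<longleftrightarrow> x = 0"
  proof transfer
    fix f assume "f \<in> L2 \<and> f \<in> L2 \<and> (AE y in leb_half_line. f y = f y)"
    then have f: "f \<in> L2" by simp
    have "(LINT y|leb_half_line. f y \<bullet> f y) = 0 \<longleftrightarrow> (AE y in leb_half_line. f y \<bullet> f y = 0)"
      by (intro integral_nonneg_eq_0_iff_AE L2_integrable_inner f) auto
    then show "(LINT y|leb_half_line. f y \<bullet> f y) = 0 \<longleftrightarrow>
        f \<in> L2 \<and> (\<lambda>y. 0) \<in> L2 \<and> (AE y in leb_half_line. f y = 0)"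
      using f L2_zero by simp
  qed
  show "norm x = sqrt (x \<bullet> x)" by (rule norm_l2_def)
qed

end

lemma abs_l2_eq_iff:
  "f \<in> L2 \<Longrightarrow> g \<in> L2 \<Longrightarrow> abs_l2 f = abs_l2 g \<longleftrightarrow> (AE y in leb_half_line. f y = g y)"
  using Quotient_rel[OF Quotient_l2, of f g] by auto

lemma abs_l2_cases: obtains f where "f \<in> L2" "x = abs_l2 f"
  using Quotient_abs_rep[OF Quotient_l2, of x] Quotient_rep_reflp[OF Quotient_l2, of x]
  by (intro that[of "rep_l2 x"]) auto

lemma abs_l2_add: "f \<in> L2 \<Longrightarrow> g \<in> L2 \<Longrightarrow> abs_l2 f + abs_l2 g = abs_l2 (\<lambda>y. f y + g y)"
  by (rule plus_l2.abs_eq) (auto simp: eq_onp_def)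

lemma abs_l2_diff: "f \<in> L2 \<Longrightarrow> g \<in> L2 \<Longrightarrow> abs_l2 f - abs_l2 g = abs_l2 (\<lambda>y. f y - g y)"
  by (rule minus_l2.abs_eq) (auto simp: eq_onp_def)

lemma abs_l2_scaleR: "f \<in> L2 \<Longrightarrow> r *\<^sub>R abs_l2 f = abs_l2 (\<lambda>y. r *\<^sub>R f y)"
  by (rule scaleR_l2.abs_eq) (auto simp: eq_onp_def)

lemma abs_l2_inner: "f \<in> L2 \<Longrightarrow> g \<in> L2 \<Longrightarrow> abs_l2 f \<bullet> abs_l2 g = (LINT y|leb_half_line. f y \<bullet> g y)"
  by (rule inner_l2.abs_eq) (auto simp: eq_onp_def)

lemma norm_abs_l2: "f \<in> L2 \<Longrightarrow> norm (abs_l2 f) = L2_norm f"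
  unfolding norm_l2_def L2_norm_def by (simp add: abs_l2_inner power2_norm_eq_inner)

text \<open>Riesz-Fischer: a rapidly convergent subsequence converges almost everywhere, and Fatou's
  lemma turns the pointwise limit into a limit in norm.\<close>

instance l2 :: complete_space
proof
  fix X :: "nat \<Rightarrow> l2" assume "Cauchy X"
  then have "\<forall>k. \<exists>N. \<forall>m\<ge>N. \<forall>n\<ge>N. dist (X m) (X n) < (1/4)^k"
    unfolding Cauchy_def by simp
  then obtain N where N: "\<And>k m n. m \<ge> N k \<Longrightarrow> n \<ge> N k \<Longrightarrow> dist (X m) (X n) < (1/4)^k" by metis
  define r where "r k = k + (\<Sum>i\<le>k. N i)" for k
  have "strict_mono r" unfolding strict_mono_Suc_iff r_def by simp
  have r_ge: "N k \<le> r j" if "k \<le> j" for j k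
    using member_le_sum[of k "{..j}" N] that unfolding r_def by simp
  have "\<exists>f. f \<in> L2 \<and> X (r k) = abs_l2 f" for k by (rule abs_l2_cases[of "X (r k)"]) blast
  then obtain f where f: "\<And>k. f k \<in> L2" "\<And>k. X (r k) = abs_l2 (f k)" by metis
  have dist_f: "L2_norm (\<lambda>y. f j y - f k y) \<le> (1/4)^k" if "k \<le> j" for j k
    using N[OF r_ge[OF that] r_ge[OF order_refl, of k]] f
    by (simp add: dist_norm abs_l2_diff norm_abs_l2 L2_diff)
  have f_meas: "f k \<in> borel_measurable leb_half_line" for k using f(1) by (rule L2_measurable)
  have "AE y in leb_half_line. convergent (\<lambda>k. f k y)"
  proof -
    \<comment> \<open>Squared distances are at most (1/16)^k, so the weight 4^k still leaves a
      summable bound (1/4)^k. Conversely, boundedness of the weighted terms at a point forces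
      increments of order (1/2)^k there, hence pointwise convergence.\<close>
    define g where "g k y = 4 ^ k * (cmod (f (Suc k) y - f k y))\<^sup>2" for k y
    have g_meas: "(\<lambda>y. ennreal (g k y)) \<in> borel_measurable leb_half_line" for k
      unfolding g_def using f_meas by measurable
    have "(\<integral>\<^sup>+y. ennreal (g k y) \<partial>leb_half_line) \<le> ennreal ((1/4)^k)" for k
    proof -
      have "(\<integral>\<^sup>+y. ennreal (g k y) \<partial>leb_half_line)
          = ennreal (4^k) * (\<integral>\<^sup>+y. ennreal ((cmod (f (Suc k) y - f k y))\<^sup>2) \<partial>leb_half_line)"
        unfolding g_def using f_meas by (subst nn_integral_cmult[symmetric]) (auto simp: ennreal_mult)
      also have "\<dots> = ennreal (4^k * (L2_norm (\<lambda>y. f (Suc k) y - f k y))\<^sup>2)"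
        by (subst nn_integral_L2) (auto simp: ennreal_mult intro: L2_diff f(1))
      also have "\<dots> \<le> ennreal (4^k * ((1/4)^k)\<^sup>2)"
        using dist_f[of k "Suc k"] by (intro ennreal_leI mult_left_mono power_mono) (auto simp: L2_norm_def)
      also have "4^k * ((1/4)^k)\<^sup>2 = (1/4::real)^k"
        by (simp add: power2_eq_square power_divide)
      finally show ?thesis .
    qed
    then have "(\<integral>\<^sup>+y. (\<Sum>k. ennreal (g k y)) \<partial>leb_half_line) \<le> (\<Sum>k. ennreal ((1/4)^k))"
      using g_meas by (subst nn_integral_suminf) (auto intro!: suminf_le)
    also have "\<dots> = ennreal (\<Sum>k. (1/4)^k)"
      by (intro suminf_ennreal2) (auto intro: summable_geometric)
    finally have "(\<integral>\<^sup>+y. (\<Sum>k. ennreal (g k y)) \<partial>leb_half_line) \<noteq> \<infinity>"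
      by (auto simp: top_unique)
    then have "AE y in leb_half_line. (\<Sum>k. ennreal (g k y)) \<noteq> \<infinity>"
      using g_meas by (intro nn_integral_noteq_infinite) auto
    then show ?thesis
    proof eventually_elim
      fix y assume "(\<Sum>k. ennreal (g k y)) \<noteq> \<infinity>"
      then have "summable (\<lambda>k. g k y)"
        by (intro summable_suminf_not_top) (auto simp: g_def)
      then have "Bseq (\<lambda>k. g k y)" by (rule summable_imp_Bseq)
      then obtain C where "C > 0" and C': "\<forall>k. norm (g k y) \<le> C" by (rule BseqE)
      have C: "g k y \<le> C" for k using C'[rule_format, of k] by simp
      have "summable (\<lambda>k. f (Suc k) y - f k y)"
      proof (rule summable_comparison_test')
        show "summable (\<lambda>k. sqrt C * (1/2)^k)" by (intro summable_mult summable_geometric) simp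
        show "norm (f (Suc k) y - f k y) \<le> sqrt C * (1/2)^k" for k
        proof -
          have "(cmod (f (Suc k) y - f k y))\<^sup>2 \<le> C / 4^k"
            using C[of k] unfolding g_def by (simp add: field_simps)
          then have "cmod (f (Suc k) y - f k y) \<le> sqrt (C / 4^k)" by (rule real_le_rsqrt)
          also have "\<dots> = sqrt C * (1/2)^k"
            by (simp add: real_sqrt_divide real_sqrt_power power_divide)
          finally show ?thesis .
        qed
      qed
      then have "convergent (\<lambda>n. (\<Sum>k<n. f (Suc k) y - f k y))" by (simp add: summable_iff_convergent)
      then have "convergent (\<lambda>n. (f n y - f 0 y) + f 0 y)"
        unfolding sum_lessThan_telescope[of "\<lambda>k. f k y"] by (intro convergent_add convergent_const)
      then show "convergent (\<lambda>k. f k y)" by simp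
    qed
  qed
  define F where "F y = lim (\<lambda>k. f k y)" for y
  have F_meas: "F \<in> borel_measurable leb_half_line"
    unfolding F_def using f_meas by (rule borel_measurable_lim_metric)
  have F_lim: "AE y in leb_half_line. (\<lambda>k. f k y) \<longlonglongrightarrow> F y"
    using \<open>AE y in leb_half_line. convergent (\<lambda>k. f k y)\<close> unfolding F_def
    by eventually_elim (simp add: convergent_LIMSEQ_iff)
  have Fatou: "(\<integral>\<^sup>+y. ennreal ((cmod (F y - f k y))\<^sup>2) \<partial>leb_half_line) \<le> ennreal (((1/4)^k)\<^sup>2)" for k
  proof -
    have "AE y in leb_half_line. ennreal ((cmod (F y - f k y))\<^sup>2) = liminf (\<lambda>j. ennreal ((cmod (f j y - f k y))\<^sup>2))"
      using F_lim
    proof eventually_elim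
      fix y assume "(\<lambda>j. f j y) \<longlonglongrightarrow> F y"
      then have "(\<lambda>j. ennreal ((cmod (f j y - f k y))\<^sup>2)) \<longlonglongrightarrow> ennreal ((cmod (F y - f k y))\<^sup>2)"
        by (intro tendsto_intros)
      then show "ennreal ((cmod (F y - f k y))\<^sup>2) = liminf (\<lambda>j. ennreal ((cmod (f j y - f k y))\<^sup>2))"
        by (rule lim_imp_Liminf[OF trivial_limit_sequentially, symmetric])
    qed
    then have "(\<integral>\<^sup>+y. ennreal ((cmod (F y - f k y))\<^sup>2) \<partial>leb_half_line)
        = (\<integral>\<^sup>+y. liminf (\<lambda>j. ennreal ((cmod (f j y - f k y))\<^sup>2)) \<partial>leb_half_line)"
      by (rule nn_integral_cong_AE)
    also have "\<dots> \<le> liminf (\<lambda>j. \<integral>\<^sup>+y. ennreal ((cmod (f j y - f k y))\<^sup>2) \<partial>leb_half_line)"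
      using f_meas by (intro nn_integral_liminf) auto
    also have "\<dots> \<le> limsup (\<lambda>j. \<integral>\<^sup>+y. ennreal ((cmod (f j y - f k y))\<^sup>2) \<partial>leb_half_line)"
      by (intro Liminf_le_Limsup) simp
    also have "\<dots> \<le> ennreal (((1/4)^k)\<^sup>2)"
    proof (rule Limsup_bounded)
      show "\<forall>\<^sub>F j in sequentially. (\<integral>\<^sup>+y. ennreal ((cmod (f j y - f k y))\<^sup>2) \<partial>leb_half_line) \<le> ennreal (((1/4)^k)\<^sup>2)"
        using eventually_ge_at_top[of k]
      proof eventually_elim
        fix j assume "k \<le> j"
        then show "(\<integral>\<^sup>+y. ennreal ((cmod (f j y - f k y))\<^sup>2) \<partial>leb_half_line) \<le> ennreal (((1/4)^k)\<^sup>2)"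
          using dist_f[of k j]
          by (subst nn_integral_L2[OF L2_diff[OF f(1) f(1)]]) (intro ennreal_leI power_mono, auto simp: L2_norm_def)
      qed
    qed
    finally show ?thesis .
  qed
  have diff_L2: "(\<lambda>y. F y - f k y) \<in> L2" for k
  proof -
    have "(\<integral>\<^sup>+y. ennreal (norm ((cmod (F y - f k y))\<^sup>2)) \<partial>leb_half_line) < \<infinity>"
      using Fatou[of k] by (simp add: le_less_trans)
    then have "integrable leb_half_line (\<lambda>y. (cmod (F y - f k y))\<^sup>2)"
      using F_meas f_meas by (intro integrableI_bounded) auto
    then show ?thesis unfolding L2_def using F_meas f_meas by auto
  qed
  have F: "F \<in> L2" using L2_add[OF diff_L2[of 0] f(1)[of 0]] by simp
  have "norm (abs_l2 F - X (r k)) \<le> (1/4)^k" for k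
  proof -
    have "ennreal ((L2_norm (\<lambda>y. F y - f k y))\<^sup>2) \<le> ennreal (((1/4)^k)\<^sup>2)"
      using Fatou[of k] nn_integral_L2[OF diff_L2[of k]] by simp
    then have "(L2_norm (\<lambda>y. F y - f k y))\<^sup>2 \<le> ((1/4)^k)\<^sup>2" by simp
    then have "L2_norm (\<lambda>y. F y - f k y) \<le> (1/4)^k" by (rule power2_le_imp_le) simp
    then show ?thesis using F f by (simp add: abs_l2_diff norm_abs_l2 diff_L2)
  qed
  then have "(\<lambda>k. X (r k) - abs_l2 F) \<longlonglongrightarrow> 0"
    by (intro Lim_null_comparison[OF _ LIMSEQ_realpow_zero[of "1/4"]]) (auto simp: norm_minus_commute)
  then have "(\<lambda>k. X (r k)) \<longlonglongrightarrow> abs_l2 F" by (rule LIM_zero_cancel)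
  then show "convergent X"
    using Cauchy_converges_subseq[OF \<open>Cauchy X\<close> \<open>strict_mono r\<close>, of "abs_l2 F"]
    unfolding convergent_def o_def by blast
qed

section \<open>Symmetric operators with discrete spectrum\<close>

text \<open>Let \<kappa> be the infimum over the family of the norms of \<open>R\<close> restricted
  to its members. On vectors where the norm is nearly \<kappa>, the square of \<open>R\<close>
  nearly acts as \<kappa>^2, and factoring R^2 - \<kappa>^2 into R - \<kappa> and R + \<kappa> shows
  that one of the two is not bounded below on any member. Directedness and the invariance condition
  allow finitely many estimates to be used on one common member.\<close>

lemma approximate_eigenvalue:
  fixes R :: "'a::real_inner \<Rightarrow> 'a"
  assumes R: "bounded_linear R" and sym: "\<And>u v. R u \<bullet> v = u \<bullet> R v"
    and ne: "\<V> \<noteq> {}" and sub: "\<And>V. V \<in> \<V> \<Longrightarrow> subspace V"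
    and dir: "\<And>V W. V \<in> \<V> \<Longrightarrow> W \<in> \<V> \<Longrightarrow> \<exists>U\<in>\<V>. U \<subseteq> V \<inter> W"
    and inv: "\<And>V. V \<in> \<V> \<Longrightarrow> \<exists>U\<in>\<V>. R ` U \<subseteq> V"
    and eps: "0 < \<epsilon>" and large: "\<And>V. V \<in> \<V> \<Longrightarrow> \<exists>u\<in>V. norm (R u) > \<epsilon> * norm u"
  obtains \<mu> where "\<bar>\<mu>\<bar> \<ge> \<epsilon>" "\<And>V C. V \<in> \<V> \<Longrightarrow> \<exists>u\<in>V. norm u > C * norm (R u - \<mu> *\<^sub>R u)"
proof -
  interpret R: bounded_linear R by (rule R)
  \<comment> \<open>\<open>S\<close> collects the bounds valid on some member. For the subspaces of
    finite codimension its infimum is the essential norm of \<open>R\<close>.\<close>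
  define S where "S = {c. \<exists>V\<in>\<V>. \<forall>u\<in>V. norm (R u) \<le> c * norm u}"
  define \<kappa> where "\<kappa> = Inf S"
  have S_ge: "\<epsilon> \<le> c" if c: "c \<in> S" for c
  proof -
    obtain V where V: "V \<in> \<V>" "\<And>u. u \<in> V \<Longrightarrow> norm (R u) \<le> c * norm u"
      using c unfolding S_def by auto
    obtain u where u: "u \<in> V" "norm (R u) > \<epsilon> * norm u" using large[OF V(1)] by blast
    have "\<epsilon> * norm u < c * norm u" using u V(2)[OF u(1)] by linarith
    then show ?thesis by (meson mult_right_mono norm_ge_zero not_less less_le_not_le linorder_le_cases)
  qed
  have S_ne: "S \<noteq> {}"
  proof -
    obtain K where "\<And>u. norm (R u) \<le> norm u * K" using R.bounded by blast
    then have "K \<in> S" unfolding S_def using ne by (auto simp: mult.commute)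
    then show ?thesis by blast
  qed
  have bdd: "bdd_below S" using S_ge by (meson bdd_belowI)
  have \<kappa>_ge: "\<kappa> \<ge> \<epsilon>" unfolding \<kappa>_def using S_ne S_ge by (meson cInf_greatest)
  then have \<kappa>_pos: "\<kappa> > 0" using eps by simp
  have upper: "\<exists>V\<in>\<V>. \<forall>u\<in>V. norm (R u) \<le> (\<kappa> + \<eta>) * norm u" if "\<eta> > 0" for \<eta>
  proof -
    have "Inf S < \<kappa> + \<eta>" unfolding \<kappa>_def using that by simp
    then obtain c where c: "c \<in> S" "c < \<kappa> + \<eta>" using cInf_less_iff[OF S_ne bdd] by blast
    then obtain V where "V \<in> \<V>" "\<And>u. u \<in> V \<Longrightarrow> norm (R u) \<le> c * norm u" unfolding S_def by auto
    moreover have "c * norm u \<le> (\<kappa> + \<eta>) * norm u" for u :: 'a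
      using c(2) by (intro mult_right_mono) auto
    ultimately show ?thesis by (meson order_trans)
  qed
  have lower: "\<exists>u\<in>V. norm (R u) > (\<kappa> - \<eta>) * norm u" if "\<eta> > 0" "V \<in> \<V>" for \<eta> V
  proof (rule ccontr)
    assume "\<not> ?thesis"
    then have "\<kappa> - \<eta> \<in> S" unfolding S_def using that by (auto simp: not_less)
    then have "\<kappa> \<le> \<kappa> - \<eta>" unfolding \<kappa>_def using cInf_lower[OF _ bdd] by blast
    then show False using that by simp
  qed
  have square: "\<exists>u\<in>V. norm u > C * norm (R (R u) - \<kappa>\<^sup>2 *\<^sub>R u)" if V: "V \<in> \<V>" for V C
  proof -
    \<comment> \<open>\<open>poly \<eta>\<close> bounds norm (R R u - \<kappa>^2 u)^2 / norm u^2
      once norm (R R u) is at most \<kappa> + \<eta> times norm (R u) and norm (R u) at least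
      \<kappa> - \<eta> times norm u. It vanishes at \<eta> = 0.\<close>
    define poly where "poly \<eta> = ((\<kappa> + \<eta>)\<^sup>2 - 2 * \<kappa>\<^sup>2) * (\<kappa> - \<eta>)\<^sup>2 + \<kappa>^4" for \<eta>
    have "(poly \<longlongrightarrow> poly 0) (at_right 0)"
      unfolding poly_def by (intro tendsto_intros)
    moreover have "poly 0 = 0" unfolding poly_def by (simp add: algebra_simps power2_eq_square power4_eq_xxxx)
    ultimately have "\<forall>\<^sub>F \<eta> in at_right 0. poly \<eta> < 1 / (1 + C\<^sup>2)"
      by (intro order_tendstoD(2)) (auto simp: add_pos_nonneg)
    \<comment> \<open>Below \<kappa> / 3 one has (\<kappa> + \<eta>)^2 \<le> 2 \<kappa>^2, so the
      term in norm (R u)^2 has a nonpositive coefficient and the lower bound of norm (R u) can be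
      inserted.\<close>
    moreover have "\<forall>\<^sub>F \<eta> in at_right 0. 0 < \<eta> \<and> \<eta> < \<kappa> / 3"
      using \<kappa>_pos by (auto simp: eventually_at_right_field intro!: exI[of _ "\<kappa>/3"])
    ultimately obtain \<eta> where \<eta>: "0 < \<eta>" "\<eta> < \<kappa> / 3" "poly \<eta> < 1 / (1 + C\<^sup>2)"
      using eventually_happens[OF eventually_conj] trivial_limit_at_right_real by blast
    obtain V1 where V1: "V1 \<in> \<V>" "\<And>u. u \<in> V1 \<Longrightarrow> norm (R u) \<le> (\<kappa> + \<eta>) * norm u"
      using upper[OF \<eta>(1)] by blast
    \<comment> \<open>The upper bound holds on \<open>V1\<close> and has to be applied to
      \<open>R u\<close>, so \<open>u\<close> is taken from a member that \<open>R\<close> maps into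
      \<open>V1\<close>.\<close>
    obtain V2 where V2: "V2 \<in> \<V>" "R ` V2 \<subseteq> V1" using inv[OF V1(1)] by blast
    obtain U where U: "U \<in> \<V>" "U \<subseteq> V \<inter> V2" using dir[OF V V2(1)] by blast
    obtain u where u: "u \<in> U" "norm (R u) > (\<kappa> - \<eta>) * norm u" using lower[OF \<eta>(1) U(1)] by blast
    have u0: "norm u > 0" using u by (cases "u = 0") (auto simp: R.zero)
    have RRu: "norm (R (R u)) \<le> (\<kappa> + \<eta>) * norm (R u)" using u(1) U(2) V2(2) V1(2) by blast
    have "(norm (R (R u) - \<kappa>\<^sup>2 *\<^sub>R u))\<^sup>2 = (norm (R (R u)))\<^sup>2 - 2 * \<kappa>\<^sup>2 * (R (R u) \<bullet> u) + \<kappa>^4 * (norm u)\<^sup>2"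
      unfolding power2_norm_eq_inner
      by (simp add: inner_diff_left inner_diff_right inner_commute algebra_simps power4_eq_xxxx power2_eq_square)
    also have "R (R u) \<bullet> u = (norm (R u))\<^sup>2" by (simp add: sym power2_norm_eq_inner)
    also have "(norm (R (R u)))\<^sup>2 \<le> (\<kappa> + \<eta>)\<^sup>2 * (norm (R u))\<^sup>2"
      using power_mono[OF RRu norm_ge_zero, of 2] by (simp add: power_mult_distrib)
    also have "(\<kappa> + \<eta>)\<^sup>2 * (norm (R u))\<^sup>2 - 2 * \<kappa>\<^sup>2 * (norm (R u))\<^sup>2 + \<kappa>^4 * (norm u)\<^sup>2
        = \<kappa>^4 * (norm u)\<^sup>2 - (2 * \<kappa>\<^sup>2 - (\<kappa> + \<eta>)\<^sup>2) * (norm (R u))\<^sup>2" by (simp add: algebra_simps)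
    also have "\<dots> \<le> \<kappa>^4 * (norm u)\<^sup>2 - (2 * \<kappa>\<^sup>2 - (\<kappa> + \<eta>)\<^sup>2) * ((\<kappa> - \<eta>)\<^sup>2 * (norm u)\<^sup>2)"
    proof -
      have "(\<kappa> + \<eta>)\<^sup>2 \<le> (\<kappa> + \<kappa>/3)\<^sup>2" using \<eta> \<kappa>_pos by (intro power_mono) auto
      also have "\<dots> \<le> 2 * \<kappa>\<^sup>2" by (simp add: power2_eq_square field_simps)
      finally have "0 \<le> 2 * \<kappa>\<^sup>2 - (\<kappa> + \<eta>)\<^sup>2" by simp
      moreover have "(\<kappa> - \<eta>)\<^sup>2 * (norm u)\<^sup>2 \<le> (norm (R u))\<^sup>2"
        using power_mono[of "(\<kappa> - \<eta>) * norm u" "norm (R u)" 2] u(2) \<eta> \<kappa>_pos by (simp add: power_mult_distrib)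
      ultimately show ?thesis by (intro diff_left_mono mult_left_mono)
    qed
    also have "\<dots> = poly \<eta> * (norm u)\<^sup>2" by (simp add: poly_def algebra_simps)
    finally have le: "(norm (R (R u) - \<kappa>\<^sup>2 *\<^sub>R u))\<^sup>2 \<le> poly \<eta> * (norm u)\<^sup>2" by simp
    have "(C * norm (R (R u) - \<kappa>\<^sup>2 *\<^sub>R u))\<^sup>2 \<le> C\<^sup>2 * (poly \<eta> * (norm u)\<^sup>2)"
      unfolding power_mult_distrib using le by (intro mult_left_mono) auto
    also have "\<dots> \<le> C\<^sup>2 * (1 / (1 + C\<^sup>2) * (norm u)\<^sup>2)"
      using \<eta>(3) by (intro mult_left_mono mult_right_mono) auto
    also have "\<dots> < (norm u)\<^sup>2"
      using u0 by (auto simp: divide_simps add_pos_nonneg algebra_simps)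
    finally have "C * norm (R (R u) - \<kappa>\<^sup>2 *\<^sub>R u) < norm u"
      using power2_less_imp_less norm_ge_zero by blast
    then show ?thesis using u(1) U(2) by blast
  qed
  \<comment> \<open>If both signs failed, R - \<kappa> would be bounded below on \<open>V1\<close>
    and R + \<kappa> on \<open>V2\<close>. For \<open>u\<close> deep enough in the family, w = R u +
    \<kappa> u lies in \<open>V1\<close>, and composing the two bounds contradicts
    \<open>square\<close>.\<close>
  have "\<exists>\<mu>\<in>{\<kappa>, -\<kappa>}. \<forall>V\<in>\<V>. \<forall>C. \<exists>u\<in>V. norm u > C * norm (R u - \<mu> *\<^sub>R u)"
  proof (rule ccontr)
    assume "\<not> ?thesis"
    then obtain V1 C1 V2 C2 where V1: "V1 \<in> \<V>" "\<And>u. u \<in> V1 \<Longrightarrow> norm u \<le> C1 * norm (R u - \<kappa> *\<^sub>R u)"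
      and V2: "V2 \<in> \<V>" "\<And>u. u \<in> V2 \<Longrightarrow> norm u \<le> C2 * norm (R u + \<kappa> *\<^sub>R u)"
      by (auto simp: not_less) blast
    obtain V3 where V3: "V3 \<in> \<V>" "R ` V3 \<subseteq> V1" using inv[OF V1(1)] by blast
    obtain V4 where V4: "V4 \<in> \<V>" "V4 \<subseteq> V1 \<inter> V2" using dir[OF V1(1) V2(1)] by blast
    obtain U where U: "U \<in> \<V>" "U \<subseteq> V3 \<inter> V4" using dir[OF V3(1) V4(1)] by blast
    obtain u where u: "u \<in> U" "norm u > (\<bar>C2\<bar> * C1) * norm (R (R u) - \<kappa>\<^sup>2 *\<^sub>R u)"
      using square[OF U(1)] by blast
    define w where "w = R u + \<kappa> *\<^sub>R u"
    have "w \<in> V1" unfolding w_def using u(1) U(2) V3(2) V4(2) sub[OF V1(1)]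
      by (intro subspace_add subspace_scale) auto
    then have "norm w \<le> C1 * norm (R w - \<kappa> *\<^sub>R w)" by (rule V1(2))
    also have "R w - \<kappa> *\<^sub>R w = R (R u) - \<kappa>\<^sup>2 *\<^sub>R u"
      unfolding w_def by (simp add: R.add R.scaleR algebra_simps power2_eq_square)
    finally have w: "norm w \<le> C1 * norm (R (R u) - \<kappa>\<^sup>2 *\<^sub>R u)" .
    have "norm u \<le> C2 * norm w" unfolding w_def using u(1) U(2) V4(2) by (intro V2(2)) auto
    also have "\<dots> \<le> \<bar>C2\<bar> * norm w" by (intro mult_right_mono) auto
    also have "\<dots> \<le> \<bar>C2\<bar> * (C1 * norm (R (R u) - \<kappa>\<^sup>2 *\<^sub>R u))" using w by (intro mult_left_mono) auto
    finally show False using u(2) by (simp add: mult.assoc)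
  qed
  then obtain \<mu> where "\<mu> \<in> {\<kappa>, -\<kappa>}" and \<mu>: "\<forall>V\<in>\<V>. \<forall>C. \<exists>u\<in>V. norm u > C * norm (R u - \<mu> *\<^sub>R u)"
    by (rule bexE)
  then have "\<bar>\<mu>\<bar> \<ge> \<epsilon>" using \<kappa>_ge \<kappa>_pos by auto
  then show ?thesis using that \<mu> by simp
qed

section \<open>Resolvents of a symmetric closed graph at real points\<close>

definition regular_value :: "('a::real_inner \<times> 'a) set \<Rightarrow> real \<Rightarrow> bool" where
  "regular_value T a \<longleftrightarrow> (\<forall>h. \<exists>(f, g)\<in>T. g - a *\<^sub>R f = h) \<and>
     (\<exists>C. \<forall>(f, g)\<in>T. norm f \<le> C * norm (g - a *\<^sub>R f))"

text \<open>The operator is kept as a closed linear relation. A real regular value makes such a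
  symmetric relation self-adjoint, so the existence of one carries the rest of the argument.\<close>

locale symmetric_graph =
  fixes T :: "('a::{real_inner,complete_space} \<times> 'a) set"
  assumes subspace_T: "subspace T" and closed_T: "closed T"
    and symmetric_T: "\<And>f g u v. (f, g) \<in> T \<Longrightarrow> (u, v) \<in> T \<Longrightarrow> g \<bullet> u = f \<bullet> v"
begin

text \<open>At a regular value this is the resolvent, the inverse of T - a; the choice is then
  unique by the norm estimate, see \<open>res_eq\<close>.\<close>

definition res :: "real \<Rightarrow> 'a \<Rightarrow> 'a" where
  "res a h = (SOME f. (f, h + a *\<^sub>R f) \<in> T)"

lemma add_T: "(f, g) \<in> T \<Longrightarrow> (u, v) \<in> T \<Longrightarrow> (f + u, g + v) \<in> T"
  using subspace_add[OF subspace_T, of "(f, g)" "(u, v)"] by simp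

lemma scale_T: "(f, g) \<in> T \<Longrightarrow> (c *\<^sub>R f, c *\<^sub>R g) \<in> T"
  using subspace_scale[OF subspace_T, of "(f, g)" c] by simp

lemma diff_T: "(f, g) \<in> T \<Longrightarrow> (u, v) \<in> T \<Longrightarrow> (f - u, g - v) \<in> T"
  using subspace_diff[OF subspace_T, of "(f, g)" "(u, v)"] by simp

lemma regular_bound:
  assumes "regular_value T a"
  obtains C where "C \<ge> 0" "\<And>f g. (f, g) \<in> T \<Longrightarrow> norm f \<le> C * norm (g - a *\<^sub>R f)"
proof -
  obtain C where C: "\<And>f g. (f, g) \<in> T \<Longrightarrow> norm f \<le> C * norm (g - a *\<^sub>R f)"
    using assms unfolding regular_value_def by blast
  show ?thesis
  proof (rule that)
    show "norm f \<le> \<bar>C\<bar> * norm (g - a *\<^sub>R f)" if "(f, g) \<in> T" for f g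
      by (rule order_trans[OF C[OF that] mult_right_mono[OF abs_ge_self norm_ge_zero]])
  qed simp
qed

lemma res_in_T:
  assumes "regular_value T a" shows "(res a h, h + a *\<^sub>R res a h) \<in> T"
proof -
  obtain f g where "(f, g) \<in> T" "g - a *\<^sub>R f = h"
    using assms unfolding regular_value_def by blast
  then have "(f, h + a *\<^sub>R f) \<in> T" by auto
  then show ?thesis unfolding res_def by (rule someI)
qed

lemma res_eq:
  assumes reg: "regular_value T a" and fg: "(f, g) \<in> T" shows "res a (g - a *\<^sub>R f) = f"
proof -
  obtain C where C: "\<And>f g. (f, g) \<in> T \<Longrightarrow> norm f \<le> C * norm (g - a *\<^sub>R f)"
    by (rule regular_bound[OF reg]) blast
  define h where "h = g - a *\<^sub>R f"
  have "norm (res a h - f) \<le> C * norm (h + a *\<^sub>R res a h - g - a *\<^sub>R (res a h - f))"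
    by (rule C[OF diff_T[OF res_in_T[OF reg] fg]])
  also have "h + a *\<^sub>R res a h - g - a *\<^sub>R (res a h - f) = 0"
    unfolding h_def by (simp add: scaleR_diff_right)
  finally show ?thesis unfolding h_def by simp
qed

lemma res_eqI: "regular_value T a \<Longrightarrow> (f, h + a *\<^sub>R f) \<in> T \<Longrightarrow> res a h = f"
  using res_eq[of a f "h + a *\<^sub>R f"] by simp

lemma bounded_linear_res:
  assumes reg: "regular_value T a" shows "bounded_linear (res a)"
proof -
  obtain C where C: "\<And>f g. (f, g) \<in> T \<Longrightarrow> norm f \<le> C * norm (g - a *\<^sub>R f)"
    by (rule regular_bound[OF reg]) blast
  show ?thesis
  proof (rule bounded_linear_intro)
    show "res a (u + v) = res a u + res a v" for u v
      using add_T[OF res_in_T[OF reg, of u] res_in_T[OF reg, of v]]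
      by (intro res_eqI[OF reg]) (simp add: algebra_simps)
    show "res a (r *\<^sub>R u) = r *\<^sub>R res a u" for r u
      using scale_T[OF res_in_T[OF reg, of u], of r]
      by (intro res_eqI[OF reg]) (simp add: algebra_simps)
    show "norm (res a u) \<le> norm u * C" for u
      using C[OF res_in_T[OF reg, of u]] by (simp add: mult.commute)
  qed
qed

lemma res_symmetric:
  assumes reg: "regular_value T a" shows "res a u \<bullet> v = u \<bullet> res a v"
  using symmetric_T[OF res_in_T[OF reg, of u] res_in_T[OF reg, of v]]
  by (simp add: inner_add_left inner_add_right inner_commute)

end

text \<open>
  With \<open>S = T - z\<close>, the operators below are \<open>S (S\<^sup>2 - t\<^sup>2)\<inverse>\<close> and \<open>t\<^sup>2 (S\<^sup>2 - t\<^sup>2)\<inverse>\<close>.  As \<open>t \<rightarrow> 0\<close> the first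
  stays bounded and the second tends to minus the orthogonal projection onto the kernel of \<open>S\<close>.
\<close>

locale isolated_value = symmetric_graph T for T :: "('a::{real_inner,complete_space} \<times> 'a) set" +
  fixes z \<delta> :: real
  assumes \<delta>_pos: "\<delta> > 0" and isolated: "\<And>s. 0 < \<bar>s\<bar> \<Longrightarrow> \<bar>s\<bar> < \<delta> \<Longrightarrow> regular_value T (z + s)"
begin

definition K :: "real \<Rightarrow> 'a \<Rightarrow> 'a" where
  "K t h = (1/2) *\<^sub>R (res (z + t) h + res (z - t) h)"

definition J :: "real \<Rightarrow> 'a \<Rightarrow> 'a" where
  "J t h = (t/2) *\<^sub>R (res (z + t) h - res (z - t) h)"

context
  fixes t :: real assumes t: "0 < t" "t < \<delta>"
begin

lemma regular_pm: "regular_value T (z + t)" "regular_value T (z - t)"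
  using isolated[of t] isolated[of "-t"] t by auto

lemma bounded_linear_K: "bounded_linear (K t)"
  unfolding K_def using regular_pm by (intro bounded_linear_const_scaleR bounded_linear_add bounded_linear_res)

lemma K_symmetric: "K t u \<bullet> v = u \<bullet> K t v"
  unfolding K_def using res_symmetric[OF regular_pm(1)] res_symmetric[OF regular_pm(2)]
  by (simp add: inner_add_left inner_add_right)

lemma J_symmetric: "J t u \<bullet> v = u \<bullet> J t v"
  unfolding J_def using res_symmetric[OF regular_pm(1)] res_symmetric[OF regular_pm(2)]
  by (simp add: inner_diff_left inner_diff_right)

text \<open>With S = T - z this says S K = 1 + J. Together with S J = t^2 K and with K S = 1 + J on
  the domain, proved next, it stands in for a functional calculus.\<close>

lemma K_in_T: "(K t h, h + J t h + z *\<^sub>R K t h) \<in> T"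
proof -
  have "h + J t h + z *\<^sub>R K t h
      = (1/2) *\<^sub>R ((h + (z + t) *\<^sub>R res (z + t) h) + (h + (z - t) *\<^sub>R res (z - t) h))"
    unfolding K_def J_def by (subst scaleR_half_double[of h, symmetric]) (simp add: algebra_simps del: scaleR_half_double)
  then show ?thesis
    using scale_T[OF add_T[OF res_in_T[OF regular_pm(1)] res_in_T[OF regular_pm(2)]], of "1/2" h h]
    unfolding K_def[symmetric] by simp
qed

lemma J_in_T: "(J t h, t\<^sup>2 *\<^sub>R K t h + z *\<^sub>R J t h) \<in> T"
proof -
  have "t\<^sup>2 *\<^sub>R K t h + z *\<^sub>R J t h
      = (t/2) *\<^sub>R ((h + (z + t) *\<^sub>R res (z + t) h) - (h + (z - t) *\<^sub>R res (z - t) h))"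
    unfolding K_def J_def by (simp add: algebra_simps power2_eq_square)
  then show ?thesis
    using scale_T[OF diff_T[OF res_in_T[OF regular_pm(1)] res_in_T[OF regular_pm(2)]], of "t/2" h h]
    unfolding J_def[symmetric] by simp
qed

lemma K_apply_T:
  assumes "(v, g) \<in> T" shows "K t (g - z *\<^sub>R v) = v + J t v"
proof -
  interpret p: bounded_linear "res (z + t)" by (rule bounded_linear_res[OF regular_pm(1)])
  interpret m: bounded_linear "res (z - t)" by (rule bounded_linear_res[OF regular_pm(2)])
  have "g - z *\<^sub>R v = (g - (z + t) *\<^sub>R v) + t *\<^sub>R v" by (simp add: algebra_simps)
  then have 1: "res (z + t) (g - z *\<^sub>R v) = v + t *\<^sub>R res (z + t) v"
    using res_eq[OF regular_pm(1) assms] by (metis p.add p.scaleR)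
  have "g - z *\<^sub>R v = (g - (z - t) *\<^sub>R v) - t *\<^sub>R v" by (simp add: algebra_simps)
  then have 2: "res (z - t) (g - z *\<^sub>R v) = v - t *\<^sub>R res (z - t) v"
    using res_eq[OF regular_pm(2) assms] by (metis m.diff m.scaleR)
  show ?thesis unfolding K_def J_def 1 2
    by (subst (3) scaleR_half_double[of v, symmetric]) (simp add: algebra_simps del: scaleR_half_double)
qed

text \<open>A piece of spectral mapping. \<open>K t\<close> is the function s / (s^2 - t^2) of S = T
  - z, and the equations say that \<open>s1\<close> and \<open>s2\<close> are two points where this
  function takes the value \<mu>. If S is boundedly invertible after subtracting either of them,
  then \<mu> is no approximate eigenvalue of \<open>K t\<close>.\<close>

lemma K_bounded_below:
  assumes "\<mu> \<noteq> 0" and s: "\<mu> * s1\<^sup>2 - s1 = \<mu> * t\<^sup>2" "\<mu> * s2\<^sup>2 - s2 = \<mu> * t\<^sup>2" "s1 \<noteq> s2"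
    and reg: "regular_value T (z + s1)" "regular_value T (z + s2)"
  shows "\<exists>C. \<forall>u. norm u \<le> C * norm (K t u - \<mu> *\<^sub>R u)"
proof -
  obtain C1 where C1: "C1 \<ge> 0" "\<And>f g. (f, g) \<in> T \<Longrightarrow> norm f \<le> C1 * norm (g - (z + s1) *\<^sub>R f)"
    by (rule regular_bound[OF reg(1)]) blast
  obtain C2 where C2: "C2 \<ge> 0" "\<And>f g. (f, g) \<in> T \<Longrightarrow> norm f \<le> C2 * norm (g - (z + s2) *\<^sub>R f)"
    by (rule regular_bound[OF reg(2)]) blast
  define C where "C = ((C1 * \<bar>s1\<bar> + C2 * \<bar>s2\<bar>) / \<bar>\<mu>\<bar> / \<bar>s1 - s2\<bar> + 1) / \<bar>\<mu>\<bar>"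
  have "norm u \<le> C * norm (K t u - \<mu> *\<^sub>R u)" for u
  proof -
    define a b y where "a = K t u" "b = J t u" "y = K t u - \<mu> *\<^sub>R u"
    note defs = this
    have u: "u = (1/\<mu>) *\<^sub>R (a - y)" using \<open>\<mu> \<noteq> 0\<close> by (simp add: defs)
    \<comment> \<open>Applying S - s to s K u + J u gives s u + (t^2 - s^2) K u, and the equation
      for \<open>s\<close> turns this into -(s / \<mu>) y. Subtracting the estimates for the two
      roots isolates K u.\<close>
    have eig: "norm (s *\<^sub>R a + b) \<le> C' * \<bar>s\<bar> / \<bar>\<mu>\<bar> * norm y"
      if s: "\<mu> * s\<^sup>2 - s = \<mu> * t\<^sup>2" and C': "\<And>f g. (f, g) \<in> T \<Longrightarrow> norm f \<le> C' * norm (g - (z + s) *\<^sub>R f)" for s C'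
    proof -
      define f where "f = s *\<^sub>R a + b"
      have "(f, s *\<^sub>R (u + b + z *\<^sub>R a) + (t\<^sup>2 *\<^sub>R a + z *\<^sub>R b)) \<in> T"
        unfolding f_def defs by (intro add_T scale_T K_in_T J_in_T)
      then have "norm f \<le> C' * norm (s *\<^sub>R (u + b + z *\<^sub>R a) + (t\<^sup>2 *\<^sub>R a + z *\<^sub>R b) - (z + s) *\<^sub>R f)"
        by (rule C')
      also have "s *\<^sub>R (u + b + z *\<^sub>R a) + (t\<^sup>2 *\<^sub>R a + z *\<^sub>R b) - (z + s) *\<^sub>R f
          = s *\<^sub>R u + (t\<^sup>2 - s\<^sup>2) *\<^sub>R a"
        unfolding f_def by (simp add: algebra_simps power2_eq_square)
      also have "t\<^sup>2 - s\<^sup>2 = - s / \<mu>" using s \<open>\<mu> \<noteq> 0\<close> by (simp add: field_simps)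
      also have "s *\<^sub>R u + (- s / \<mu>) *\<^sub>R a = (- s / \<mu>) *\<^sub>R y"
        unfolding u by (simp add: algebra_simps)
      finally show ?thesis unfolding f_def by (simp add: abs_divide)
    qed
    have "(s1 *\<^sub>R a + b) - (s2 *\<^sub>R a + b) = (s1 - s2) *\<^sub>R a" by (simp add: algebra_simps)
    then have "\<bar>s1 - s2\<bar> * norm a \<le> norm (s1 *\<^sub>R a + b) + norm (s2 *\<^sub>R a + b)"
      by (metis norm_scaleR norm_triangle_ineq4)
    also have "\<dots> \<le> (C1 * \<bar>s1\<bar> + C2 * \<bar>s2\<bar>) / \<bar>\<mu>\<bar> * norm y"
      using eig[OF s(1) C1(2)] eig[OF s(2) C2(2)] by (simp add: add_divide_distrib distrib_right)
    finally have "norm a * \<bar>s1 - s2\<bar> \<le> (C1 * \<bar>s1\<bar> + C2 * \<bar>s2\<bar>) / \<bar>\<mu>\<bar> * norm y"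
      by (simp only: mult.commute)
    then have "norm a \<le> (C1 * \<bar>s1\<bar> + C2 * \<bar>s2\<bar>) / \<bar>\<mu>\<bar> * norm y / \<bar>s1 - s2\<bar>"
      using s(3) by (subst pos_le_divide_eq) auto
    then have "norm a \<le> (C1 * \<bar>s1\<bar> + C2 * \<bar>s2\<bar>) / \<bar>\<mu>\<bar> / \<bar>s1 - s2\<bar> * norm y"
      by simp
    moreover have "norm u = norm (a - y) / \<bar>\<mu>\<bar>" by (subst u) simp
    moreover have "norm (a - y) \<le> norm a + norm y" by (rule norm_triangle_ineq4)
    ultimately have "norm u \<le> ((C1 * \<bar>s1\<bar> + C2 * \<bar>s2\<bar>) / \<bar>\<mu>\<bar> / \<bar>s1 - s2\<bar> * norm y + norm y) / \<bar>\<mu>\<bar>"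
      by (simp add: divide_right_mono)
    then show ?thesis unfolding C_def defs(3)[symmetric] by (simp add: algebra_simps)
  qed
  then show ?thesis by blast
qed

end

text \<open>Off 0 the spectrum of S = T - z keeps distance \<delta> from 0, and for |s| \<ge>
  \<delta> and t \<le> \<delta> / 2 the function s / (s^2 - t^2) has modulus at most 4 / (3
  \<delta>); at s = 0 it vanishes. So a value \<mu> of modulus at least 2 / \<delta> is taken only
  at regular points, and \<open>K_bounded_below\<close> excludes it. The bound does not depend on
  \<open>t\<close>.\<close>

lemma norm_K_le:
  assumes t: "0 < t" "t \<le> \<delta> / 2" shows "norm (K t u) \<le> 2 / \<delta> * norm u"
proof (rule ccontr)
  assume large: "\<not> norm (K t u) \<le> 2 / \<delta> * norm u"
  have t': "0 < t" "t < \<delta>" using t \<delta>_pos by auto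
  \<comment> \<open>The family \<open>{UNIV}\<close> gives the classical statement about the norm of
    a bounded symmetric operator.\<close>
  obtain \<mu> where \<mu>: "\<bar>\<mu>\<bar> \<ge> 2 / \<delta>" "\<And>C. \<exists>u. norm u > C * norm (K t u - \<mu> *\<^sub>R u)"
  proof (rule approximate_eigenvalue[OF bounded_linear_K[OF t'] K_symmetric[OF t'], of "{UNIV}" "2 / \<delta>"])
    show "\<exists>u\<in>V. norm (K t u) > 2 / \<delta> * norm u" if "V \<in> {UNIV}" for V
      using large that by (auto simp: not_le)
  qed (use \<delta>_pos in auto)
  have "\<mu> \<noteq> 0" using \<mu>(1) \<delta>_pos by (auto simp: divide_le_0_iff)
  \<comment> \<open>\<open>r\<close> is the root of the discriminant of the quadratic equation in s
    that expresses s / (s^2 - t^2) = \<mu>; \<open>s1\<close> and \<open>s2\<close> are its two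
    solutions.\<close>
  define r where "r = sqrt (1 + 4 * \<mu>\<^sup>2 * t\<^sup>2)"
  have r: "r\<^sup>2 = 1 + 4 * \<mu>\<^sup>2 * t\<^sup>2" "r > 0" unfolding r_def by (auto simp: add_pos_nonneg)
  define s1 s2 where "s1 = (1 + r) / (2 * \<mu>)" and "s2 = (1 - r) / (2 * \<mu>)"
  have s: "\<mu> * s1\<^sup>2 - s1 = \<mu> * t\<^sup>2" "\<mu> * s2\<^sup>2 - s2 = \<mu> * t\<^sup>2" "s1 \<noteq> s2"
    using r \<open>\<mu> \<noteq> 0\<close> unfolding s1_def s2_def
    by (auto simp: field_simps power2_eq_square)
  have reg: "regular_value T (z + s)" if s: "\<mu> * s\<^sup>2 - s = \<mu> * t\<^sup>2" for s
  proof (rule isolated)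
    show "0 < \<bar>s\<bar>" using s t \<open>\<mu> \<noteq> 0\<close> by auto
    show "\<bar>s\<bar> < \<delta>"
    proof (rule ccontr)
      assume "\<not> \<bar>s\<bar> < \<delta>"
      then have s\<delta>: "\<delta> \<le> \<bar>s\<bar>" by simp
      have "\<mu> * (s\<^sup>2 - t\<^sup>2) = s" using s by (simp add: algebra_simps)
      then have eq: "\<bar>\<mu>\<bar> * \<bar>s\<^sup>2 - t\<^sup>2\<bar> = \<bar>s\<bar>" by (metis abs_mult)
      have "t\<^sup>2 \<le> (\<delta>/2)\<^sup>2" using t by (intro power_mono) auto
      also have "\<dots> = \<delta>\<^sup>2/4" by (simp add: power2_eq_square)
      also have "\<delta>\<^sup>2 / 4 \<le> s\<^sup>2 / 4" using s\<delta> \<delta>_pos by (simp add: abs_le_square_iff[symmetric])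
      finally have "3/4 * s\<^sup>2 \<le> s\<^sup>2 - t\<^sup>2" by (simp add: field_simps)
      then have "3/4 * s\<^sup>2 \<le> \<bar>s\<^sup>2 - t\<^sup>2\<bar>" by (rule order_trans[OF _ abs_ge_self])
      then have "2 / \<delta> * (3/4 * s\<^sup>2) \<le> \<bar>\<mu>\<bar> * \<bar>s\<^sup>2 - t\<^sup>2\<bar>" using \<mu>(1) \<delta>_pos by (intro mult_mono) auto
      then have "2 / \<delta> * (3/4 * \<bar>s\<bar>\<^sup>2) \<le> \<bar>s\<bar>" unfolding eq by simp
      then have "3/2 * \<bar>s\<bar>\<^sup>2 \<le> \<bar>s\<bar> * \<delta>" using \<delta>_pos by (simp add: field_simps)
      also have "\<dots> \<le> \<bar>s\<bar>\<^sup>2" using mult_left_mono[OF s\<delta>, of "\<bar>s\<bar>"] by (simp add: power2_eq_square)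
      finally show False using s\<delta> \<delta>_pos by simp
    qed
  qed
  obtain C where "\<And>u. norm u \<le> C * norm (K t u - \<mu> *\<^sub>R u)"
    using K_bounded_below[OF t' \<open>\<mu> \<noteq> 0\<close> s reg[OF s(1)] reg[OF s(2)]] by blast
  then show False using \<mu>(2)[of C] by (meson not_less)
qed

text \<open>The difference J t - J s equals (t^2 - s^2) K s K t, and both factors \<open>K\<close>
  are bounded by 2 / \<delta>. This makes \<open>J t\<close> a Cauchy family as t tends to
  0.\<close>

lemma J_diff_le:
  assumes s: "0 < s" "s \<le> \<delta> / 2" and t: "0 < t" "t \<le> \<delta> / 2"
  shows "norm (J t u - J s u) \<le> \<bar>t\<^sup>2 - s\<^sup>2\<bar> * (4 / \<delta>\<^sup>2) * norm u"
proof -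
  have s': "0 < s" "s < \<delta>" and t': "0 < t" "t < \<delta>" using s t \<delta>_pos by auto
  interpret Ks: bounded_linear "K s" by (rule bounded_linear_K[OF s'])
  interpret Kt: bounded_linear "K t" by (rule bounded_linear_K[OF t'])
  have 1: "t\<^sup>2 *\<^sub>R K s (K t u) = J t u + J s (J t u)" for u
    using K_apply_T[OF s' J_in_T[OF t', of u]] by (simp add: Ks.scaleR)
  have 2: "s\<^sup>2 *\<^sub>R K t (K s u) = J s u + J t (J s u)" for u
    using K_apply_T[OF t' J_in_T[OF s', of u]] by (simp add: Kt.scaleR)
  \<comment> \<open>To avoid proving that \<open>K s\<close> and \<open>K t\<close> commute, the
    second identity is used in transposed form: moving all operators to the other side of the inner
    product reverses their order.\<close>
  have eq: "(J t u - J s u) \<bullet> w = (t\<^sup>2 - s\<^sup>2) * (K s (K t u) \<bullet> w)" for w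
  proof -
    have a: "t\<^sup>2 * (K s (K t u) \<bullet> w) = J t u \<bullet> w + J s (J t u) \<bullet> w"
      using arg_cong[OF 1[of u], of "\<lambda>v. v \<bullet> w"] by (simp add: inner_add_left)
    have "s\<^sup>2 * (u \<bullet> K t (K s w)) = u \<bullet> J s w + u \<bullet> J t (J s w)"
      using arg_cong[OF 2[of w], of "\<lambda>v. u \<bullet> v"] by (simp add: inner_add_right)
    then have "s\<^sup>2 * (K s (K t u) \<bullet> w) = J s u \<bullet> w + J s (J t u) \<bullet> w"
      by (simp only: K_symmetric[OF s'] K_symmetric[OF t'] J_symmetric[OF s'] J_symmetric[OF t'])
    with a show ?thesis by (simp add: inner_diff_left algebra_simps)
  qed
  define w where "w = J t u - J s u"
  have "norm (K s (K t u)) \<le> 2 / \<delta> * (2 / \<delta> * norm u)"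
    using norm_K_le[OF s, of "K t u"] norm_K_le[OF t, of u] \<delta>_pos
    by (meson divide_pos_pos mult_left_mono order_trans less_imp_le zero_less_numeral)
  then have KK: "norm (K s (K t u)) \<le> 4 / \<delta>\<^sup>2 * norm u" by (simp add: power2_eq_square)
  have "norm w * norm w = \<bar>t\<^sup>2 - s\<^sup>2\<bar> * \<bar>K s (K t u) \<bullet> w\<bar>"
    using eq[of w] unfolding w_def[symmetric] by (metis abs_mult abs_norm_cancel power2_eq_square power2_norm_eq_inner)
  also have "\<dots> \<le> \<bar>t\<^sup>2 - s\<^sup>2\<bar> * (norm (K s (K t u)) * norm w)"
    by (intro mult_left_mono Cauchy_Schwarz_ineq2) auto
  also have "\<dots> \<le> \<bar>t\<^sup>2 - s\<^sup>2\<bar> * ((4 / \<delta>\<^sup>2 * norm u) * norm w)"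
    using KK by (intro mult_left_mono mult_right_mono) auto
  finally have "norm w * norm w \<le> (\<bar>t\<^sup>2 - s\<^sup>2\<bar> * (4 / \<delta>\<^sup>2) * norm u) * norm w" by (simp add: mult_ac)
  then show ?thesis unfolding w_def[symmetric]
    by (cases "w = 0") (simp, metis mult_le_cancel_right_pos zero_less_norm_iff)
qed

text \<open>The spectral theorem would give this with 1 / \<delta>. Here J t v converges to a vector
  w, and w is in the kernel of T - z because (T - z) J = t^2 K tends to 0 and the graph is closed.
  So v is orthogonal to w, and pairing K (g - z v) = v + J v with v gives the estimate in the
  limit.\<close>

proposition bounded_below_off_kernel:
  assumes vg: "(v, g) \<in> T" and orth: "\<And>e. (e, z *\<^sub>R e) \<in> T \<Longrightarrow> v \<bullet> e = 0"
  shows "norm v \<le> 2 / \<delta> * norm (g - z *\<^sub>R v)"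
proof -
  \<comment> \<open>The shift by 2 gives t 0 = \<delta> / 2, so that \<open>norm_K_le\<close>
    applies for every index.\<close>
  define t where "t n = \<delta> / real (n + 2)" for n
  have t: "0 < t n" "t n \<le> \<delta> / 2" "t n < \<delta>" for n
    using \<delta>_pos unfolding t_def by (auto simp: field_simps intro!: add_pos_nonneg)
  have t0: "t \<longlonglongrightarrow> 0" unfolding t_def
    by (rule LIMSEQ_ignore_initial_segment[OF lim_const_over_n, of \<delta> 2])
  define c where "c = 4 / \<delta>\<^sup>2 * norm v"
  have "Cauchy (\<lambda>n. J (t n) v)"
  proof -
    have "Cauchy (\<lambda>n. c * (t n)\<^sup>2)"
      by (intro LIMSEQ_imp_Cauchy[of _ "c * 0\<^sup>2"] tendsto_intros t0)
    moreover have "dist (J (t m) v) (J (t n) v) \<le> dist (c * (t m)\<^sup>2) (c * (t n)\<^sup>2)" for m n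
    proof -
      have "c \<ge> 0" unfolding c_def by simp
      then have "dist (c * (t m)\<^sup>2) (c * (t n)\<^sup>2) = c * \<bar>(t m)\<^sup>2 - (t n)\<^sup>2\<bar>"
        by (simp add: dist_real_def abs_mult flip: right_diff_distrib)
      then show ?thesis
        using J_diff_le[OF t(1,2)[of n] t(1,2)[of m], of v] unfolding dist_norm c_def by (simp add: mult_ac)
    qed
    ultimately show ?thesis unfolding Cauchy_def by (meson order_le_less_trans)
  qed
  then obtain w where w: "(\<lambda>n. J (t n) v) \<longlonglongrightarrow> w" by (meson Cauchy_convergent_iff convergent_def)
  have Kv: "(\<lambda>n. (t n)\<^sup>2 *\<^sub>R K (t n) v) \<longlonglongrightarrow> 0"
  proof (rule Lim_null_comparison)
    show "\<forall>\<^sub>F n in sequentially. norm ((t n)\<^sup>2 *\<^sub>R K (t n) v) \<le> (t n)\<^sup>2 * (2 / \<delta> * norm v)"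
      unfolding norm_scaleR abs_power2
      by (intro always_eventually allI mult_left_mono norm_K_le[OF t(1,2)]) auto
    show "(\<lambda>n. (t n)\<^sup>2 * (2 / \<delta> * norm v)) \<longlonglongrightarrow> 0"
      using tendsto_mult_right[OF tendsto_power[OF t0, of 2], of "2 / \<delta> * norm v"] by simp
  qed
  have lim: "(\<lambda>n. (J (t n) v, (t n)\<^sup>2 *\<^sub>R K (t n) v + z *\<^sub>R J (t n) v)) \<longlonglongrightarrow> (w, 0 + z *\<^sub>R w)"
    by (intro tendsto_intros w Kv)
  have "(w, 0 + z *\<^sub>R w) \<in> T"
    by (rule closed_sequentially[OF closed_T J_in_T[OF t(1,3)] lim])
  then have "v \<bullet> w = 0" using orth by simp
  have "(norm v)\<^sup>2 + J (t n) v \<bullet> v \<le> 2 / \<delta> * norm (g - z *\<^sub>R v) * norm v" for n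
  proof -
    have "(norm v)\<^sup>2 + J (t n) v \<bullet> v = K (t n) (g - z *\<^sub>R v) \<bullet> v"
      unfolding K_apply_T[OF t(1,3) vg] by (simp add: inner_add_left power2_norm_eq_inner)
    also have "\<dots> \<le> norm (K (t n) (g - z *\<^sub>R v)) * norm v" by (rule norm_cauchy_schwarz)
    also have "\<dots> \<le> 2 / \<delta> * norm (g - z *\<^sub>R v) * norm v"
      by (intro mult_right_mono norm_K_le[OF t(1,2)]) simp
    finally show ?thesis .
  qed
  moreover have "(\<lambda>n. (norm v)\<^sup>2 + J (t n) v \<bullet> v) \<longlonglongrightarrow> (norm v)\<^sup>2 + w \<bullet> v"
    by (intro tendsto_intros w)
  ultimately have "(norm v)\<^sup>2 + w \<bullet> v \<le> 2 / \<delta> * norm (g - z *\<^sub>R v) * norm v"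
    by (intro LIMSEQ_le_const2) auto
  then have "norm v * norm v \<le> 2 / \<delta> * norm (g - z *\<^sub>R v) * norm v"
    using \<open>v \<bullet> w = 0\<close> by (simp add: inner_commute power2_eq_square)
  then show ?thesis
    using \<delta>_pos by (cases "v = 0") (simp, metis mult_le_cancel_right_pos zero_less_norm_iff)
qed

end

section \<open>Compactness of the resolvent and its effect on weakly null sequences\<close>

lemma bessel_projection:
  fixes C :: "'a::real_inner set"
  assumes "finite C" "pairwise orthogonal C" "c \<in> C"
  shows "(u - (\<Sum>b\<in>C. (u \<bullet> b / (b \<bullet> b)) *\<^sub>R b)) \<bullet> c = 0"
proof -
  have "(\<Sum>b\<in>C. (u \<bullet> b / (b \<bullet> b)) *\<^sub>R b) \<bullet> c = (\<Sum>b\<in>C. if b = c then u \<bullet> c else 0)"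
    unfolding inner_sum_left
    using assms(2,3) by (intro sum.cong refl) (auto simp: pairwise_def orthogonal_def)
  also have "\<dots> = u \<bullet> c" using assms(1,3) by simp
  finally show ?thesis by (simp add: inner_diff_left)
qed

context symmetric_graph
begin

text \<open>This is compactness of the resolvent, stated as smallness after finitely many
  orthogonality conditions. Were its essential norm positive, some \<mu> \<noteq> 0 would be an
  approximate eigenvalue on every subspace of finite codimension. But \<mu> belongs to a point z of
  the operator that is regular, or isolated with a kernel of finite dimension, and in both cases T -
  z is bounded below off finitely many vectors.\<close>

lemma resolvent_small_off_finite:
  assumes reg: "regular_value T a"
    and discrete: "\<And>z. \<not> regular_value T z \<Longrightarrow>
      (\<exists>\<delta>>0. \<forall>s. 0 < \<bar>s\<bar> \<and> \<bar>s\<bar> < \<delta> \<longrightarrow> regular_value T (z + s)) \<and>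
      (\<exists>B. finite B \<and> {f. (f, z *\<^sub>R f) \<in> T} \<subseteq> span B)"
    and "0 < \<epsilon>"
  shows "\<exists>B. finite B \<and> (\<forall>u. (\<forall>b\<in>B. u \<bullet> b = 0) \<longrightarrow> norm (res a u) \<le> \<epsilon> * norm u)"
proof -
  define perp where "perp B = {u. \<forall>b\<in>B. u \<bullet> b = 0}" for B :: "'a set"
  define \<V> where "\<V> = perp ` {B. finite B}"
  interpret R: bounded_linear "res a" by (rule bounded_linear_res[OF reg])
  have perp_\<V>: "finite B \<Longrightarrow> perp B \<in> \<V>" for B unfolding \<V>_def by blast
  \<comment> \<open>By symmetry, orthogonality of \<open>u\<close> to the images of \<open>B\<close>
    is orthogonality of \<open>res a u\<close> to \<open>B\<close>. It serves the invariance
    condition and also the transfer of a lower bound for T - z to the resolvent.\<close>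
  have res_perp: "res a u \<in> perp B" if "u \<in> perp (res a ` B)" for u B
    using that unfolding perp_def by (auto simp: res_symmetric[OF reg])
  have below: "\<exists>V\<in>\<V>. \<exists>C. \<forall>u\<in>V. norm u \<le> C * norm (res a u - \<mu> *\<^sub>R u)" if \<mu>: "\<mu> \<noteq> 0" for \<mu>
  proof -
    \<comment> \<open>With R = \<open>res a\<close>, the choice of \<open>z\<close> gives (T - z) R
      u = -(1 / \<mu>) (R u - \<mu> u), so lower bounds for T - z become lower bounds for R -
      \<mu>.\<close>
    define z where "z = a + 1 / \<mu>"
    have "\<exists>B C. finite B \<and> (\<forall>f g. (f, g) \<in> T \<longrightarrow> f \<in> perp B \<longrightarrow> norm f \<le> C * norm (g - z *\<^sub>R f))"
    proof (cases "regular_value T z")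
      case True
      then obtain C where "\<And>f g. (f, g) \<in> T \<Longrightarrow> norm f \<le> C * norm (g - z *\<^sub>R f)"
        by (rule regular_bound) blast
      then show ?thesis by (intro exI[of _ "{}"] exI[of _ C]) simp
    next
      case False
      then obtain \<delta> B where \<delta>: "\<delta> > 0" "\<forall>s. 0 < \<bar>s\<bar> \<and> \<bar>s\<bar> < \<delta> \<longrightarrow> regular_value T (z + s)"
        and B: "finite B" "{f. (f, z *\<^sub>R f) \<in> T} \<subseteq> span B"
        using discrete[OF False] by blast
      interpret isolated_value T z \<delta> by unfold_locales (use \<delta> in auto)
      have "norm f \<le> 2 / \<delta> * norm (g - z *\<^sub>R f)" if fg: "(f, g) \<in> T" and f: "f \<in> perp B" for f g
      proof (rule bounded_below_off_kernel[OF fg])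
        fix e assume "(e, z *\<^sub>R e) \<in> T"
        then have "e \<in> span B" using B(2) by blast
        moreover have "orthogonal f b" if "b \<in> B" for b using f that unfolding perp_def orthogonal_def by blast
        ultimately show "f \<bullet> e = 0" using orthogonal_to_span unfolding orthogonal_def by blast
      qed
      then show ?thesis using B(1) by (intro exI[of _ B] exI[of _ "2 / \<delta>"]) simp
    qed
    then obtain B C where B: "finite B" and C: "\<And>f g. (f, g) \<in> T \<Longrightarrow> f \<in> perp B \<Longrightarrow> norm f \<le> C * norm (g - z *\<^sub>R f)"
      by auto
    have "norm u \<le> (C / \<bar>\<mu>\<bar> + 1) / \<bar>\<mu>\<bar> * norm (res a u - \<mu> *\<^sub>R u)" if u: "u \<in> perp (res a ` B)" for u
    proof -
      define y where "y = res a u - \<mu> *\<^sub>R u"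
      have "norm (res a u) \<le> C * norm (u + a *\<^sub>R res a u - z *\<^sub>R res a u)"
        by (rule C[OF res_in_T[OF reg] res_perp[OF u]])
      also have "u + a *\<^sub>R res a u - z *\<^sub>R res a u = (- 1 / \<mu>) *\<^sub>R y"
        unfolding y_def z_def using \<mu> by (simp add: algebra_simps)
      finally have 1: "norm (res a u) \<le> C / \<bar>\<mu>\<bar> * norm y" by simp
      have "u = (1 / \<mu>) *\<^sub>R (res a u - y)" unfolding y_def using \<mu> by simp
      from arg_cong[OF this, of norm] have "norm u = norm (res a u - y) / \<bar>\<mu>\<bar>" by simp
      also have "\<dots> \<le> (norm (res a u) + norm y) / \<bar>\<mu>\<bar>" by (intro divide_right_mono norm_triangle_ineq4) simp
      also have "\<dots> \<le> (C / \<bar>\<mu>\<bar> * norm y + norm y) / \<bar>\<mu>\<bar>" using 1 by (intro divide_right_mono) auto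
      finally show ?thesis unfolding y_def[symmetric] by (simp add: algebra_simps)
    qed
    then show ?thesis using perp_\<V>[of "res a ` B"] B
      by (intro bexI[of _ "perp (res a ` B)"] exI[of _ "(C / \<bar>\<mu>\<bar> + 1) / \<bar>\<mu>\<bar>"]) auto
  qed
  have "\<exists>V\<in>\<V>. \<forall>u\<in>V. norm (res a u) \<le> \<epsilon> * norm u"
  proof (rule ccontr)
    assume neg: "\<not> ?thesis"
    obtain \<mu> where \<mu>: "\<bar>\<mu>\<bar> \<ge> \<epsilon>" "\<And>V C. V \<in> \<V> \<Longrightarrow> \<exists>u\<in>V. norm u > C * norm (res a u - \<mu> *\<^sub>R u)"
    proof (rule approximate_eigenvalue[OF R.bounded_linear_axioms res_symmetric[OF reg], of \<V> \<epsilon>])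
      show "\<V> \<noteq> {}" unfolding \<V>_def by blast
      show "subspace V" if "V \<in> \<V>" for V
        using that unfolding \<V>_def perp_def by (auto simp: subspace_def inner_add_left)
      show "\<exists>U\<in>\<V>. U \<subseteq> V \<inter> W" if VW: "V \<in> \<V>" "W \<in> \<V>" for V W
      proof -
        obtain A B where "finite A" "finite B" "V = perp A" "W = perp B" using VW unfolding \<V>_def by blast
        then show ?thesis using perp_\<V>[of "A \<union> B"] by (intro bexI[of _ "perp (A \<union> B)"]) (auto simp: perp_def)
      qed
      show "\<exists>U\<in>\<V>. res a ` U \<subseteq> V" if V: "V \<in> \<V>" for V
      proof -
        obtain A where "finite A" "V = perp A" using V unfolding \<V>_def by blast
        then show ?thesis using perp_\<V>[of "res a ` A"] res_perp by blast
      qed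
      show "\<exists>u\<in>V. norm (res a u) > \<epsilon> * norm u" if "V \<in> \<V>" for V
        using neg that by (auto simp: not_le)
    qed (use \<open>0 < \<epsilon>\<close> in auto)
    then have "\<mu> \<noteq> 0" using \<open>0 < \<epsilon>\<close> by auto
    then obtain V C where "V \<in> \<V>" "\<forall>u\<in>V. norm u \<le> C * norm (res a u - \<mu> *\<^sub>R u)"
      using below by blast
    then show False using \<mu>(2)[of V C] by fastforce
  qed
  then obtain B where B: "finite B" "\<forall>u\<in>perp B. norm (res a u) \<le> \<epsilon> * norm u" unfolding \<V>_def by blast
  then show ?thesis unfolding perp_def by auto
qed

text \<open>With R the resolvent at a and h n = w n - a u n, one has u n = R (h n), so 1 = h n
  \<bullet> R (u n) by symmetry, while the h n stay bounded. Hence R (u n) stays away from 0,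
  whereas a compact R sends a weakly null sequence to 0 in norm.\<close>

theorem weakly_null_not_normalized:
  assumes discrete: "\<And>z. \<not> regular_value T z \<Longrightarrow>
      (\<exists>\<delta>>0. \<forall>s. 0 < \<bar>s\<bar> \<and> \<bar>s\<bar> < \<delta> \<longrightarrow> regular_value T (z + s)) \<and>
      (\<exists>B. finite B \<and> {f. (f, z *\<^sub>R f) \<in> T} \<subseteq> span B)"
    and uw: "\<And>n::nat. (u n, w n) \<in> T" and u1: "\<And>n. norm (u n) = 1" and w_le: "\<And>n. norm (w n) \<le> M"
    and weak: "\<And>v. (\<lambda>n. u n \<bullet> v) \<longlonglongrightarrow> 0"
  shows False
proof -
  \<comment> \<open>If 0 is not regular, it is isolated among such points, and a nearby real number
    is regular.\<close>
  have "\<exists>a. regular_value T a"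
  proof (cases "regular_value T 0")
    case False
    then obtain \<delta> where "\<delta> > 0" and \<delta>: "\<forall>s. 0 < \<bar>s\<bar> \<and> \<bar>s\<bar> < \<delta> \<longrightarrow> regular_value T (0 + s)"
      using discrete[OF False] by blast
    then have "regular_value T (0 + \<delta> / 2)" by (intro \<delta>[rule_format]) auto
    then show ?thesis by blast
  qed blast
  then obtain a where reg: "regular_value T a" by blast
  interpret R: bounded_linear "res a" by (rule bounded_linear_res[OF reg])
  define N where "N = M + \<bar>a\<bar>"
  have h_le: "norm (w n - a *\<^sub>R u n) \<le> N" for n
    using norm_triangle_ineq4[of "w n" "a *\<^sub>R u n"] w_le[of n] u1[of n] unfolding N_def by simp
  have "N \<ge> 0" using h_le[of 0] norm_ge_zero order_trans by blast
  have R_ge: "1 \<le> N * norm (res a (u n))" for n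
  proof -
    have "1 = u n \<bullet> u n" using u1[of n] by (simp add: norm_eq_1)
    also have "\<dots> = res a (w n - a *\<^sub>R u n) \<bullet> u n" by (simp add: res_eq[OF reg uw])
    also have "\<dots> = (w n - a *\<^sub>R u n) \<bullet> res a (u n)" by (rule res_symmetric[OF reg])
    also have "\<dots> \<le> norm (w n - a *\<^sub>R u n) * norm (res a (u n))" by (rule norm_cauchy_schwarz)
    also have "\<dots> \<le> N * norm (res a (u n))" using h_le by (intro mult_right_mono) auto
    finally show ?thesis .
  qed
  \<comment> \<open>With this value the limit of the upper bound is N / (4 (N + 1)), which is below
    1.\<close>
  define \<epsilon> where "\<epsilon> = 1 / (4 * (N + 1))"
  have "\<epsilon> > 0" unfolding \<epsilon>_def using \<open>N \<ge> 0\<close> by simp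
  obtain B where B: "finite B" "\<And>u. (\<And>b. b \<in> B \<Longrightarrow> u \<bullet> b = 0) \<Longrightarrow> norm (res a u) \<le> \<epsilon> * norm u"
    using resolvent_small_off_finite[OF reg discrete \<open>\<epsilon> > 0\<close>] by auto
  obtain C where C: "finite C" "span C = span B" "pairwise orthogonal C"
    using basis_orthogonal[OF B(1)] by blast
  \<comment> \<open>\<open>P n\<close> is the orthogonal projection to the span of \<open>B\<close>.
    Its finitely many coefficients tend to 0 by weak convergence, so \<open>P n\<close> tends to 0
    in norm, and the remainder is orthogonal to \<open>B\<close>.\<close>
  define P where "P n = (\<Sum>b\<in>C. (u n \<bullet> b / (b \<bullet> b)) *\<^sub>R b)" for n
  have "P \<longlonglongrightarrow> (\<Sum>b\<in>C. (0 / (b \<bullet> b)) *\<^sub>R b)"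
    unfolding P_def divide_inverse by (intro tendsto_intros weak)
  then have P0: "P \<longlonglongrightarrow> 0" by simp
  have perp: "(u n - P n) \<bullet> b = 0" if "b \<in> B" for n b
  proof -
    have "orthogonal (u n - P n) c" if "c \<in> C" for c
      unfolding P_def orthogonal_def by (rule bessel_projection[OF C(1,3) that])
    moreover have "b \<in> span C" using that C(2) span_base by blast
    ultimately show ?thesis using orthogonal_to_span unfolding orthogonal_def by blast
  qed
  have le: "norm (res a (u n)) \<le> norm (res a (P n)) + \<epsilon> * (1 + norm (P n))" for n
  proof -
    have "norm (res a (u n)) = norm (res a (P n) + res a (u n - P n))" by (simp flip: R.add)
    also have "\<dots> \<le> norm (res a (P n)) + norm (res a (u n - P n))" by (rule norm_triangle_ineq)
    also have "norm (res a (u n - P n)) \<le> \<epsilon> * norm (u n - P n)" using perp by (rule B(2))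
    also have "\<dots> \<le> \<epsilon> * (1 + norm (P n))"
      using norm_triangle_ineq4[of "u n" "P n"] u1[of n] \<open>\<epsilon> > 0\<close> by (intro mult_left_mono) auto
    finally show ?thesis by simp
  qed
  have "(\<lambda>n. N * (norm (res a (P n)) + \<epsilon> * (1 + norm (P n)))) \<longlonglongrightarrow> N * (norm (0::'a) + \<epsilon> * (1 + norm (0::'a)))"
    using R.tendsto_zero[OF P0] by (intro tendsto_intros P0) auto
  moreover have "1 \<le> N * (norm (res a (P n)) + \<epsilon> * (1 + norm (P n)))" for n
    using R_ge[of n] mult_left_mono[OF le[of n] \<open>N \<ge> 0\<close>] by linarith
  ultimately have "1 \<le> N * (norm (0::'a) + \<epsilon> * (1 + norm (0::'a)))"
    by (intro LIMSEQ_le_const) auto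
  then show False using \<open>N \<ge> 0\<close> unfolding \<epsilon>_def by (simp add: field_simps)
qed

end

section \<open>Symmetry of the minimal operator\<close>

lemma has_second_deriv_iff_negligible:
  "has_second_deriv f h \<longleftrightarrow>
    (\<exists>N. negligible N \<and> (\<forall>y\<in>{0..} - N. (deriv1 f has_vector_derivative h y) (at y)))"
proof -
  have "has_second_deriv f h \<longleftrightarrow> (AE y in lebesgue. y \<in> {0..} \<longrightarrow> (deriv1 f has_vector_derivative h y) (at y))"
    unfolding has_second_deriv_def by (rule AE_restrict_space_iff) simp
  also have "\<dots> \<longleftrightarrow> (\<exists>N\<in>null_sets lebesgue. {y. \<not> (y \<in> {0..} \<longrightarrow> (deriv1 f has_vector_derivative h y) (at y))} \<subseteq> N)"
    by (simp add: eventually_ae_filter)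
  finally show ?thesis unfolding negligible_iff_null_sets by blast
qed

lemma deriv1_eqI:
  assumes "0 \<le> y" "(f has_vector_derivative d) (at y within {0..})" shows "deriv1 f y = d"
  unfolding deriv1_def
proof (rule vector_derivative_within)
  have "y islimpt {y..y + 1}" by (simp add: islimpt_Icc)
  then have "y islimpt {0..}" by (rule islimpt_subset) (use assms(1) in auto)
  then show "at y within {0..} \<noteq> bot" by (simp add: trivial_limit_within)
qed (rule assms(2))

lemma at_within_half_line: "0 < y \<Longrightarrow> at y within {0..} = at (y::real)"
  by (rule at_within_interior) (simp add: interior_Ici[of "-1"])

lemma absolutely_continuous_on_cong:
  assumes "absolutely_continuous_on a b F" "\<And>y. y \<in> {a..b} \<Longrightarrow> G y = F y"
  shows "absolutely_continuous_on a b G"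
  by (rule absolutely_continuous_on_dominated[OF assms(1,1), of 1]) (auto simp: assms(2))

section \<open>The interaction points and the linear structure of the domain\<close>

locale half_line_partition =
  fixes x :: "nat \<Rightarrow> real"
  assumes x_0: "x 0 = 0" and strict_mono_x: "strict_mono x" and x_at_top: "filterlim x at_top sequentially"
begin

abbreviation X :: "real set" where "X \<equiv> interaction_points x"

lemma X_eq: "X = x ` {1..}"
  by (simp add: interaction_points_def)

lemma x_less_iff: "x m < x n \<longleftrightarrow> m < n"
  using strict_mono_x by (rule strict_mono_less)

lemma x_nonneg: "0 \<le> x n"
  using strict_mono_less_eq[OF strict_mono_x, of 0 n] x_0 by simp

lemma countable_X: "countable X"
  unfolding X_eq by simp

lemma negligible_X: "negligible X"
  unfolding negligible_iff_null_sets
  by (intro null_sets_completionI countable_imp_null_set_lborel countable_X)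

lemma finite_X_le: "finite (X \<inter> {..b})"
proof -
  obtain N where N: "\<And>n. n \<ge> N \<Longrightarrow> b < x n"
    using x_at_top unfolding filterlim_at_top_dense eventually_sequentially by blast
  then have "X \<inter> {..b} \<subseteq> x ` {..N}" unfolding X_eq
  proof safe
    fix n assume "x n \<le> b"
    then have "n \<le> N" using N[of n] by (cases "N \<le> n") auto
    then show "x n \<in> x ` {..N}" by simp
  qed
  then show ?thesis by (rule finite_subset) simp
qed

text \<open>Since \<open>x\<close> tends to infinity, bounded sets contain finitely many interaction
  points. Derivatives and one-sided limits can therefore be computed off \<open>X\<close>.\<close>

lemma not_islimpt_X: "\<not> p islimpt X"
proof
  assume "p islimpt X"
  then have "p islimpt X \<inter> ball p 1" by (rule islimpt_Int_eventually) (auto simp: eventually_at dist_commute intro!: exI[of _ 1])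
  moreover have "finite (X \<inter> ball p 1)"
    by (rule finite_subset[OF _ finite_X_le[of "p + 1"]]) (auto simp: dist_real_def)
  ultimately show False using islimpt_finite by blast
qed

lemma eventually_notin_X: "\<forall>\<^sub>F y in at p within S. y \<notin> X"
proof -
  have "\<forall>\<^sub>F y in at p. y \<notin> X" using not_islimpt_X[of p] by (simp add: islimpt_iff_eventually)
  then show ?thesis using at_le[of S UNIV p] by (auto simp: filter_leD)
qed

lemma open_regular_points: "open ({0<..} - X)"
  using not_islimpt_X by (intro open_Diff) (auto simp: closed_limpt)

lemma component_avoids_X: "{x n<..<x (Suc n)} \<inter> X = {}"
  unfolding X_eq using strict_mono_less[OF strict_mono_x] by (auto simp: less_Suc_eq not_less_eq)

lemma W22_vector_derivative:
  assumes "f \<in> W22 X" "y \<in> {0..} - X"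
  shows "(f has_vector_derivative deriv1 f y) (at y within {0..})"
  using assms unfolding W22_def deriv1_def vector_derivative_works by blast

lemma deriv1_lincomb:
  assumes "f \<in> W22 X" "u \<in> W22 X" "y \<in> {0..} - X"
  shows "deriv1 (\<lambda>y. f y + c * u y) y = deriv1 f y + c * deriv1 u y"
  using assms by (intro deriv1_eqI has_vector_derivative_add has_vector_derivative_mult_right W22_vector_derivative) auto

text \<open>Linearity of \<open>deriv1\<close> is available only on the half line off
  \<open>X\<close>, so one-sided limits need it in an eventual form. The left filter is restricted
  to p > 0 because \<open>deriv1\<close> is meaningless to the left of 0.\<close>

lemma eventually_deriv1_lincomb:
  assumes "f \<in> W22 X" "u \<in> W22 X" "0 \<le> p" "F = at_right p \<or> (0 < p \<and> F = at_left p)"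
  shows "\<forall>\<^sub>F y in F. deriv1 f y + c * deriv1 u y = deriv1 (\<lambda>y. f y + c * u y) y"
proof -
  have "\<forall>\<^sub>F y in F. y \<notin> X" using assms(4) eventually_notin_X by auto
  moreover have "\<forall>\<^sub>F y in F. 0 < y"
    using assms(3,4) eventually_at_right_less[of p] eventually_at_left_field[of "\<lambda>y. 0 < y" p]
    by (auto elim: eventually_mono)
  ultimately show ?thesis
  proof eventually_elim
    case (elim y)
    then show ?case by (subst deriv1_lincomb[OF assms(1,2)]) auto
  qed
qed

lemma W22_compD:
  assumes "f \<in> W22_comp X"
  shows "f \<in> W22 X" "\<exists>B. \<forall>y\<ge>0. y > B \<longrightarrow> f y = 0"
proof -
  show "f \<in> W22 X" using assms unfolding W22_comp_def by simp
  have "bounded (closure (support_on {0..} f))"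
    using assms unfolding W22_comp_def by (simp add: compact_imp_bounded)
  then have "bounded (support_on {0..} f)" by (rule bounded_subset) (rule closure_subset)
  then obtain B where B: "\<forall>y\<in>support_on {0..} f. norm y \<le> B" unfolding bounded_iff by blast
  have "f y = 0" if "y \<ge> 0" "y > B" for y
    using B[rule_format, of y] that unfolding support_on_def by auto
  then have "\<forall>y\<ge>0. y > B \<longrightarrow> f y = 0" by blast
  then show "\<exists>B. \<forall>y\<ge>0. y > B \<longrightarrow> f y = 0" by blast
qed

lemma W22_compI:
  assumes "f \<in> W22 X" "\<And>y. y \<ge> 0 \<Longrightarrow> y > B \<Longrightarrow> f y = 0" shows "f \<in> W22_comp X"
proof -
  have "support_on {0..} f \<subseteq> {0..B}" unfolding support_on_def using assms(2) not_le by force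
  then have "bounded (support_on {0..} f)" using bounded_subset bounded_closed_interval by blast
  then show ?thesis using assms(1) unfolding W22_comp_def by (simp add: compact_closure)
qed

lemma has_second_deriv_lincomb:
  assumes f: "f \<in> W22 X" "has_second_deriv f h" and u: "u \<in> W22 X" "has_second_deriv u k"
  shows "has_second_deriv (\<lambda>y. f y + c * u y) (\<lambda>y. h y + c * k y)"
proof -
  obtain N where N: "negligible N" "\<And>y. y \<in> {0..} - N \<Longrightarrow> (deriv1 f has_vector_derivative h y) (at y)"
    using f(2) unfolding has_second_deriv_iff_negligible by blast
  obtain M where M: "negligible M" "\<And>y. y \<in> {0..} - M \<Longrightarrow> (deriv1 u has_vector_derivative k y) (at y)"
    using u(2) unfolding has_second_deriv_iff_negligible by blast
  have "negligible (N \<union> M \<union> insert 0 X)"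
    using N(1) M(1) negligible_X by auto
  moreover have "(deriv1 (\<lambda>y. f y + c * u y) has_vector_derivative h y + c * k y) (at y)"
    if y: "y \<in> {0..} - (N \<union> M \<union> insert 0 X)" for y
  proof (rule has_vector_derivative_transform_within_open[OF _ open_regular_points])
    show "((\<lambda>y. deriv1 f y + c * deriv1 u y) has_vector_derivative h y + c * k y) (at y)"
      using N(2) M(2) y by (intro has_vector_derivative_add has_vector_derivative_mult_right) auto
    show "y \<in> {0<..} - X" using y by auto
    show "deriv1 f z + c * deriv1 u z = deriv1 (\<lambda>y. f y + c * u y) z" if "z \<in> {0<..} - X" for z
      using that by (subst deriv1_lincomb[OF f(1) u(1)]) auto
  qed
  ultimately show ?thesis unfolding has_second_deriv_iff_negligible by blast
qed

lemma W22_lincomb: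
  assumes f: "f \<in> W22 X" and u: "u \<in> W22 X" shows "(\<lambda>y. f y + c * u y) \<in> W22 X"
proof -
  obtain h k where h: "h \<in> L2" "has_second_deriv f h" and k: "k \<in> L2" "has_second_deriv u k"
    using f u unfolding W22_def by blast
  have "f \<in> L2" "u \<in> L2" using f u unfolding W22_def by auto
  then have fu_L2: "(\<lambda>y. f y + c * u y) \<in> L2" by (intro L2_add L2_mult_const)
  have AC: "absolutely_continuous_on a b f \<and> absolutely_continuous_on a b (deriv1 f) \<and>
      absolutely_continuous_on a b u \<and> absolutely_continuous_on a b (deriv1 u)"
    if "a \<le> b \<and> {a..b} \<subseteq> {0..} - X" for a b
    using f u that unfolding W22_def AC_loc_def by blast
  from AC have AC1: "AC_loc ({0..} - X) (\<lambda>y. f y + c * u y)"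
    unfolding AC_loc_def by (simp add: absolutely_continuous_on_add absolutely_continuous_on_cmult)
  have diffb: "(\<lambda>y. f y + c * u y) differentiable (at y within {0..})" if "y \<in> {0..} - X" for y
  proof -
    have "f differentiable (at y within {0..})" "u differentiable (at y within {0..})"
      using f u that unfolding W22_def by blast+
    then show ?thesis by (intro differentiable_add differentiable_mult differentiable_const)
  qed
  have AC2: "AC_loc ({0..} - X) (deriv1 (\<lambda>y. f y + c * u y))"
    unfolding AC_loc_def
  proof (intro allI impI)
    fix a b assume ab: "a \<le> b \<and> {a..b} \<subseteq> {0..} - X"
    show "absolutely_continuous_on a b (deriv1 (\<lambda>y. f y + c * u y))"
    proof (rule absolutely_continuous_on_cong)
      show "absolutely_continuous_on a b (\<lambda>y. deriv1 f y + c * deriv1 u y)"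
        using AC[OF ab] by (simp add: absolutely_continuous_on_add absolutely_continuous_on_cmult)
      show "deriv1 (\<lambda>y. f y + c * u y) y = deriv1 f y + c * deriv1 u y" if "y \<in> {a..b}" for y
        using ab that by (intro deriv1_lincomb[OF f u]) blast
    qed
  qed
  have "(\<lambda>y. h y + c * k y) \<in> L2" using h(1) k(1) by (intro L2_add L2_mult_const)
  with has_second_deriv_lincomb[OF f h(2) u k(2)]
  have "\<exists>h\<in>L2. has_second_deriv (\<lambda>y. f y + c * u y) h" by (rule bexI)
  with fu_L2 AC1 diffb AC2 show ?thesis unfolding W22_def mem_Collect_eq by (intro conjI ballI)
qed

lemma H_dom_lincomb:
  assumes f: "f \<in> H_dom x \<beta>" and u: "u \<in> H_dom x \<beta>"
  shows "(\<lambda>y. f y + c * u y) \<in> H_dom x \<beta>"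
proof -
  have fW: "f \<in> W22_comp X" and uW: "u \<in> W22_comp X" using f u unfolding H_dom_def by auto
  note fW' = W22_compD[OF fW] and uW' = W22_compD[OF uW]
  obtain A where A: "\<forall>y\<ge>0. y > A \<longrightarrow> f y = 0" using fW'(2) by blast
  obtain B where B: "\<forall>y\<ge>0. y > B \<longrightarrow> u y = 0" using uW'(2) by blast
  have "(\<lambda>y. f y + c * u y) \<in> W22_comp X"
    by (rule W22_compI[OF W22_lincomb[OF fW'(1) uW'(1)], of "max A B"]) (use A B in auto)
  moreover have "(deriv1 (\<lambda>y. f y + c * u y) \<longlongrightarrow> 0) (at_right 0)"
  proof (rule Lim_transform_eventually[OF _ eventually_deriv1_lincomb[OF fW'(1) uW'(1), of 0]])
    have "((\<lambda>y. deriv1 f y + c * deriv1 u y) \<longlongrightarrow> 0 + c * 0) (at_right 0)"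
      using f u unfolding H_dom_def by (intro tendsto_intros) auto
    then show "((\<lambda>y. deriv1 f y + c * deriv1 u y) \<longlongrightarrow> 0) (at_right 0)" by simp
  qed auto
  moreover have "delta_prime_condition (x n) (\<beta> n) (\<lambda>y. f y + c * u y)" if "n \<ge> 1" for n
  proof -
    have p: "0 < x n" using x_less_iff[of 0 n] x_0 that by simp
    have "delta_prime_condition (x n) (\<beta> n) f" "delta_prime_condition (x n) (\<beta> n) u"
      using f u that unfolding H_dom_def by auto
    then obtain l r s l' r' s' where
      f: "(f \<longlongrightarrow> l) (at_left (x n))" "(f \<longlongrightarrow> r) (at_right (x n))"
        "(deriv1 f \<longlongrightarrow> s) (at_left (x n))" "(deriv1 f \<longlongrightarrow> s) (at_right (x n))" "r - l = of_real (\<beta> n) * s"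
      and u: "(u \<longlongrightarrow> l') (at_left (x n))" "(u \<longlongrightarrow> r') (at_right (x n))"
        "(deriv1 u \<longlongrightarrow> s') (at_left (x n))" "(deriv1 u \<longlongrightarrow> s') (at_right (x n))" "r' - l' = of_real (\<beta> n) * s'"
      unfolding delta_prime_condition_def by blast
    show ?thesis
      unfolding delta_prime_condition_def
    proof (intro exI conjI)
      show "((\<lambda>y. f y + c * u y) \<longlongrightarrow> l + c * l') (at_left (x n))"
        "((\<lambda>y. f y + c * u y) \<longlongrightarrow> r + c * r') (at_right (x n))"
        by (intro tendsto_intros f u)+
      have "((\<lambda>y. deriv1 f y + c * deriv1 u y) \<longlongrightarrow> s + c * s') (at_left (x n))"
        by (intro tendsto_intros f u)
      then show "(deriv1 (\<lambda>y. f y + c * u y) \<longlongrightarrow> s + c * s') (at_left (x n))"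
        by (rule Lim_transform_eventually) (rule eventually_deriv1_lincomb[OF fW'(1) uW'(1), of "x n"], use p in auto)
      have "((\<lambda>y. deriv1 f y + c * deriv1 u y) \<longlongrightarrow> s + c * s') (at_right (x n))"
        by (intro tendsto_intros f u)
      then show "(deriv1 (\<lambda>y. f y + c * u y) \<longlongrightarrow> s + c * s') (at_right (x n))"
        by (rule Lim_transform_eventually) (rule eventually_deriv1_lincomb[OF fW'(1) uW'(1), of "x n"], use p in auto)
      have eq: "(r + c * r') - (l + c * l') = (r - l) + c * (r' - l')" by (simp add: algebra_simps)
      show "(r + c * r') - (l + c * l') = of_real (\<beta> n) * (s + c * s')"
        unfolding eq f(5) u(5) by (simp add: algebra_simps)
    qed
  qed
  ultimately show ?thesis unfolding H_dom_def by simp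
qed

lemma H_min_lincomb:
  assumes fg: "(f, g) \<in> H_min x \<beta>" and uv: "(u, v) \<in> H_min x \<beta>"
  shows "(\<lambda>y. f y + c * u y, \<lambda>y. g y + c * v y) \<in> H_min x \<beta>"
proof -
  have "f \<in> W22 X" "u \<in> W22 X"
    using assms W22_compD(1) unfolding H_min_def H_dom_def by auto
  then have "has_second_deriv (\<lambda>y. f y + c * u y) (\<lambda>y. - g y + c * - v y)"
    using assms unfolding H_min_def by (intro has_second_deriv_lincomb) auto
  moreover have "(\<lambda>y. - g y + c * - v y) = (\<lambda>y. - (g y + c * v y))" by auto
  moreover have "f \<in> H_dom x \<beta>" "u \<in> H_dom x \<beta>" "g \<in> L2" "v \<in> L2"
    using assms unfolding H_min_def by auto
  then have "(\<lambda>y. f y + c * u y) \<in> H_dom x \<beta>" "(\<lambda>y. g y + c * v y) \<in> L2"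
    by (simp_all add: H_dom_lincomb L2_add L2_mult_const)
  ultimately show ?thesis unfolding H_min_def by simp
qed

lemma zero_in_H_min: "(\<lambda>y. 0, \<lambda>y. 0) \<in> H_min x \<beta>"
proof -
  have d: "deriv1 (\<lambda>y. 0) y = 0" if "y \<ge> 0" for y
    using that by (rule deriv1_eqI) (rule has_vector_derivative_const)
  have AC0: "absolutely_continuous_on a b F" if "\<And>y. y \<in> {a..b} \<Longrightarrow> F y = 0" for a b F
    using that by (intro lipschitz_absolutely_continuous_on[of 0]) auto
  have "(deriv1 (\<lambda>y. 0) has_vector_derivative 0) (at y)" if "y > 0" for y
    by (rule has_vector_derivative_transform_within_open[of "\<lambda>y. 0" 0 _ "{0<..}"]) (use that d in auto)
  then have second: "has_second_deriv (\<lambda>y. 0) (\<lambda>y. 0)"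
    unfolding has_second_deriv_iff_negligible by (intro exI[of _ "{0}"]) auto
  \<comment> \<open>At negative points \<open>deriv1\<close> is a derivative along the trivial
    filter, hence an arbitrary value; the filter has to stay in the half line eventually.\<close>
  have lim: "(deriv1 (\<lambda>y. 0) \<longlongrightarrow> 0) F" if "\<forall>\<^sub>F y in F. y \<ge> 0" for F
    by (rule Lim_transform_eventually[OF tendsto_const]) (use that d in \<open>auto elim: eventually_mono\<close>)
  have ev_right: "\<forall>\<^sub>F y in at_right p. y \<ge> 0" if "p \<ge> 0" for p :: real
    using eventually_at_right_less[of p] that by (auto elim: eventually_mono)
  have ev_left: "\<forall>\<^sub>F y in at_left p. y \<ge> 0" if "p > 0" for p :: real
    using that by (auto simp: eventually_at_left_field intro!: exI[of _ 0])
  have "(\<lambda>y. 0) \<in> W22 X"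
    unfolding W22_def AC_loc_def using L2_zero second d by (auto intro!: AC0)
  then have "(\<lambda>y. 0) \<in> W22_comp X" by (rule W22_compI[of _ 0]) simp
  moreover have "delta_prime_condition (x n) (\<beta> n) (\<lambda>y. 0)" if "n \<ge> 1" for n
  proof -
    have "0 < x n" using x_less_iff[of 0 n] x_0 that by simp
    then show ?thesis unfolding delta_prime_condition_def
      by (intro exI[of _ 0]) (auto intro!: lim ev_left ev_right)
  qed
  ultimately show ?thesis
    unfolding H_min_def H_dom_def using L2_zero second lim[OF ev_right[OF order_refl]] by simp
qed

text \<open>The jump of the Wronskian is s cnj (r' - l') - (r - l) cnj s'. Both differences are the
  same real multiple \<open>b\<close> of the common derivative values, so the two terms
  cancel.\<close>

lemma wronskian_limits:
  assumes f: "delta_prime_condition p b f" and u: "delta_prime_condition p b u"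
  obtains w where "((\<lambda>y. deriv1 f y * cnj (u y) - f y * cnj (deriv1 u y)) \<longlongrightarrow> w) (at_left p)"
    "((\<lambda>y. deriv1 f y * cnj (u y) - f y * cnj (deriv1 u y)) \<longlongrightarrow> w) (at_right p)"
proof -
  obtain l r s l' r' s' where
    f: "(f \<longlongrightarrow> l) (at_left p)" "(f \<longlongrightarrow> r) (at_right p)"
      "(deriv1 f \<longlongrightarrow> s) (at_left p)" "(deriv1 f \<longlongrightarrow> s) (at_right p)" "r - l = of_real b * s"
    and u: "(u \<longlongrightarrow> l') (at_left p)" "(u \<longlongrightarrow> r') (at_right p)"
      "(deriv1 u \<longlongrightarrow> s') (at_left p)" "(deriv1 u \<longlongrightarrow> s') (at_right p)" "r' - l' = of_real b * s'"
    using assms unfolding delta_prime_condition_def by blast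
  have "(s * cnj r' - r * cnj s') - (s * cnj l' - l * cnj s') = s * cnj (r' - l') - (r - l) * cnj s'"
    by (simp add: algebra_simps)
  then have eq: "s * cnj r' - r * cnj s' = s * cnj l' - l * cnj s'" unfolding f(5) u(5) by simp
  show ?thesis
  proof (rule that)
    show "((\<lambda>y. deriv1 f y * cnj (u y) - f y * cnj (deriv1 u y)) \<longlongrightarrow> s * cnj l' - l * cnj s') (at_left p)"
      by (intro tendsto_intros f u)
    show "((\<lambda>y. deriv1 f y * cnj (u y) - f y * cnj (deriv1 u y)) \<longlongrightarrow> s * cnj l' - l * cnj s') (at_right p)"
      unfolding eq[symmetric] by (intro tendsto_intros f u)
  qed
qed

text \<open>Lagrange's identity on an interval free of interaction points: the products f' u' cancel
  in the derivative of the Wronskian, and f'' = -g, u'' = -v hold off a negligible set. Absolute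
  continuity is what makes the integrated form valid.\<close>

lemma wronskian_has_integral:
  assumes fg: "(f, g) \<in> H_min x \<beta>" and uv: "(u, v) \<in> H_min x \<beta>"
    and ab: "a \<le> b" "{a..b} \<subseteq> {0..} - X"
  shows "((\<lambda>y. f y * cnj (v y) - g y * cnj (u y)) has_integral
    ((deriv1 f b * cnj (u b) - f b * cnj (deriv1 u b)) - (deriv1 f a * cnj (u a) - f a * cnj (deriv1 u a)))) {a..b}"
proof -
  have f: "f \<in> W22 X" "has_second_deriv f (\<lambda>y. - g y)" and u: "u \<in> W22 X" "has_second_deriv u (\<lambda>y. - v y)"
    using fg uv W22_compD(1) unfolding H_min_def H_dom_def by auto
  obtain N where N: "negligible N" "\<And>y. y \<in> {0..} - N \<Longrightarrow> (deriv1 f has_vector_derivative - g y) (at y)"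
    using f(2) unfolding has_second_deriv_iff_negligible by blast
  obtain M where M: "negligible M" "\<And>y. y \<in> {0..} - M \<Longrightarrow> (deriv1 u has_vector_derivative - v y) (at y)"
    using u(2) unfolding has_second_deriv_iff_negligible by blast
  have AC: "absolutely_continuous_on a b f" "absolutely_continuous_on a b (deriv1 f)"
    "absolutely_continuous_on a b u" "absolutely_continuous_on a b (deriv1 u)"
    using f(1) u(1) ab unfolding W22_def AC_loc_def by auto
  show ?thesis
  proof (rule absolutely_continuous_FTC[OF ab(1), of _ "N \<union> M"])
    have "absolutely_continuous_on a b (\<lambda>y. deriv1 f y * cnj (u y) + (- 1) * (f y * cnj (deriv1 u y)))"
      by (intro absolutely_continuous_on_add absolutely_continuous_on_cmult absolutely_continuous_on_mult
          absolutely_continuous_on_cnj AC)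
    then show "absolutely_continuous_on a b (\<lambda>y. deriv1 f y * cnj (u y) - f y * cnj (deriv1 u y))" by simp
    show "negligible (N \<union> M)" using N(1) M(1) by simp
    fix y assume y: "y \<in> {a..b} - (N \<union> M)"
    then have y0: "y \<in> {0..} - X" using ab by auto
    have "(f has_vector_derivative deriv1 f y) (at y within {a..b})"
      "(u has_vector_derivative deriv1 u y) (at y within {a..b})"
      using W22_vector_derivative[OF f(1) y0] W22_vector_derivative[OF u(1) y0] ab
      by (auto elim: has_vector_derivative_within_subset)
    moreover have "(deriv1 f has_vector_derivative - g y) (at y within {a..b})"
      "(deriv1 u has_vector_derivative - v y) (at y within {a..b})"
      using N(2) M(2) y y0 by (auto intro: has_vector_derivative_at_within)
    ultimately have "((\<lambda>y. deriv1 f y * cnj (u y) - f y * cnj (deriv1 u y)) has_vector_derivative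
        (deriv1 f y * cnj (deriv1 u y) + - g y * cnj (u y)) - (f y * cnj (- v y) + deriv1 f y * cnj (deriv1 u y)))
        (at y within {a..b})"
      by (intro has_vector_derivative_diff has_vector_derivative_mult has_vector_derivative_cnj)
    then show "((\<lambda>y. deriv1 f y * cnj (u y) - f y * cnj (deriv1 u y)) has_vector_derivative
        f y * cnj (v y) - g y * cnj (u y)) (at y within {a..b})" by simp
  qed
qed

text \<open>
  The primitive of \<open>f v\<^sup>* - g u\<^sup>*\<close> minus the Wronskian is constant on every component, has equal one-sided
  limits at the interaction points and vanishes at the origin, hence vanishes identically.
\<close>

lemma H_min_symmetric:
  assumes fg: "(f, g) \<in> H_min x \<beta>" and uv: "(u, v) \<in> H_min x \<beta>"
  shows "(LINT y|leb_half_line. g y \<bullet> u y) = (LINT y|leb_half_line. f y \<bullet> v y)"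
proof -
  define W where "W y = deriv1 f y * cnj (u y) - f y * cnj (deriv1 u y)" for y
  define w where "w y = f y * cnj (v y) - g y * cnj (u y)" for y
  define I where "I b = integral {0..b} w" for b
  have fd: "f \<in> H_dom x \<beta>" and ud: "u \<in> H_dom x \<beta>" using fg uv unfolding H_min_def by auto
  have fc: "f \<in> W22_comp X" and uc: "u \<in> W22_comp X" using fd ud unfolding H_dom_def by auto
  have L2: "f \<in> L2" "g \<in> L2" "u \<in> L2" "v \<in> L2"
    using fg uv fc uc W22_compD(1) unfolding H_min_def W22_def by auto
  have int1: "integrable leb_half_line (\<lambda>y. f y * cnj (v y))" and int2: "integrable leb_half_line (\<lambda>y. g y * cnj (u y))"
    using L2 by (auto intro: L2_integrable_product)
  then have w_int: "integrable leb_half_line w" unfolding w_def by (rule Bochner_Integration.integrable_diff)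
  then have w_HK: "w integrable_on {0..}" by (rule integrable_on_lebesgue_on) simp
  have w_HK': "w integrable_on {0..b}" for b by (rule integrable_on_subinterval[OF w_HK]) auto
  have I_cont: "continuous_on {0..b} I" for b
    unfolding I_def by (rule indefinite_integral_continuous_1[OF w_HK'])
  have I_isCont: "isCont I y" if "0 < y" for y
  proof (rule continuous_on_interior[OF I_cont[of "y + 1"]])
    show "y \<in> interior {0..y + 1}" using that by (simp add: interior_atLeastAtMost_real)
  qed
  define \<Phi> where "\<Phi> y = I y - W y" for y
  have const: "\<Phi> b = \<Phi> a" if ab: "0 \<le> a" "a \<le> b" "{a..b} \<inter> X = {}" for a b
  proof -
    have "integral {a..b} w = W b - W a"
      unfolding w_def W_def using ab by (intro integral_unique wronskian_has_integral[OF fg uv]) auto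
    then have W: "W b = W a + integral {a..b} w" by simp
    have I: "integral {0..b} w = integral {0..a} w + integral {a..b} w"
      using ab by (intro Henstock_Kurzweil_Integration.integral_combine[symmetric] w_HK') auto
    show ?thesis unfolding \<Phi>_def I_def W I by simp
  qed
  \<comment> \<open>The domain prescribes only the right limit of the derivative at 0. As 0 is not
    an interaction point, the derivative is absolutely continuous up to 0, so its value there is
    that limit.\<close>
  have deriv_0: "deriv1 h 0 = 0" if h: "h \<in> H_dom x \<beta>" for h
  proof -
    define b where "b = x 1 / 2"
    have b: "0 < b" "b < x 1" unfolding b_def using x_less_iff[of 0 1] x_0 by auto
    have "{0..b} \<subseteq> {0..} - X"
    proof -
      have "x 1 \<le> y" if "y \<in> X" for y
        using that strict_mono_less_eq[OF strict_mono_x] unfolding X_eq by auto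
      then show ?thesis using b by force
    qed
    then have "absolutely_continuous_on 0 b (deriv1 h)"
      using h b W22_compD(1) unfolding H_dom_def W22_def AC_loc_def by auto
    then have "continuous_on {0..b} (deriv1 h)" by (rule absolutely_continuous_on_imp_continuous_on)
    then have "(deriv1 h \<longlongrightarrow> deriv1 h 0) (at 0 within {0..b})" using b unfolding continuous_on by auto
    moreover have "at 0 within {0..b} = at_right (0::real)" using b by (intro at_within_Icc_at_right) simp
    ultimately have "(deriv1 h \<longlongrightarrow> deriv1 h 0) (at_right 0)" by simp
    moreover have "(deriv1 h \<longlongrightarrow> 0) (at_right 0)" using h unfolding H_dom_def by simp
    ultimately show ?thesis by (rule tendsto_unique[OF trivial_limit_at_right_real])
  qed
  have \<Phi>_0: "\<Phi> 0 = 0" unfolding \<Phi>_def I_def W_def using deriv_0[OF fd] deriv_0[OF ud] by simp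
  have component: "\<Phi> y = 0" if "x n < y" "y < x (Suc n)" for n y
    using that
  proof (induction n arbitrary: y)
    case 0
    have "{0..y} \<inter> X = {}"
    proof -
      have "x 1 \<le> z" if "z \<in> X" for z
        using that strict_mono_less_eq[OF strict_mono_x] unfolding X_eq by auto
      then show ?thesis using 0 by force
    qed
    then show ?case using const[of 0 y] \<Phi>_0 0 x_0 by simp
  next
    case (Suc n)
    define p where "p = x (Suc n)"
    have p: "0 < p" unfolding p_def using x_less_iff[of 0 "Suc n"] x_0 by simp
    have xn: "x n < p" "p < x (Suc (Suc n))" unfolding p_def by (auto simp: x_less_iff)
    have "delta_prime_condition p (\<beta> (Suc n)) f" "delta_prime_condition p (\<beta> (Suc n)) u"
      using fd ud unfolding H_dom_def p_def by auto
    then obtain c where c: "(W \<longlongrightarrow> c) (at_left p)" "(W \<longlongrightarrow> c) (at_right p)"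
      unfolding W_def by (rule wronskian_limits)
    have I_lim: "(I \<longlongrightarrow> I p) (at p within S)" for S
      using I_isCont[OF p] unfolding isCont_def by (rule tendsto_within_subset) simp
    have "(\<Phi> \<longlongrightarrow> I p - c) (at_left p)" unfolding \<Phi>_def by (intro tendsto_diff I_lim c)
    moreover have "(\<Phi> \<longlongrightarrow> 0) (at_left p)"
    proof (rule Lim_transform_eventually[OF tendsto_const])
      show "\<forall>\<^sub>F z in at_left p. 0 = \<Phi> z"
        unfolding eventually_at_left_field using Suc.IH xn(1) by (intro exI[of _ "x n"]) (simp add: p_def)
    qed
    ultimately have "I p - c = 0" by (rule tendsto_unique[OF trivial_limit_at_left_real])
    moreover have "(\<Phi> \<longlongrightarrow> I p - c) (at_right p)" unfolding \<Phi>_def by (intro tendsto_diff I_lim c)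
    ultimately have "(\<Phi> \<longlongrightarrow> 0) (at_right p)" by simp
    moreover have "(\<Phi> \<longlongrightarrow> \<Phi> y) (at_right p)"
    proof (rule Lim_transform_eventually[OF tendsto_const])
      have "\<Phi> y = \<Phi> z" if z: "p < z" "z < y" for z
      proof (rule const)
        show "{z..y} \<inter> X = {}"
        proof -
          have "{z..y} \<subseteq> {x (Suc n)<..<x (Suc (Suc n))}" using Suc.prems(2) z unfolding p_def by auto
          then show ?thesis using component_avoids_X[of "Suc n"] by blast
        qed
      qed (use p z in auto)
      then show "\<forall>\<^sub>F z in at_right p. \<Phi> y = \<Phi> z"
        unfolding eventually_at_right_field using Suc.prems(1) by (intro exI[of _ y]) (simp add: p_def)
    qed
    ultimately show ?case by (metis tendsto_unique trivial_limit_at_right_real)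
  qed
  obtain A where A: "\<forall>y\<ge>0. y > A \<longrightarrow> f y = 0" using W22_compD(2)[OF fc] by blast
  obtain B where B: "\<forall>y\<ge>0. y > B \<longrightarrow> u y = 0" using W22_compD(2)[OF uc] by blast
  obtain N where N: "x N > max A B"
    using x_at_top unfolding filterlim_at_top_dense eventually_sequentially by blast
  \<comment> \<open>The point lies inside a component, where \<Phi> is known to vanish, and beyond
    both supports, where W vanishes because \<open>f b\<close> and \<open>u b\<close> do.\<close>
  define b where "b = (x N + x (Suc N)) / 2"
  have b: "x N < b" "b < x (Suc N)" unfolding b_def using x_less_iff[of N "Suc N"] by auto
  have b': "b \<ge> 0" "b > A" "b > B" using b N x_nonneg[of N] by auto
  have "W b = 0" unfolding W_def using A B b' by simp
  then have "I b = 0" using component[OF b] unfolding \<Phi>_def by simp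
  have "(LINT y|leb_half_line. w y) = integral {0..} w"
    by (rule lebesgue_integral_eq_integral[OF w_int]) simp
  also have "\<dots> = integral {0..b} w"
  proof (rule integral_spike_set)
    have "w y = 0" if "y > b" for y
      using A[rule_format, of y] B[rule_format, of y] b' that unfolding w_def by simp
    then have "\<forall>y. w y \<noteq> 0 \<longrightarrow> y \<le> b" by (meson not_le)
    then have eq: "{y \<in> {0..} - {0..b}. w y \<noteq> 0} = {}" by auto
    show "negligible {y \<in> {0..} - {0..b}. w y \<noteq> 0}" unfolding eq by (rule negligible_empty)
    have eq: "{y \<in> {0..b} - {0..}. w y \<noteq> 0} = {}" by auto
    show "negligible {y \<in> {0..b} - {0..}. w y \<noteq> 0}" unfolding eq by (rule negligible_empty)
  qed
  also have "\<dots> = 0" using \<open>I b = 0\<close> unfolding I_def .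
  finally have "(LINT y|leb_half_line. f y * cnj (v y)) = (LINT y|leb_half_line. g y * cnj (u y))"
    unfolding w_def using int1 int2 by (simp add: Bochner_Integration.integral_diff)
  then have "Re (LINT y|leb_half_line. f y * cnj (v y)) = Re (LINT y|leb_half_line. g y * cnj (u y))" by simp
  then show ?thesis
    using int1 int2 by (simp flip: integral_Re add: inner_complex_def)
qed

end

section \<open>Test functions\<close>

text \<open>The parabola (y - a) (b - y) extended by zero. Clamping the argument to the interval
  makes continuity immediate and yields the Lipschitz bound from a factorization of
  differences.\<close>

definition bump :: "real \<Rightarrow> real \<Rightarrow> real \<Rightarrow> real" where
  "bump a b y = (max a (min b y) - a) * (b - max a (min b y))"

lemma bump_nonneg: "a \<le> b \<Longrightarrow> 0 \<le> bump a b y"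
  unfolding bump_def by (intro mult_nonneg_nonneg) auto

lemma bump_eq_0: "a \<le> b \<Longrightarrow> y \<le> a \<or> b \<le> y \<Longrightarrow> bump a b y = 0"
  unfolding bump_def by auto

lemma bump_inside: "a \<le> y \<Longrightarrow> y \<le> b \<Longrightarrow> bump a b y = (y - a) * (b - y)"
  unfolding bump_def by (simp add: max_def min_def)

lemma continuous_on_bump: "continuous_on S (bump a b)"
  unfolding bump_def by (intro continuous_intros)

lemma bump_le:
  assumes "a \<le> b" shows "bump a b y \<le> (b - a)\<^sup>2"
  unfolding bump_def power2_eq_square using assms by (intro mult_mono) auto

lemma bump_lipschitz:
  assumes "a \<le> b" shows "\<bar>bump a b v - bump a b u\<bar> \<le> (b - a) * \<bar>v - u\<bar>"
proof -
  define s t where "s = max a (min b u)" and "t = max a (min b v)"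
  have "bump a b v - bump a b u = (a + b - s - t) * (t - s)"
    unfolding bump_def s_def[symmetric] t_def[symmetric] by (simp add: algebra_simps)
  moreover have "\<bar>a + b - s - t\<bar> \<le> b - a"
  proof -
    have "a \<le> s" "s \<le> b" "a \<le> t" "t \<le> b" unfolding s_def t_def using assms by auto
    then show ?thesis by linarith
  qed
  moreover have "\<bar>t - s\<bar> \<le> \<bar>v - u\<bar>" unfolding s_def t_def by (simp add: max_def min_def)
  ultimately show ?thesis using assms by (simp add: abs_mult mult_mono)
qed

lemma bump_has_derivative:
  assumes "a \<le> b" "y \<noteq> a" "y \<noteq> b"
  shows "(bump a b has_vector_derivative (if a < y \<and> y < b then a + b - 2 * y else 0)) (at y)"
proof -
  consider "y < a" | "a < y" "y < b" | "b < y" using assms by linarith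
  then show ?thesis
  proof cases
    case 1
    have "(bump a b has_vector_derivative 0) (at y)"
      by (rule has_vector_derivative_transform_within_open[of "\<lambda>y. 0" 0 y "{..<a}"])
         (use assms 1 in \<open>auto simp: bump_eq_0\<close>)
    then show ?thesis using 1 by simp
  next
    case 2
    have "((\<lambda>y. (y - a) * (b - y)) has_real_derivative (a + b - 2 * y)) (at y)"
      by (rule derivative_eq_intros refl)+ simp
    then have "((\<lambda>y. (y - a) * (b - y)) has_vector_derivative (a + b - 2 * y)) (at y)"
      unfolding has_real_derivative_iff_has_vector_derivative .
    then have "(bump a b has_vector_derivative (a + b - 2 * y)) (at y)"
      by (rule has_vector_derivative_transform_within_open[of _ _ _ "{a<..<b}"])
         (use 2 in \<open>auto simp: bump_inside\<close>)
    then show ?thesis using 2 by simp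
  next
    case 3
    have "(bump a b has_vector_derivative 0) (at y)"
      by (rule has_vector_derivative_transform_within_open[of "\<lambda>y. 0" 0 y "{b<..}"])
         (use assms 3 in \<open>auto simp: bump_eq_0\<close>)
    then show ?thesis using 3 by simp
  qed
qed

text \<open>The origin of the exponent 3: the area under the parabola is the drop of the test
  function over one interval, up to a common factor.\<close>

lemma integral_bump:
  assumes "0 \<le> a" "a \<le> b" "b \<le> Y" shows "integral {0..Y} (bump a b) = (b - a) ^ 3 / 6"
proof -
  define P where "P y = (y - a)\<^sup>2 * (b - a) / 2 - (y - a) ^ 3 / 3" for y
  have deriv: "(P has_real_derivative (y - a) * (b - y)) (at y within A)" for y A
  proof -
    have "((\<lambda>y. (y - a)\<^sup>2 * ((b - a) / 2) - (y - a) ^ 3 * (1 / 3)) has_real_derivative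
        (y - a) * (b - a) - (y - a)\<^sup>2) (at y within A)"
      by (rule derivative_eq_intros refl)+ simp
    moreover have "(y - a) * (b - a) - (y - a)\<^sup>2 = (y - a) * (b - y)"
      by (simp add: power2_eq_square algebra_simps)
    ultimately show ?thesis unfolding P_def by simp
  qed
  have "((\<lambda>y. (y - a) * (b - y)) has_integral (P b - P a)) {a..b}"
    by (rule fundamental_theorem_of_calculus[OF assms(2)])
       (rule deriv[unfolded has_real_derivative_iff_has_vector_derivative])
  moreover have "P b - P a = (b - a) ^ 3 / 6"
    unfolding P_def by (simp add: power2_eq_square power3_eq_cube)
  ultimately have "((\<lambda>y. (y - a) * (b - y)) has_integral (b - a) ^ 3 / 6) {a..b}" by simp
  then have "(bump a b has_integral (b - a) ^ 3 / 6) {a..b}"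
    by (rule has_integral_eq[rotated]) (auto simp: bump_inside)
  then have "(bump a b has_integral (b - a) ^ 3 / 6) {0..Y}"
    by (rule has_integral_on_superset) (use assms in \<open>auto intro!: bump_eq_0\<close>)
  then show ?thesis by (rule integral_unique)
qed

lemma has_bochner_integral_indicator_half_line:
  assumes "0 \<le> a" "a \<le> b"
  shows "has_bochner_integral leb_half_line (indicator {a..b} :: real \<Rightarrow> real) (b - a)"
proof -
  have sub: "{a..b} \<subseteq> {0..}" using assms by auto
  then have sets: "{a..b} \<in> sets leb_half_line" by (simp add: sets_restrict_space_iff)
  have em: "emeasure leb_half_line {a..b} = ennreal (b - a)"
    using assms sub by (subst emeasure_restrict_space) auto
  have "has_bochner_integral leb_half_line (indicator {a..b} :: real \<Rightarrow> real) (measure leb_half_line {a..b})"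
    by (rule has_bochner_integral_real_indicator[OF sets]) (simp add: em)
  moreover have "measure leb_half_line {a..b} = b - a" unfolding measure_def em using assms by simp
  ultimately show ?thesis by simp
qed

lemma integrable_indicator_half_line:
  "0 \<le> a \<Longrightarrow> a \<le> b \<Longrightarrow> integrable leb_half_line (indicator {a..b} :: real \<Rightarrow> real)"
  by (rule integrable.intros[OF has_bochner_integral_indicator_half_line])

lemma integral_indicator_half_line:
  "0 \<le> a \<Longrightarrow> a \<le> b \<Longrightarrow> (LINT y|leb_half_line. indicator {a..b} y) = b - a"
  by (rule has_bochner_integral_integral_eq[OF has_bochner_integral_indicator_half_line])

context half_line_partition
begin

text \<open>
  The test function equals 1 up to \<open>x i\<close> and drops to 0 between \<open>x i\<close> and \<open>x (i + p)\<close>.  Its derivative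
  vanishes at all \<open>x k\<close>, so it is in the domain whatever the coupling constants are.
\<close>

lemma test_function_exists:
  fixes i p :: nat and \<beta> :: "nat \<Rightarrow> real"
  defines "S \<equiv> \<Sum>j<p. (x (Suc (i + j)) - x (i + j)) ^ 3"
  assumes "p > 0"
  obtains f g where "(f, g) \<in> H_min x \<beta>" "\<forall>y\<ge>0. cmod (f y) \<le> 1"
    "(L2_norm f)\<^sup>2 \<ge> x i" "(L2_norm g)\<^sup>2 \<le> 36 / S"
proof -
  define d where "d j = x (Suc (i + j)) - x (i + j)" for j
  have d_pos: "d j > 0" for j unfolding d_def using x_less_iff[of "i + j" "Suc (i + j)"] by simp
  have d_nonneg: "0 \<le> d j" and le: "x (i + j) \<le> x (Suc (i + j))" for j
    using d_pos[of j] unfolding d_def by auto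
  have S: "S = (\<Sum>j<p. d j ^ 3)" unfolding S_def d_def ..
  have "S > 0" unfolding S using d_pos \<open>p > 0\<close> by (intro sum_pos) auto
  have abs_6S: "\<bar>6 / S\<bar> = 6 / S" using \<open>S > 0\<close> by simp
  define q where "q y = (\<Sum>j<p. bump (x (i + j)) (x (Suc (i + j))) y)" for y
  define q' where "q' y = (\<Sum>j<p. if x (i + j) < y \<and> y < x (Suc (i + j)) then x (i + j) + x (Suc (i + j)) - 2 * y else 0)" for y
  \<comment> \<open>As the bumps have areas d^3 / 6, the factor 6 / S makes the total drop equal to
    1.\<close>
  define F where "F y = 1 - 6 / S * integral {0..y} q" for y
  define f where "f y = complex_of_real (F y)" for y
  define g where "g y = complex_of_real (6 / S * q' y)" for y
  have q_nonneg: "0 \<le> q y" for y unfolding q_def using le by (intro sum_nonneg bump_nonneg)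
  have q_cont: "continuous_on A q" for A unfolding q_def by (intro continuous_on_sum continuous_on_bump)
  have q_int: "q integrable_on {a..b}" for a b by (intro integrable_continuous_interval q_cont)
  have q_x: "q (x k) = 0" for k
    unfolding q_def
  proof (intro sum.neutral ballI bump_eq_0 le)
    fix j show "x k \<le> x (i + j) \<or> x (Suc (i + j)) \<le> x k"
      using strict_mono_less_eq[OF strict_mono_x] by (metis not_less_eq_eq nat_le_linear)
  qed
  have q_0: "q y = 0" if "y \<le> x i" for y
    unfolding q_def
  proof (intro sum.neutral ballI bump_eq_0 le)
    fix j have "x i \<le> x (i + j)" using strict_mono_less_eq[OF strict_mono_x] by simp
    then show "y \<le> x (i + j) \<or> x (Suc (i + j)) \<le> y" using that by simp
  qed
  have int_mono: "integral {0..y} q \<le> integral {0..z} q" if "y \<le> z" for y z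
    by (rule integral_subset_le) (use that q_int q_nonneg in auto)
  have int_total: "integral {0..y} q = S / 6" if y: "x (i + p) \<le> y" for y
  proof -
    have "integral {0..y} q = (\<Sum>j<p. integral {0..y} (bump (x (i + j)) (x (Suc (i + j)))))"
      unfolding q_def by (intro integral_sum integrable_continuous_interval continuous_on_bump) simp
    also have "\<dots> = (\<Sum>j<p. d j ^ 3 / 6)"
      unfolding d_def
    proof (intro sum.cong refl integral_bump le x_nonneg)
      fix j assume "j \<in> {..<p}"
      then have "x (Suc (i + j)) \<le> x (i + p)" using strict_mono_less_eq[OF strict_mono_x] by simp
      then show "x (Suc (i + j)) \<le> y" using y by simp
    qed
    finally show ?thesis unfolding S by (simp add: sum_divide_distrib)
  qed
  have F_le: "F y \<le> 1" for y
    unfolding F_def using \<open>S > 0\<close> integral_nonneg[OF q_int q_nonneg, of 0 y] by simp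
  have F_ge: "0 \<le> F y" for y
  proof -
    have "integral {0..y} q \<le> integral {0..max y (x (i + p))} q" by (rule int_mono) simp
    also have "\<dots> = S / 6" by (rule int_total) simp
    finally show ?thesis unfolding F_def using \<open>S > 0\<close> by (simp add: field_simps)
  qed
  have F_0: "F y = 0" if "x (i + p) \<le> y" for y
    unfolding F_def int_total[OF that] using \<open>S > 0\<close> by simp
  have F_1: "F y = 1" if "y \<le> x i" for y
  proof -
    have "integral {0..y} q = integral {0..y} (\<lambda>y. 0)" by (rule integral_cong) (use that q_0 in auto)
    then show ?thesis unfolding F_def by simp
  qed
  have F_deriv: "(F has_vector_derivative - (6 / S * q y)) (at y within {0..})" if "0 \<le> y" for y
  proof -
    have "((\<lambda>u. integral {0..u} q) has_vector_derivative q y) (at y within {0..y + 1})"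
      by (rule integral_has_vector_derivative[OF q_cont]) (use that in auto)
    then have "((\<lambda>u. 1 - 6 / S * integral {0..u} q) has_vector_derivative 0 - 6 / S * q y) (at y within {0..y + 1})"
      by (intro has_vector_derivative_diff has_vector_derivative_mult_right) auto
    moreover have "at y within {0..y + 1} = at y within {0..}"
      by (rule at_within_nhd[of _ "{..<y + 1}"]) auto
    ultimately show ?thesis unfolding F_def[abs_def] by simp
  qed
  have f_deriv: "(f has_vector_derivative of_real (- (6 / S * q y))) (at y within {0..})" if "0 \<le> y" for y
    unfolding f_def[abs_def]
    by (intro has_vector_derivative_of_real F_deriv[OF that, folded has_real_derivative_iff_has_vector_derivative])
  have deriv1_f: "deriv1 f y = of_real (- (6 / S * q y))" if "0 \<le> y" for y
    by (rule deriv1_eqI[OF that f_deriv[OF that]])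
  define M where "M = (\<Sum>j<p. (d j)\<^sup>2)"
  have q_le: "q y \<le> M" for y
    unfolding q_def M_def d_def using le by (intro sum_mono bump_le)
  have q_lip: "\<bar>q v - q u\<bar> \<le> (\<Sum>j<p. d j) * \<bar>v - u\<bar>" for u v
  proof -
    have "\<bar>q v - q u\<bar> \<le> (\<Sum>j<p. \<bar>bump (x (i + j)) (x (Suc (i + j))) v - bump (x (i + j)) (x (Suc (i + j))) u\<bar>)"
      unfolding q_def sum_subtractf[symmetric] by (rule sum_abs)
    also have "\<dots> \<le> (\<Sum>j<p. d j * \<bar>v - u\<bar>)"
      unfolding d_def using le by (intro sum_mono bump_lipschitz)
    finally show ?thesis by (simp add: sum_distrib_right)
  qed
  have AC_f: "absolutely_continuous_on a b f" if "0 \<le> a" for a b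
  proof (rule lipschitz_absolutely_continuous_on[of "6 / S * M"])
    have "0 \<le> M" unfolding M_def by (intro sum_nonneg) auto
    then show "0 \<le> 6 / S * M" using \<open>S > 0\<close> by simp
    fix u v assume uv: "a \<le> u" "u \<le> v" "v \<le> b"
    have "integral {0..u} q + integral {u..v} q = integral {0..v} q"
      using uv that by (intro Henstock_Kurzweil_Integration.integral_combine q_int) auto
    moreover have "integral {u..v} q \<le> integral {u..v} (\<lambda>y. M)"
      using q_le q_int by (intro integral_le) auto
    moreover have "0 \<le> integral {u..v} q" using q_int q_nonneg by (intro integral_nonneg) auto
    ultimately have "\<bar>integral {0..v} q - integral {0..u} q\<bar> \<le> M * (v - u)" using uv by (simp add: mult.commute)
    then have "6 / S * \<bar>integral {0..v} q - integral {0..u} q\<bar> \<le> 6 / S * (M * (v - u))"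
      using \<open>S > 0\<close> by (intro mult_left_mono) auto
    moreover have "F v - F u = - (6 / S * (integral {0..v} q - integral {0..u} q))"
      unfolding F_def by (simp add: right_diff_distrib)
    then have "\<bar>F v - F u\<bar> = 6 / S * \<bar>integral {0..v} q - integral {0..u} q\<bar>"
      by (simp only: abs_minus_cancel abs_mult abs_6S)
    ultimately show "cmod (f v - f u) \<le> 6 / S * M * (v - u)"
      unfolding f_def by (simp flip: of_real_diff)
  qed
  have AC_q: "absolutely_continuous_on a b (\<lambda>y. of_real (- (6 / S * q y)))" for a b
  proof (rule lipschitz_absolutely_continuous_on[of "6 / S * (\<Sum>j<p. d j)"])
    show "0 \<le> 6 / S * (\<Sum>j<p. d j)" using \<open>S > 0\<close> d_nonneg by (simp add: sum_nonneg)
    fix u v :: real assume "u \<le> v"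
    have "- (6 / S * q v) - - (6 / S * q u) = 6 / S * (q u - q v)" by (simp add: right_diff_distrib)
    then have "cmod (of_real (- (6 / S * q v)) - of_real (- (6 / S * q u))) = \<bar>6 / S * (q u - q v)\<bar>"
      unfolding of_real_diff[symmetric] norm_of_real by (rule arg_cong)
    also have "\<dots> = 6 / S * \<bar>q v - q u\<bar>" by (simp only: abs_mult abs_6S abs_minus_commute)
    also have "\<dots> \<le> 6 / S * ((\<Sum>j<p. d j) * \<bar>v - u\<bar>)"
      using \<open>S > 0\<close> q_lip by (intro mult_left_mono) auto
    finally show "cmod (of_real (- (6 / S * q v)) - of_real (- (6 / S * q u))) \<le> 6 / S * (\<Sum>j<p. d j) * (v - u)"
      using \<open>u \<le> v\<close> by simp
  qed
  have q_deriv: "(q has_vector_derivative q' y) (at y)" if "y \<notin> range x" for y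
    unfolding q_def[abs_def] q'_def using that le
    by (intro has_vector_derivative_sum bump_has_derivative) auto
  have second: "has_second_deriv f (\<lambda>y. - g y)"
    unfolding has_second_deriv_iff_negligible
  proof (intro exI conjI ballI)
    show "negligible (insert 0 (range x))"
      unfolding negligible_iff_null_sets
      by (intro null_sets_completionI countable_imp_null_set_lborel) auto
    fix y assume y: "y \<in> {0..} - insert 0 (range x)"
    have "((\<lambda>y. - (6 / S * q y)) has_vector_derivative - (6 / S * q' y)) (at y)"
      using y by (intro has_vector_derivative_minus has_vector_derivative_mult_right q_deriv) auto
    then have "((\<lambda>y. complex_of_real (- (6 / S * q y))) has_vector_derivative of_real (- (6 / S * q' y))) (at y)"
      unfolding has_real_derivative_iff_has_vector_derivative[symmetric] by (rule has_vector_derivative_of_real)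
    then have "(deriv1 f has_vector_derivative of_real (- (6 / S * q' y))) (at y)"
      by (rule has_vector_derivative_transform_within_open[of _ _ _ "{0<..}"]) (use y deriv1_f in auto)
    then show "(deriv1 f has_vector_derivative - g y) (at y)" unfolding g_def by simp
  qed
  have f_meas: "f \<in> borel_measurable leb_half_line"
  proof (rule continuous_imp_measurable_on_sets_lebesgue)
    show "continuous_on {0..} f"
      unfolding continuous_on_eq_continuous_within
      using f_deriv has_vector_derivative_continuous by blast
  qed simp
  have f_L2: "f \<in> L2"
  proof (rule L2I_dominated[OF f_meas integrable_indicator_half_line[of 0 "x (i + p)"]])
    have "(cmod (f y))\<^sup>2 \<le> indicator {0..x (i + p)} y" if "0 \<le> y" for y
    proof (cases "y \<le> x (i + p)")
      case True
      have "(F y)\<^sup>2 \<le> 1" using F_le[of y] F_ge[of y] by (simp add: power_le_one)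
      then show ?thesis using True that unfolding f_def by simp
    next
      case False
      then show ?thesis using F_0[of y] unfolding f_def by simp
    qed
    then show "AE y in leb_half_line. (cmod (f y))\<^sup>2 \<le> indicator {0..x (i + p)} y"
      by (intro AE_I2) simp
  qed (use x_nonneg in auto)
  have f_norm: "x i \<le> (L2_norm f)\<^sup>2"
  proof -
    have "(LINT y|leb_half_line. indicator {0..x i} y) \<le> (LINT y|leb_half_line. (cmod (f y))\<^sup>2)"
    proof (rule integral_mono)
      show "integrable leb_half_line (indicator {0..x i} :: real \<Rightarrow> real)"
        by (rule integrable_indicator_half_line) (use x_nonneg in auto)
      show "integrable leb_half_line (\<lambda>y. (cmod (f y))\<^sup>2)" by (rule L2_square_integrable[OF f_L2])
      show "indicator {0..x i} y \<le> (cmod (f y))\<^sup>2" for y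
        by (cases "0 \<le> y \<and> y \<le> x i") (auto simp: f_def F_1)
    qed
    then show ?thesis
      unfolding L2_norm_square integral_indicator_half_line[OF order_refl x_nonneg] by (simp only: diff_zero)
  qed
  \<comment> \<open>Inside an interval the derivative of its bump has modulus at most the length d,
    so \<open>G\<close> majorizes the square of \<open>g\<close> by a step function with integral 36
    / S. Counting shared endpoints twice is harmless for an upper bound.\<close>
  define G where "G y = (\<Sum>j<p. 36 / S\<^sup>2 * (d j)\<^sup>2 * indicator {x (i + j)..x (Suc (i + j))} y)" for y :: real
  have G_has_integral: "has_bochner_integral leb_half_line G (\<Sum>j<p. 36 / S\<^sup>2 * (d j)\<^sup>2 * d j)"
    unfolding G_def
  proof (intro has_bochner_integral_sum has_bochner_integral_mult_right)
    show "has_bochner_integral leb_half_line (indicator {x (i + j)..x (Suc (i + j))}) (d j)" for j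
      unfolding d_def by (rule has_bochner_integral_indicator_half_line[OF x_nonneg le])
  qed
  then have G_int: "integrable leb_half_line G" by (rule integrable.intros)
  have "(LINT y|leb_half_line. G y) = (\<Sum>j<p. 36 / S\<^sup>2 * (d j)\<^sup>2 * d j)"
    by (rule has_bochner_integral_integral_eq[OF G_has_integral])
  also have "\<dots> = 36 / S\<^sup>2 * S" unfolding S by (simp add: sum_distrib_left power2_eq_square power3_eq_cube mult.assoc)
  also have "\<dots> = 36 / S" using \<open>S > 0\<close> by (simp add: power2_eq_square)
  finally have G_integral: "(LINT y|leb_half_line. G y) = 36 / S" .
  have g_le: "(cmod (g y))\<^sup>2 \<le> G y" for y
  proof (cases "\<exists>j<p. x (i + j) < y \<and> y < x (Suc (i + j))")
    case True
    then obtain k where k: "k < p" "x (i + k) < y" "y < x (Suc (i + k))" by blast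
    have "q' y = (\<Sum>j<p. if j = k then x (i + k) + x (Suc (i + k)) - 2 * y else 0)"
      unfolding q'_def
    proof (intro sum.cong refl if_cong)
      fix j
      have "j = k" if "x (i + j) < y" "y < x (Suc (i + j))"
      proof -
        have "x (i + j) < x (Suc (i + k))" "x (i + k) < x (Suc (i + j))" using k that by linarith+
        then show ?thesis by (simp add: x_less_iff)
      qed
      then show "(x (i + j) < y \<and> y < x (Suc (i + j))) = (j = k)" using k by blast
      show "x (i + j) + x (Suc (i + j)) - 2 * y = x (i + k) + x (Suc (i + k)) - 2 * y" if "j = k"
        using that by simp
    qed
    also have "\<dots> = x (i + k) + x (Suc (i + k)) - 2 * y" using k(1) by simp
    finally have "\<bar>q' y\<bar> \<le> d k" using k unfolding d_def by linarith
    then have "\<bar>q' y\<bar>\<^sup>2 \<le> (d k)\<^sup>2" by (intro power_mono) auto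
    then have "36 / S\<^sup>2 * (q' y)\<^sup>2 \<le> 36 / S\<^sup>2 * (d k)\<^sup>2" by (intro mult_left_mono) auto
    also have "\<dots> = 36 / S\<^sup>2 * (d k)\<^sup>2 * indicator {x (i + k)..x (Suc (i + k))} y" using k by simp
    also have "\<dots> \<le> G y"
      unfolding G_def using k(1) by (intro member_le_sum) auto
    finally show ?thesis unfolding g_def norm_of_real by (simp add: power_mult_distrib power_divide)
  next
    case False
    then have "q' y = 0" unfolding q'_def by (intro sum.neutral) auto
    moreover have "0 \<le> G y" unfolding G_def by (intro sum_nonneg) auto
    ultimately show ?thesis unfolding g_def by simp
  qed
  have g_meas: "g \<in> borel_measurable leb_half_line"
  proof -
    have "g \<in> borel_measurable lborel" unfolding g_def[abs_def] q'_def by measurable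
    then show ?thesis by (intro measurable_restrict_space1 measurable_completion)
  qed
  have g_L2: "g \<in> L2" by (rule L2I_dominated[OF g_meas G_int]) (use g_le in auto)
  have g_norm: "(L2_norm g)\<^sup>2 \<le> 36 / S"
    unfolding L2_norm_square G_integral[symmetric]
    by (intro integral_mono L2_square_integrable[OF g_L2] G_int g_le)
  have f_W22: "f \<in> W22 X"
    unfolding W22_def mem_Collect_eq
  proof (intro conjI ballI)
    show "f \<in> L2" by (rule f_L2)
    show "AC_loc ({0..} - X) f"
      unfolding AC_loc_def
    proof (intro allI impI)
      fix a b assume ab: "a \<le> b \<and> {a..b} \<subseteq> {0..} - X"
      then have "a \<in> {a..b}" by simp
      then have "0 \<le> a" using ab by blast
      then show "absolutely_continuous_on a b f" by (rule AC_f)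
    qed
    show "f differentiable (at y within {0..})" if "y \<in> {0..} - X" for y
      using that by (intro differentiableI_vector[OF f_deriv]) simp
    show "AC_loc ({0..} - X) (deriv1 f)"
      unfolding AC_loc_def
    proof (intro allI impI)
      fix a b assume ab: "a \<le> b \<and> {a..b} \<subseteq> {0..} - X"
      show "absolutely_continuous_on a b (deriv1 f)"
      proof (rule absolutely_continuous_on_cong[OF AC_q])
        fix y assume "y \<in> {a..b}"
        then have "0 \<le> y" using ab by blast
        then show "deriv1 f y = of_real (- (6 / S * q y))" by (rule deriv1_f)
      qed
    qed
    show "\<exists>h\<in>L2. has_second_deriv f h" using second L2_uminus[OF g_L2] by (rule bexI)
  qed
  have f_comp: "f \<in> W22_comp X"
    by (rule W22_compI[OF f_W22, of "x (i + p)"]) (simp add: f_def F_0)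
  \<comment> \<open>The formula for \<open>deriv1 f\<close> holds on the half line only, so the
    filter must stay there. In this form one statement covers the right limit at
    \<open>x 0 = 0\<close> and both limits at the interaction points.\<close>
  have deriv_lim: "(deriv1 f \<longlongrightarrow> 0) (at (x k) within A)" if "\<forall>\<^sub>F y in at (x k) within A. 0 \<le> y" for k A
  proof (rule Lim_transform_eventually)
    have "isCont q (x k)" using q_cont[of UNIV] by (simp add: continuous_on_eq_continuous_at)
    then have "(q \<longlongrightarrow> q (x k)) (at (x k) within A)" unfolding isCont_def by (rule tendsto_within_subset) simp
    then have "((\<lambda>y. complex_of_real (- (6 / S * q y))) \<longlongrightarrow> of_real (- (6 / S * q (x k)))) (at (x k) within A)"
      by (intro tendsto_intros)
    then show "((\<lambda>y. complex_of_real (- (6 / S * q y))) \<longlongrightarrow> 0) (at (x k) within A)" by (simp add: q_x)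
    show "\<forall>\<^sub>F y in at (x k) within A. of_real (- (6 / S * q y)) = deriv1 f y"
      using that by eventually_elim (simp only: deriv1_f)
  qed
  have right: "\<forall>\<^sub>F y in at_right (x k). 0 \<le> y" for k
    using eventually_at_right_less[of "x k"] x_nonneg[of k] by (auto elim: eventually_mono)
  have delta: "delta_prime_condition (x k) (\<beta> k) f" if "k \<ge> 1" for k
  proof -
    have xk: "0 < x k" using x_less_iff[of 0 k] x_0 that by simp
    have left: "\<forall>\<^sub>F y in at_left (x k). 0 \<le> y"
      using xk by (auto simp: eventually_at_left_field intro!: exI[of _ 0])
    have "(f has_vector_derivative of_real (- (6 / S * q (x k)))) (at (x k))"
      using f_deriv[of "x k"] xk by (simp add: at_within_half_line)
    then have "isCont f (x k)" by (rule has_vector_derivative_continuous)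
    then have f_lim: "(f \<longlongrightarrow> f (x k)) (at (x k) within A)" for A
      unfolding isCont_def by (rule tendsto_within_subset) simp
    show ?thesis
      unfolding delta_prime_condition_def
    proof (intro exI conjI)
      show "(f \<longlongrightarrow> f (x k)) (at_left (x k))" "(f \<longlongrightarrow> f (x k)) (at_right (x k))" by (rule f_lim)+
      show "(deriv1 f \<longlongrightarrow> 0) (at_left (x k))" "(deriv1 f \<longlongrightarrow> 0) (at_right (x k))"
        by (rule deriv_lim[OF left], rule deriv_lim[OF right])
    qed simp
  qed
  have "f \<in> H_dom x \<beta>"
    unfolding H_dom_def using f_comp delta deriv_lim[OF right[of 0]] x_0 by simp
  then have fg: "(f, g) \<in> H_min x \<beta>" unfolding H_min_def using g_L2 second by simp
  have f_le: "\<forall>y\<ge>0. cmod (f y) \<le> 1"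
    unfolding f_def using F_le F_ge by simp
  show ?thesis by (rule that[OF fg f_le f_norm g_norm])
qed

end

section \<open>Non-discreteness\<close>

lemma abs_l2_sum:
  assumes "finite B" "\<And>b. b \<in> B \<Longrightarrow> \<phi> b \<in> L2"
  shows "(\<lambda>y. \<Sum>b\<in>B. \<phi> b y) \<in> L2 \<and> abs_l2 (\<lambda>y. \<Sum>b\<in>B. \<phi> b y) = (\<Sum>b\<in>B. abs_l2 (\<phi> b))"
  using assms
proof (induction B rule: finite_induct)
  case empty
  then show ?case by (simp add: L2_zero zero_l2.abs_eq)
next
  case (insert b B)
  then have IH: "(\<lambda>y. \<Sum>b\<in>B. \<phi> b y) \<in> L2" "abs_l2 (\<lambda>y. \<Sum>b\<in>B. \<phi> b y) = (\<Sum>b\<in>B. abs_l2 (\<phi> b))"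
    and b: "\<phi> b \<in> L2" by auto
  show ?case using insert.hyps L2_add[OF b IH(1)] abs_l2_add[OF b IH(1)] IH(2) by simp
qed

lemma abs_l2_mult_real: "f \<in> L2 \<Longrightarrow> abs_l2 (\<lambda>y. of_real r * f y) = r *\<^sub>R abs_l2 f"
  by (simp add: abs_l2_scaleR scaleR_conv_of_real)

text \<open>Splitting coefficients into real and imaginary parts, a complex span of n functions
  becomes a real span of at most 2 n classes. Finite complex multiplicity thus becomes finite real
  dimension of the kernel.\<close>

lemma abs_l2_complex_span:
  assumes "finite B" "B \<subseteq> L2" "f \<in> L2" and f: "AE y in leb_half_line. f y = (\<Sum>b\<in>B. c b * b y)"
  shows "abs_l2 f \<in> span (abs_l2 ` B \<union> (\<lambda>b. abs_l2 (\<lambda>y. \<i> * b y)) ` B)"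
proof -
  have L2: "(\<lambda>y. c b * b y) \<in> L2" if "b \<in> B" for b
    using that assms(2) by (intro L2_mult_const) auto
  have sum: "(\<lambda>y. \<Sum>b\<in>B. c b * b y) \<in> L2"
    "abs_l2 (\<lambda>y. \<Sum>b\<in>B. c b * b y) = (\<Sum>b\<in>B. abs_l2 (\<lambda>y. c b * b y))"
    using abs_l2_sum[OF assms(1), of "\<lambda>b y. c b * b y"] L2 by auto
  have "abs_l2 (\<lambda>y. c b * b y) = Re (c b) *\<^sub>R abs_l2 b + Im (c b) *\<^sub>R abs_l2 (\<lambda>y. \<i> * b y)" if b: "b \<in> B" for b
  proof -
    have bL: "b \<in> L2" "(\<lambda>y. \<i> * b y) \<in> L2" using b assms(2) L2_mult_const by auto
    have "Re (c b) *\<^sub>R abs_l2 b + Im (c b) *\<^sub>R abs_l2 (\<lambda>y. \<i> * b y)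
        = abs_l2 (\<lambda>y. of_real (Re (c b)) * b y + of_real (Im (c b)) * (\<i> * b y))"
      using bL by (subst abs_l2_add[symmetric]) (auto simp: abs_l2_mult_real intro: L2_mult_const)
    also have "(\<lambda>y. of_real (Re (c b)) * b y + of_real (Im (c b)) * (\<i> * b y)) = (\<lambda>y. c b * b y)"
      by (subst (5) complex_eq) (simp add: algebra_simps)
    finally show ?thesis by simp
  qed
  then have "abs_l2 f = (\<Sum>b\<in>B. Re (c b) *\<^sub>R abs_l2 b + Im (c b) *\<^sub>R abs_l2 (\<lambda>y. \<i> * b y))"
    using sum f assms(3) abs_l2_eq_iff[OF assms(3) sum(1)] by simp
  then show ?thesis
    by (auto intro!: span_sum span_add span_scale intro: span_base)
qed

lemma tendsto_abs_l2_iff: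
  assumes "\<And>k. F k \<in> L2" "f \<in> L2"
  shows "(\<lambda>k::nat. abs_l2 (F k)) \<longlonglongrightarrow> abs_l2 f \<longleftrightarrow> (\<lambda>k. L2_norm (\<lambda>y. F k y - f y)) \<longlonglongrightarrow> 0"
proof -
  have "dist (abs_l2 (F k)) (abs_l2 f) = L2_norm (\<lambda>y. F k y - f y)" for k
    using assms by (simp add: dist_norm abs_l2_diff norm_abs_l2 L2_diff)
  then show ?thesis by (subst tendsto_dist_iff) simp
qed

lemma subspace_closure_normed:
  fixes S :: "'a::real_normed_vector set"
  assumes S: "subspace S" shows "subspace (closure S)"
  unfolding subspace_def
proof (intro conjI ballI allI)
  show "0 \<in> closure S" using subspace_0[OF S] closure_subset by blast
  show "u + v \<in> closure S" if uv: "u \<in> closure S" "v \<in> closure S" for u v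
  proof -
    obtain p q where p: "\<And>n. p n \<in> S" "p \<longlonglongrightarrow> u" and q: "\<And>n. q n \<in> S" "q \<longlonglongrightarrow> v"
      using uv unfolding closure_sequential by auto
    have "(\<lambda>n. p n + q n) \<longlonglongrightarrow> u + v" "\<And>n. p n + q n \<in> S"
      using p q by (auto intro: tendsto_add subspace_add[OF S])
    then show ?thesis unfolding closure_sequential by (intro exI[of _ "\<lambda>n. p n + q n"]) simp
  qed
  show "r *\<^sub>R u \<in> closure S" if u: "u \<in> closure S" for r u
  proof -
    obtain p where p: "\<And>n. p n \<in> S" "p \<longlonglongrightarrow> u" using u unfolding closure_sequential by auto
    have "(\<lambda>n. r *\<^sub>R p n) \<longlonglongrightarrow> r *\<^sub>R u" "\<And>n. r *\<^sub>R p n \<in> S"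
      using p by (auto intro: tendsto_scaleR subspace_scale[OF S])
    then show ?thesis unfolding closure_sequential by (intro exI[of _ "\<lambda>n. r *\<^sub>R p n"]) simp
  qed
qed

definition l2_graph :: "L2_operator \<Rightarrow> (l2 \<times> l2) set" where
  "l2_graph T = (\<lambda>(f, g). (abs_l2 f, abs_l2 g)) ` T"

text \<open>Convergence of both components in \<open>L2_norm\<close> is convergence in the product
  metric, and \<open>closure_op\<close> takes limits with all their representatives, so membership
  depends on the classes only.\<close>

lemma closure_op_iff:
  assumes T: "T \<subseteq> L2 \<times> L2" and f: "f \<in> L2" and g: "g \<in> L2"
  shows "(f, g) \<in> closure_op T \<longleftrightarrow> (abs_l2 f, abs_l2 g) \<in> closure (l2_graph T)"
proof
  assume "(f, g) \<in> closure_op T"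
  then obtain F G where FG: "\<And>k::nat. (F k, G k) \<in> T"
    and lim: "(\<lambda>k. L2_norm (\<lambda>y. F k y - f y)) \<longlonglongrightarrow> 0" "(\<lambda>k. L2_norm (\<lambda>y. G k y - g y)) \<longlonglongrightarrow> 0"
    unfolding closure_op_def by auto
  have FGL: "F k \<in> L2" "G k \<in> L2" for k using FG[of k] T by auto
  have "(\<lambda>k. (abs_l2 (F k), abs_l2 (G k))) \<longlonglongrightarrow> (abs_l2 f, abs_l2 g)"
    using lim FGL f g by (intro tendsto_Pair) (simp_all add: tendsto_abs_l2_iff)
  moreover have "(abs_l2 (F k), abs_l2 (G k)) \<in> l2_graph T" for k
    unfolding l2_graph_def using FG[of k] by (intro image_eqI[of _ _ "(F k, G k)"]) auto
  ultimately show "(abs_l2 f, abs_l2 g) \<in> closure (l2_graph T)"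
    unfolding closure_sequential by (intro exI[of _ "\<lambda>k. (abs_l2 (F k), abs_l2 (G k))"]) simp
next
  assume "(abs_l2 f, abs_l2 g) \<in> closure (l2_graph T)"
  then obtain p where p: "\<And>n. p n \<in> l2_graph T" "p \<longlonglongrightarrow> (abs_l2 f, abs_l2 g)"
    unfolding closure_sequential by auto
  have "\<exists>q. q \<in> T \<and> p n = (abs_l2 (fst q), abs_l2 (snd q))" for n
    using p(1)[of n] unfolding l2_graph_def by auto
  then obtain q where q: "\<And>n. q n \<in> T" "\<And>n. p n = (abs_l2 (fst (q n)), abs_l2 (snd (q n)))" by metis
  have qL: "fst (q n) \<in> L2" "snd (q n) \<in> L2" for n using q(1)[of n] T by auto
  have "(\<lambda>n. abs_l2 (fst (q n))) \<longlonglongrightarrow> abs_l2 f" "(\<lambda>n. abs_l2 (snd (q n))) \<longlonglongrightarrow> abs_l2 g"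
    using tendsto_fst[OF p(2)] tendsto_snd[OF p(2)] q(2) by simp_all
  then have "(\<lambda>n. L2_norm (\<lambda>y. fst (q n) y - f y)) \<longlonglongrightarrow> 0" "(\<lambda>n. L2_norm (\<lambda>y. snd (q n) y - g y)) \<longlonglongrightarrow> 0"
    using qL f g by (simp_all add: tendsto_abs_l2_iff)
  with f g q(1) show "(f, g) \<in> closure_op T"
    unfolding closure_op_def mem_Collect_eq prod.case
    by (intro conjI exI[of _ "\<lambda>n. fst (q n)"] exI[of _ "\<lambda>n. snd (q n)"]) simp_all
qed

lemma closure_op_L2: "(f, g) \<in> closure_op T \<Longrightarrow> f \<in> L2 \<and> g \<in> L2"
  unfolding closure_op_def by auto

lemma closure_l2_graph_cases:
  assumes "T \<subseteq> L2 \<times> L2" "(a, b) \<in> closure (l2_graph T)"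
  obtains f g where "f \<in> L2" "g \<in> L2" "a = abs_l2 f" "b = abs_l2 g" "(f, g) \<in> closure_op T"
proof -
  obtain f where f: "f \<in> L2" "a = abs_l2 f" by (rule abs_l2_cases)
  obtain g where g: "g \<in> L2" "b = abs_l2 g" by (rule abs_l2_cases)
  show ?thesis using that[OF f(1) g(1) f(2) g(2)] closure_op_iff[OF assms(1) f(1) g(1)] assms(2) f(2) g(2) by simp
qed

lemma resolvent_set_regular_value:
  assumes T: "T \<subseteq> L2 \<times> L2" and z: "of_real z \<in> resolvent_set (closure_op T)"
  shows "regular_value (closure (l2_graph T)) z"
  unfolding regular_value_def
proof (intro conjI allI)
  have diff: "abs_l2 g - z *\<^sub>R abs_l2 f = abs_l2 (\<lambda>y. g y - of_real z * f y)" if "f \<in> L2" "g \<in> L2" for f g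
    using that by (simp add: abs_l2_diff L2_mult_const flip: abs_l2_mult_real)
  fix h' :: l2
  obtain h where h: "h \<in> L2" "h' = abs_l2 h" by (rule abs_l2_cases)
  obtain f g where fg: "(f, g) \<in> closure_op T" and eq: "AE y in leb_half_line. g y - of_real z * f y = h y"
    using z h(1) unfolding resolvent_set_def by blast
  have L: "f \<in> L2" "g \<in> L2" using closure_op_L2[OF fg] by auto
  have "abs_l2 g - z *\<^sub>R abs_l2 f = h'"
    unfolding diff[OF L] h(2) using L h(1) eq by (subst abs_l2_eq_iff) (auto intro: L2_diff L2_mult_const)
  moreover have "(abs_l2 f, abs_l2 g) \<in> closure (l2_graph T)" using closure_op_iff[OF T L] fg by simp
  ultimately show "\<exists>(f, g)\<in>closure (l2_graph T). g - z *\<^sub>R f = h'" by blast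
next
  have diff: "abs_l2 g - z *\<^sub>R abs_l2 f = abs_l2 (\<lambda>y. g y - of_real z * f y)" if "f \<in> L2" "g \<in> L2" for f g
    using that by (simp add: abs_l2_diff L2_mult_const flip: abs_l2_mult_real)
  obtain C where C: "\<forall>(f, g)\<in>closure_op T. L2_norm f \<le> C * L2_norm (\<lambda>y. g y - of_real z * f y)"
    using z unfolding resolvent_set_def by blast
  have "norm a \<le> C * norm (b - z *\<^sub>R a)" if ab: "(a, b) \<in> closure (l2_graph T)" for a b
  proof -
    obtain f g where L: "f \<in> L2" "g \<in> L2" and ab': "a = abs_l2 f" "b = abs_l2 g" and fg: "(f, g) \<in> closure_op T"
      by (rule closure_l2_graph_cases[OF T ab])
    have "L2_norm f \<le> C * L2_norm (\<lambda>y. g y - of_real z * f y)" using bspec[OF C fg] by simp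
    then show ?thesis
      unfolding ab' diff[OF L] using L by (subst (1 2) norm_abs_l2) (auto intro: L2_diff L2_mult_const)
  qed
  then show "\<exists>C. \<forall>(f, g)\<in>closure (l2_graph T). norm f \<le> C * norm (g - z *\<^sub>R f)" by blast
qed

text \<open>A real point that is not regular lies in the complex spectrum, hence is isolated there
  with finite multiplicity. The isolating disc meets the real axis in an interval of regular
  points.\<close>

lemma discrete_spectrum_l2_graph:
  assumes T: "T \<subseteq> L2 \<times> L2" and discrete: "discrete_spectrum (closure_op T)"
    and z: "\<not> regular_value (closure (l2_graph T)) z"
  shows "(\<exists>\<delta>>0. \<forall>s. 0 < \<bar>s\<bar> \<and> \<bar>s\<bar> < \<delta> \<longrightarrow> regular_value (closure (l2_graph T)) (z + s)) \<and>
      (\<exists>B. finite B \<and> {f. (f, z *\<^sub>R f) \<in> closure (l2_graph T)} \<subseteq> span B)"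
proof
  have spec: "of_real z \<in> spectrum (closure_op T)"
    using z resolvent_set_regular_value[OF T] unfolding spectrum_def by blast
  then have "of_real z isolated_in spectrum (closure_op T)" and fin: "finite_multiplicity (closure_op T) (of_real z)"
    using discrete unfolding discrete_spectrum_def by auto
  then obtain U where U: "open U" "U \<inter> spectrum (closure_op T) = {of_real z}"
    unfolding isolated_in_def by blast
  then obtain e where e: "e > 0" "ball (complex_of_real z) e \<subseteq> U" using open_contains_ball by blast
  have "regular_value (closure (l2_graph T)) (z + s)" if s: "0 < \<bar>s\<bar>" "\<bar>s\<bar> < e" for s
  proof (rule resolvent_set_regular_value[OF T])
    have "of_real (z + s) \<in> ball (complex_of_real z) e" using s by (simp add: dist_norm)
    then have "of_real (z + s) \<in> U" using e(2) by blast
    moreover have "complex_of_real (z + s) \<noteq> of_real z" using s by (simp del: of_real_add)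
    ultimately have "of_real (z + s) \<notin> spectrum (closure_op T)" using U(2) by blast
    then show "of_real (z + s) \<in> resolvent_set (closure_op T)" unfolding spectrum_def by blast
  qed
  then show "\<exists>\<delta>>0. \<forall>s. 0 < \<bar>s\<bar> \<and> \<bar>s\<bar> < \<delta> \<longrightarrow> regular_value (closure (l2_graph T)) (z + s)"
    using e(1) by blast
  obtain B where B: "finite B" "B \<subseteq> eigenspace (closure_op T) (of_real z)"
    "\<And>f. f \<in> eigenspace (closure_op T) (of_real z) \<Longrightarrow> \<exists>c. AE y in leb_half_line. f y = (\<Sum>b\<in>B. c b * b y)"
    using fin unfolding finite_multiplicity_def by blast
  have BL: "B \<subseteq> L2" using B(2) closure_op_L2 unfolding eigenspace_def by blast
  define B' where "B' = abs_l2 ` B \<union> (\<lambda>b. abs_l2 (\<lambda>y. \<i> * b y)) ` B"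
  have "finite B'" unfolding B'_def using B(1) by simp
  moreover have "a \<in> span B'" if a: "(a, z *\<^sub>R a) \<in> closure (l2_graph T)" for a
  proof -
    obtain f where f: "f \<in> L2" "a = abs_l2 f" by (rule abs_l2_cases)
    have zf: "(\<lambda>y. of_real z * f y) \<in> L2" using f(1) by (rule L2_mult_const)
    have "(f, \<lambda>y. of_real z * f y) \<in> closure_op T"
      using a closure_op_iff[OF T f(1) zf] f by (simp add: abs_l2_mult_real)
    then have "f \<in> eigenspace (closure_op T) (of_real z)" unfolding eigenspace_def by simp
    then obtain c where "AE y in leb_half_line. f y = (\<Sum>b\<in>B. c b * b y)" using B(3) by blast
    then show ?thesis unfolding f(2) B'_def by (rule abs_l2_complex_span[OF B(1) BL f(1)])
  qed
  ultimately show "\<exists>B. finite B \<and> {f. (f, z *\<^sub>R f) \<in> closure (l2_graph T)} \<subseteq> span B" by blast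
qed

text \<open>The vector \<open>v\<close> is split at a point \<open>K\<close> of the half line. The
  tail has small norm and is paired with vectors of norm at most 1; the rest is integrable and is
  paired with functions that are uniformly at most \<open>a k\<close>.\<close>

lemma spreading_weakly_null:
  assumes f: "\<And>k::nat. f k \<in> L2" and a: "a \<longlonglongrightarrow> 0" "\<And>k. 0 \<le> a k"
    and bound: "\<And>k y. y \<ge> 0 \<Longrightarrow> cmod (f k y) \<le> 1" and norm: "\<And>k. norm (a k *\<^sub>R abs_l2 (f k)) \<le> 1"
  shows "(\<lambda>k. (a k *\<^sub>R abs_l2 (f k)) \<bullet> v) \<longlonglongrightarrow> 0"
proof (rule LIMSEQ_I)
  fix e :: real assume "e > 0"
  obtain h where h: "h \<in> L2" "v = abs_l2 h" by (rule abs_l2_cases)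
  define h1 where "h1 K y = h y * indicator {0..real K} y" for K y
  define h2 where "h2 K y = h y * indicator {real K<..} y" for K y
  have meas: "(indicator A :: real \<Rightarrow> complex) \<in> borel_measurable leb_half_line" if "A \<in> sets borel" for A
    using that by (intro measurable_restrict_space1 measurable_completion) auto
  have h1_L2: "h1 K \<in> L2" and h2_L2: "h2 K \<in> L2" for K
    unfolding h1_def h2_def
    by (rule L2I_dominated[OF _ L2_square_integrable[OF h(1)]],
        intro borel_measurable_times L2_measurable[OF h(1)] meas, simp, simp add: indicator_def)+
  have split: "v = abs_l2 (h1 K) + abs_l2 (h2 K)" for K
  proof -
    have "AE y in leb_half_line. h y = h1 K y + h2 K y"
      unfolding h1_def h2_def by (rule AE_I2) (auto simp: indicator_def)
    then show ?thesis
      unfolding h(2) abs_l2_add[OF h1_L2 h2_L2] using abs_l2_eq_iff[OF h(1) L2_add[OF h1_L2 h2_L2]] by blast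
  qed
  have "(\<lambda>K. LINT y|leb_half_line. (cmod (h2 K y))\<^sup>2) \<longlonglongrightarrow> (LINT y|leb_half_line. 0)"
  proof (rule integral_dominated_convergence[OF _ _ L2_square_integrable[OF h(1)]])
    show "AE y in leb_half_line. (\<lambda>K. (cmod (h2 K y))\<^sup>2) \<longlonglongrightarrow> 0"
    proof (rule AE_I2)
      fix y :: real
      obtain N where "y \<le> real N" using real_arch_simple by blast
      then have "\<forall>\<^sub>F K in sequentially. (cmod (h2 K y))\<^sup>2 = 0"
        unfolding eventually_sequentially h2_def by (intro exI[of _ N]) (auto simp: indicator_def)
      then show "(\<lambda>K. (cmod (h2 K y))\<^sup>2) \<longlonglongrightarrow> 0" by (rule tendsto_eventually)
    qed
    show "(\<lambda>y. (cmod (h2 K y))\<^sup>2) \<in> borel_measurable leb_half_line" for K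
      using L2_measurable[OF h2_L2] by simp
    show "AE y in leb_half_line. norm ((cmod (h2 K y))\<^sup>2) \<le> (cmod (h y))\<^sup>2" for K
      unfolding h2_def by (rule AE_I2) (auto simp: indicator_def)
  qed simp
  then have "(\<lambda>K. (norm (abs_l2 (h2 K)))\<^sup>2) \<longlonglongrightarrow> 0"
    by (simp add: norm_abs_l2[OF h2_L2] L2_norm_square)
  then have "\<forall>\<^sub>F K in sequentially. (norm (abs_l2 (h2 K)))\<^sup>2 < (e/2)\<^sup>2"
    by (rule order_tendstoD(2)) (use \<open>e > 0\<close> in simp)
  then obtain K where "(norm (abs_l2 (h2 K)))\<^sup>2 < (e/2)\<^sup>2"
    using eventually_happens'[OF sequentially_bot] by blast
  then have K: "norm (abs_l2 (h2 K)) < e/2" by (rule power2_less_imp_less) (use \<open>e > 0\<close> in simp)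
  define A where "A = (LINT y|leb_half_line. cmod (h1 K y))"
  have h1_int: "integrable leb_half_line (\<lambda>y. cmod (h1 K y))"
  proof -
    have "(indicator {0..real K} :: real \<Rightarrow> complex) \<in> L2"
      by (rule L2I_dominated[OF meas integrable_indicator_half_line[of 0 "real K"]]) (auto simp: indicator_def)
    then show ?thesis unfolding h1_def norm_mult by (rule L2_integrable_mult[OF h(1)])
  qed
  have f_h1: "\<bar>abs_l2 (f k) \<bullet> abs_l2 (h1 K)\<bar> \<le> A" for k
  proof -
    have "\<bar>abs_l2 (f k) \<bullet> abs_l2 (h1 K)\<bar> \<le> (LINT y|leb_half_line. \<bar>f k y \<bullet> h1 K y\<bar>)"
      unfolding abs_l2_inner[OF f h1_L2] by (rule integral_abs_bound)
    also have "\<dots> \<le> A"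
      unfolding A_def
    proof (rule integral_mono)
      show "integrable leb_half_line (\<lambda>y. \<bar>f k y \<bullet> h1 K y\<bar>)"
        by (intro integrable_abs L2_integrable_inner f h1_L2)
      fix y assume "y \<in> space leb_half_line"
      then have "cmod (f k y) \<le> 1" using bound by simp
      then have "cmod (f k y) * cmod (h1 K y) \<le> cmod (h1 K y)" by (simp add: mult_left_le_one_le)
      then show "\<bar>f k y \<bullet> h1 K y\<bar> \<le> cmod (h1 K y)" using Cauchy_Schwarz_ineq2[of "f k y" "h1 K y"] by linarith
    qed (rule h1_int)
    finally show ?thesis .
  qed
  have "(\<lambda>k. a k * A) \<longlonglongrightarrow> 0 * A" by (intro tendsto_intros a)
  then have "\<forall>\<^sub>F k in sequentially. a k * A < e/2" using \<open>e > 0\<close> by (intro order_tendstoD(2)) auto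
  then obtain N where N: "\<And>k. k \<ge> N \<Longrightarrow> a k * A < e/2" unfolding eventually_sequentially by blast
  have "norm ((a k *\<^sub>R abs_l2 (f k)) \<bullet> v - 0) < e" if "k \<ge> N" for k
  proof -
    have "(a k *\<^sub>R abs_l2 (f k)) \<bullet> v = a k * (abs_l2 (f k) \<bullet> abs_l2 (h1 K)) + (a k *\<^sub>R abs_l2 (f k)) \<bullet> abs_l2 (h2 K)"
      by (subst split[of K]) (simp add: inner_add_right distrib_left)
    moreover have "\<bar>a k * (abs_l2 (f k) \<bullet> abs_l2 (h1 K))\<bar> \<le> a k * A"
      using f_h1[of k] a(2)[of k] by (simp add: abs_mult mult_left_mono)
    moreover have "\<bar>(a k *\<^sub>R abs_l2 (f k)) \<bullet> abs_l2 (h2 K)\<bar> \<le> norm (a k *\<^sub>R abs_l2 (f k)) * norm (abs_l2 (h2 K))"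
      by (rule Cauchy_Schwarz_ineq2)
    moreover have "\<dots> \<le> 1 * norm (abs_l2 (h2 K))" by (intro mult_right_mono norm) simp
    ultimately show ?thesis using K N[OF that] unfolding real_norm_def by linarith
  qed
  then show "\<exists>N. \<forall>k\<ge>N. norm ((a k *\<^sub>R abs_l2 (f k)) \<bullet> v - 0) < e" by blast
qed

section \<open>The singular sequence and the contradiction\<close>

context half_line_partition
begin

lemma H_min_L2: "H_min x \<beta> \<subseteq> L2 \<times> L2"
  unfolding H_min_def H_dom_def W22_comp_def W22_def by auto

lemma symmetric_graph_H: "symmetric_graph (closure (l2_graph (H_min x \<beta>)))"
proof
  have comb: "u + c *\<^sub>R v \<in> l2_graph (H_min x \<beta>)" if uv: "u \<in> l2_graph (H_min x \<beta>)" "v \<in> l2_graph (H_min x \<beta>)" for u v c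
  proof -
    obtain f g where fg: "(f, g) \<in> H_min x \<beta>" "u = (abs_l2 f, abs_l2 g)" using uv(1) unfolding l2_graph_def by auto
    obtain h k where hk: "(h, k) \<in> H_min x \<beta>" "v = (abs_l2 h, abs_l2 k)" using uv(2) unfolding l2_graph_def by auto
    have L: "f \<in> L2" "g \<in> L2" "h \<in> L2" "k \<in> L2" using fg(1) hk(1) H_min_L2 by auto
    have "u + c *\<^sub>R v = (abs_l2 (\<lambda>y. f y + of_real c * h y), abs_l2 (\<lambda>y. g y + of_real c * k y))"
      unfolding fg(2) hk(2) using L by (simp add: abs_l2_add[symmetric] L2_mult_const abs_l2_mult_real)
    then show ?thesis
      unfolding l2_graph_def by (intro rev_image_eqI[OF H_min_lincomb[OF fg(1) hk(1), of "of_real c"]]) simp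
  qed
  have zero: "0 \<in> l2_graph (H_min x \<beta>)"
    unfolding l2_graph_def
    by (rule rev_image_eqI[OF zero_in_H_min]) (simp add: zero_prod_def zero_l2.abs_eq)
  have "subspace (l2_graph (H_min x \<beta>))"
    unfolding subspace_def
  proof (intro conjI ballI allI zero)
    show "u + v \<in> l2_graph (H_min x \<beta>)" if "u \<in> l2_graph (H_min x \<beta>)" "v \<in> l2_graph (H_min x \<beta>)" for u v
      using comb[OF that, of 1] by simp
    show "c *\<^sub>R v \<in> l2_graph (H_min x \<beta>)" if "v \<in> l2_graph (H_min x \<beta>)" for c v
      using comb[OF zero that, of c] by simp
  qed
  then show "subspace (closure (l2_graph (H_min x \<beta>)))" by (rule subspace_closure_normed)
  show "closed (closure (l2_graph (H_min x \<beta>)))" by (rule closed_closure)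
  have sym: "snd p \<bullet> fst q = fst p \<bullet> snd q" if pq: "p \<in> l2_graph (H_min x \<beta>)" "q \<in> l2_graph (H_min x \<beta>)" for p q
  proof -
    obtain f g where fg: "(f, g) \<in> H_min x \<beta>" "p = (abs_l2 f, abs_l2 g)" using pq(1) unfolding l2_graph_def by auto
    obtain u v where uv: "(u, v) \<in> H_min x \<beta>" "q = (abs_l2 u, abs_l2 v)" using pq(2) unfolding l2_graph_def by auto
    have "f \<in> L2" "g \<in> L2" "u \<in> L2" "v \<in> L2" using fg(1) uv(1) H_min_L2 by auto
    then show ?thesis unfolding fg(2) uv(2) using H_min_symmetric[OF fg(1) uv(1)] by (simp add: abs_l2_inner)
  qed
  show "g \<bullet> u = f \<bullet> v" if fg: "(f, g) \<in> closure (l2_graph (H_min x \<beta>))" and uv: "(u, v) \<in> closure (l2_graph (H_min x \<beta>))"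
    for f g u v
  proof -
    obtain p where p: "\<And>n. p n \<in> l2_graph (H_min x \<beta>)" "p \<longlonglongrightarrow> (f, g)" using fg unfolding closure_sequential by auto
    obtain q where q: "\<And>n. q n \<in> l2_graph (H_min x \<beta>)" "q \<longlonglongrightarrow> (u, v)" using uv unfolding closure_sequential by auto
    have "(\<lambda>n. snd (p n) \<bullet> fst (q n)) \<longlonglongrightarrow> g \<bullet> u"
      using tendsto_inner[OF tendsto_snd[OF p(2)] tendsto_fst[OF q(2)]] by simp
    moreover have "(\<lambda>n. fst (p n) \<bullet> snd (q n)) \<longlonglongrightarrow> f \<bullet> v"
      using tendsto_inner[OF tendsto_fst[OF p(2)] tendsto_snd[OF q(2)]] by simp
    ultimately show ?thesis using sym[OF p(1) q(1)] by (simp add: LIMSEQ_unique)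
  qed
qed

text \<open>Both cases of the theorem are brought to this condition on blocks of consecutive
  intervals. The bound \<open>c\<close> compares 36 / S with the squared norm of the test function,
  and the growing lower bound of \<open>x i\<close> makes the normalizing factors tend to 0.\<close>

proposition not_discrete_spectrum:
  assumes "c > 0" and blocks: "\<And>k::nat. \<exists>i p. p > 0 \<and> real k + 1 \<le> x i \<and>
      c \<le> x i * (\<Sum>j<p. (x (Suc (i + j)) - x (i + j)) ^ 3)"
  shows "\<not> discrete_spectrum (H_op x \<beta>)"
proof
  assume discrete: "discrete_spectrum (H_op x \<beta>)"
  define good where "good k f g \<longleftrightarrow> (f, g) \<in> H_min x \<beta> \<and> (\<forall>y\<ge>0. cmod (f y) \<le> 1) \<and>
      real k + 1 \<le> (L2_norm f)\<^sup>2 \<and> (L2_norm g)\<^sup>2 \<le> 36 / c * (L2_norm f)\<^sup>2" for k f g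
  have "\<exists>f g. good k f g" for k :: nat
  proof -
    obtain i p where ip: "p > 0" "real k + 1 \<le> x i" "c \<le> x i * (\<Sum>j<p. (x (Suc (i + j)) - x (i + j)) ^ 3)"
      using blocks[of k] by blast
    define S where "S = (\<Sum>j<p. (x (Suc (i + j)) - x (i + j)) ^ 3)"
    have "S > 0" unfolding S_def using ip(1) by (intro sum_pos) (auto simp: x_less_iff)
    obtain f g where fg: "(f, g) \<in> H_min x \<beta>" "\<forall>y\<ge>0. cmod (f y) \<le> 1"
      "(L2_norm f)\<^sup>2 \<ge> x i" "(L2_norm g)\<^sup>2 \<le> 36 / S"
      by (rule test_function_exists[OF ip(1), where i = i and \<beta> = \<beta>, folded S_def]) blast
    have "c \<le> (L2_norm f)\<^sup>2 * S"
      using ip(3) mult_right_mono[OF fg(3), of S] \<open>S > 0\<close> unfolding S_def[symmetric] by linarith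
    then have "36 / S \<le> 36 / c * (L2_norm f)\<^sup>2" using \<open>c > 0\<close> \<open>S > 0\<close> by (simp add: field_simps)
    then have "(L2_norm g)\<^sup>2 \<le> 36 / c * (L2_norm f)\<^sup>2" using fg(4) by linarith
    moreover have "real k + 1 \<le> (L2_norm f)\<^sup>2" using ip(2) fg(3) by linarith
    ultimately show ?thesis unfolding good_def using fg(1,2) by (intro exI[of _ f] exI[of _ g]) simp
  qed
  then obtain f g where "\<And>k. good k (f k) (g k)" by metis
  then have fg: "\<And>k. (f k, g k) \<in> H_min x \<beta>" and f_le: "\<And>k y. y \<ge> 0 \<Longrightarrow> cmod (f k y) \<le> 1"
    and f_ge: "\<And>k. real k + 1 \<le> (L2_norm (f k))\<^sup>2" and g_le: "\<And>k. (L2_norm (g k))\<^sup>2 \<le> 36 / c * (L2_norm (f k))\<^sup>2"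
    unfolding good_def by simp_all
  have L: "f k \<in> L2" "g k \<in> L2" for k using fg[of k] H_min_L2 by auto
  define a where "a k = 1 / L2_norm (f k)" for k
  have nonneg: "0 \<le> L2_norm (f k)" for k by (simp flip: norm_abs_l2[OF L(1)])
  have pos: "L2_norm (f k) > 0" for k
    using f_ge[of k] nonneg[of k] by (cases "L2_norm (f k) = 0") auto
  have a_nonneg: "0 \<le> a k" for k unfolding a_def using nonneg by simp
  have a_le: "a k \<le> sqrt (1 / (real k + 1))" for k
  proof (rule real_le_rsqrt)
    show "(a k)\<^sup>2 \<le> 1 / (real k + 1)"
      unfolding a_def power_divide using f_ge[of k] by (simp add: frac_le)
  qed
  have a_lim: "a \<longlonglongrightarrow> 0"
  proof (rule tendsto_sandwich[of "\<lambda>_. 0"])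
    have "(\<lambda>k. sqrt (1 / real (Suc k))) \<longlonglongrightarrow> sqrt 0"
      by (intro tendsto_real_sqrt LIMSEQ_Suc lim_1_over_n)
    then show "(\<lambda>k. sqrt (1 / (real k + 1))) \<longlonglongrightarrow> 0" by (simp add: add.commute)
  qed (use a_nonneg a_le in auto)
  interpret symmetric_graph "closure (l2_graph (H_min x \<beta>))" by (rule symmetric_graph_H)
  have norm_u: "norm (a k *\<^sub>R abs_l2 (f k)) = 1" for k
    unfolding a_def using pos[of k] by (simp add: norm_abs_l2[OF L(1)])
  show False
  proof (rule weakly_null_not_normalized[of "\<lambda>k. a k *\<^sub>R abs_l2 (f k)" "\<lambda>k. a k *\<^sub>R abs_l2 (g k)" "sqrt (36 / c)"])
    show "(a k *\<^sub>R abs_l2 (f k), a k *\<^sub>R abs_l2 (g k)) \<in> closure (l2_graph (H_min x \<beta>))" for k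
    proof (rule scale_T)
      have "(abs_l2 (f k), abs_l2 (g k)) \<in> l2_graph (H_min x \<beta>)"
        unfolding l2_graph_def by (rule rev_image_eqI[OF fg[of k]]) simp
      then show "(abs_l2 (f k), abs_l2 (g k)) \<in> closure (l2_graph (H_min x \<beta>))" using closure_subset by blast
    qed
    show "norm (a k *\<^sub>R abs_l2 (g k)) \<le> sqrt (36 / c)" for k
    proof (rule real_le_rsqrt)
      have "(norm (a k *\<^sub>R abs_l2 (g k)))\<^sup>2 = (L2_norm (g k))\<^sup>2 / (L2_norm (f k))\<^sup>2"
        unfolding a_def by (simp add: norm_abs_l2[OF L(2)] power_mult_distrib power_divide)
      also have "\<dots> \<le> 36 / c" using g_le[of k] pos[of k] by (subst pos_divide_le_eq) auto
      finally show "(norm (a k *\<^sub>R abs_l2 (g k)))\<^sup>2 \<le> 36 / c" .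
    qed
    show "(\<lambda>k. (a k *\<^sub>R abs_l2 (f k)) \<bullet> v) \<longlonglongrightarrow> 0" for v
      by (rule spreading_weakly_null[OF L(1) a_lim a_nonneg f_le]) (use norm_u in auto)
  qed (fact norm_u discrete_spectrum_l2_graph[OF H_min_L2 discrete[unfolded H_op_def]])+
qed

end

theorem corollary6p12:
  fixes x \<beta> :: "nat \<Rightarrow> real"
  assumes "x 0 = 0" and "strict_mono x" and "filterlim x at_top sequentially"
    and "bdd_above (gap x ` {1..})"
    and "\<And>n. n \<ge> 1 \<Longrightarrow> \<beta> n \<noteq> 0"
    and "gap x \<notin> ell 3 \<or>
         (gap x \<in> ell 3 \<and>
          (\<exists>L::ereal. (\<lambda>n. ereal (x n * (\<Sum>j. gap x (n + j) ^ 3))) \<longlonglongrightarrow> L \<and> L > 0))"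
  shows "\<not> discrete_spectrum (H_op x \<beta>)"
proof -
  interpret half_line_partition x by unfold_locales (use assms in auto)
  define s where "s i p = (\<Sum>j<p. (x (Suc (i + j)) - x (i + j)) ^ 3)" for i p
  \<comment> \<open>\<open>gap x n\<close> is the length of the interval that ends at
    \<open>x n\<close>, so a block that starts at \<open>x i\<close> has gaps from index
    \<open>Suc i\<close> on.\<close>
  have gap_Suc: "gap x (Suc i + j) = x (Suc (i + j)) - x (i + j)" for i j by (simp add: gap_def)
  have gap_pos: "0 < gap x (Suc n)" for n by (simp add: gap_def x_less_iff)
  have x_large: "\<exists>N. \<forall>i\<ge>N. r \<le> x i" for r
    using assms(3) unfolding filterlim_at_top eventually_sequentially by blast
  have sum_gap: "(\<Sum>j<p. gap x (Suc i + j) ^ 3) = s i p" for i p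
    unfolding s_def gap_Suc ..
  have ell: "gap x \<in> ell 3 \<longleftrightarrow> summable (\<lambda>j. gap x (Suc i + j) ^ 3)" for i
  proof -
    have "gap x \<in> ell 3 \<longleftrightarrow> summable (\<lambda>n. gap x (Suc n) ^ 3)"
      unfolding ell_def using gap_pos by (simp add: less_imp_le)
    also have "\<dots> \<longleftrightarrow> summable (\<lambda>j. gap x (Suc (j + i)) ^ 3)" by (rule summable_iff_shift[symmetric])
    finally show ?thesis by (simp add: add.commute)
  qed
  have "\<exists>c>0. \<forall>k::nat. \<exists>i p. p > 0 \<and> real k + 1 \<le> x i \<and> c \<le> x i * s i p"
    using assms(6)
  proof (elim disjE conjE exE)
    assume nsum: "gap x \<notin> ell 3"
    have "\<exists>i p. p > 0 \<and> real k + 1 \<le> x i \<and> 1 \<le> x i * s i p" for k :: nat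
    proof -
      obtain i where i: "real k + 1 \<le> x i" using x_large by blast
      \<comment> \<open>Every tail of a divergent series of positive terms has a partial sum above
        1. As \<open>x i\<close> is at least 1, the constant 1 serves in this case.\<close>
      have "\<exists>p. 1 < s i p"
      proof (rule ccontr)
        assume "\<not> ?thesis"
        then have "\<And>p. (\<Sum>j<p. gap x (Suc i + j) ^ 3) \<le> 1" unfolding sum_gap by (simp add: not_less)
        then have "summable (\<lambda>j. gap x (Suc i + j) ^ 3)"
          using gap_pos by (intro summableI_nonneg_bounded) (auto simp: less_imp_le)
        then show False using nsum ell by blast
      qed
      then obtain p where p: "1 < s i p" by blast
      then have "p > 0" unfolding s_def by (cases p) auto
      moreover have "1 * 1 \<le> x i * s i p" using i p by (intro mult_mono) auto
      ultimately show ?thesis using i by auto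
    qed
    then show ?thesis by (intro exI[of _ 1]) auto
  next
    fix L :: ereal
    assume sum: "gap x \<in> ell 3" and lim: "(\<lambda>n. ereal (x n * (\<Sum>j. gap x (n + j) ^ 3))) \<longlonglongrightarrow> L" and "L > 0"
    \<comment> \<open>The limit is an extended real and may be infinite, so a finite positive number
      strictly below it is chosen.\<close>
    obtain c where c: "0 < c" "ereal c < L" using ereal_dense2[OF \<open>L > 0\<close>] by auto
    obtain N where N: "\<And>n. n \<ge> N \<Longrightarrow> c < x n * (\<Sum>j. gap x (n + j) ^ 3)"
      using order_tendstoD(1)[OF lim c(2)] unfolding eventually_sequentially by auto
    obtain D where D: "\<And>n. gap x (Suc n) \<le> D"
      using assms(4) unfolding bdd_above_def by auto
    have "\<exists>i p. p > 0 \<and> real k + 1 \<le> x i \<and> c / 2 \<le> x i * s i p" for k :: nat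
    proof -
      obtain M where M: "\<And>i. i \<ge> M \<Longrightarrow> max (real k + 1) D \<le> x i" using x_large by blast
      define i where "i = max N M"
      have i: "real k + 1 \<le> x i" "D \<le> x i" "Suc i \<ge> N" using M[of i] unfolding i_def by auto
      \<comment> \<open>The hypothesis weights the gaps after \<open>x i\<close> with
        \<open>x (Suc i)\<close>, while the test function equals 1 only up to \<open>x i\<close>. As
        the gap is at most \<open>D\<close> and \<open>D\<close> at most \<open>x i\<close>, the
        shift costs a factor 2, whence c / 2.\<close>
      have "x (Suc i) \<le> 2 * x i" using D[of i] i(2) by (simp add: gap_def)
      have pos: "0 < x (Suc i)" using i(1) x_less_iff[of i "Suc i"] by simp
      have "summable (\<lambda>j. gap x (Suc i + j) ^ 3)" using sum ell by blast
      then have "(\<lambda>p. \<Sum>j<p. gap x (Suc i + j) ^ 3) \<longlonglongrightarrow> (\<Sum>j. gap x (Suc i + j) ^ 3)" by (rule summable_LIMSEQ)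
      then have "(\<lambda>p. x (Suc i) * s i p) \<longlonglongrightarrow> x (Suc i) * (\<Sum>j. gap x (Suc i + j) ^ 3)"
        unfolding sum_gap by (intro tendsto_intros)
      \<comment> \<open>The bound for the infinite tail is strict, so a finite block already exceeds
        it and the test function can have compact support.\<close>
      then have "\<forall>\<^sub>F p in sequentially. c < x (Suc i) * s i p" by (rule order_tendstoD(1)) (rule N[OF i(3)])
      then obtain p where p: "c < x (Suc i) * s i p" using eventually_happens'[OF sequentially_bot] by blast
      have "p > 0" using p c(1) unfolding s_def by (cases p) auto
      have "0 \<le> s i p" unfolding s_def by (intro sum_nonneg) (auto simp: x_less_iff less_imp_le)
      then have "x (Suc i) * s i p \<le> 2 * x i * s i p" using \<open>x (Suc i) \<le> 2 * x i\<close> by (intro mult_right_mono)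
      then show ?thesis using p \<open>p > 0\<close> i(1) by (intro exI[of _ i] exI[of _ p]) auto
    qed
    then show ?thesis using c(1) by (intro exI[of _ "c / 2"]) auto
  qed
  then obtain c where "c > 0" "\<And>k::nat. \<exists>i p. p > 0 \<and> real k + 1 \<le> x i \<and> c \<le> x i * s i p" by blast
  then show ?thesis unfolding s_def by (rule not_discrete_spectrum)
qed

end
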